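(* Let $\varphi$ be an equation in the language of group theory with $k$ free variables, and assume that $\varphi$ transfers. Let $G$ be a finitely generated, virtually nilpotent group equipped with a sequence of densities $\mu = (\mu_n)_{n}$ that measures index uniformly. Then $\mathrm{ds}_{(G,\mu)}(\varphi) > 0$ if and only if $\varphi$ holds virtually in $G$.
   Context: An equation $\varphi$ holds virtually in a group $K$ (is a virtual law in $K$) if there is a finite index subgroup $L \leq K$ such that $\varphi(x_1,\dots,x_k)$ holds for all $x_1,\dots,x_k \in L$. An equation $\varphi$ with $k$ free variables transfers (from cosets to subgroups) if for each group $G$ and subgroup $H<G$ (not necessarily proper) the following holds: if there are elements $g_1,\dots,g_k \in G$ such that $\varphi(x_1,\dots,x_k)$ holds for all $x_1 \in g_1H, \dots, x_k \in g_kH$, then $\varphi$ is a virtual law in $H$. A density on $G$ is a finitely additive probability measure on $G$ (defined on all subsets of $G$). A sequence $n \mapsto \mu_n$ of densities on $G$ measures index uniformly if $\mu_n(gH)$ converges to $\frac{1}{[G:H]}$ as $n \to \infty$, uniformly over all elements $g \in G$ and all subgroups $H < G$ (with $\frac{1}{[G:H]} = 0$ when the index is infinite). For an equation $\varphi$ with $k$ free variables, the degree of satisfiability with respect to $\mu$ is $\mathrm{ds}_{(G,\mu)}(\varphi) = \limsup_{n \to \infty} \mu_n^k(\{\overline{x} \in G^k : \varphi(\overline{x})\})$, where $\mu_n^k$ is the $k$-fold product of $\mu_n$ on $G^k$, given by iterated integration: $\mu_n^k(A) = \int \cdots \int 1_A(x_1,\dots,x_k)\, d\mu_n(x_1) \cdots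 d\mu_n(x_k)$. *)

theory Defs
  imports
    "HOL-Algebra.Generated_Groups"
    "HOL-Algebra.Left_Coset"
    "HOL-Library.Disjoint_Sets"
    "HOL-Library.Extended_Real"
    "HOL-Library.Liminf_Limsup"
    "HOL-Analysis.Uniform_Limit"
begin

section \<open>Equations in the language of groups\<close>

datatype gterm = Var nat | One | Inv gterm | Mul gterm gterm

datatype equation = Eq gterm gterm

fun gterm_vars :: "gterm \<Rightarrow> nat set" where
  "gterm_vars (Var i) = {i}"
| "gterm_vars One = {}"
| "gterm_vars (Inv t) = gterm_vars t"
| "gterm_vars (Mul s t) = gterm_vars s \<union> gterm_vars t"

fun equation_vars :: "equation \<Rightarrow> nat set" where
  "equation_vars (Eq s t) = gterm_vars s \<union> gterm_vars t"

text \<open>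
  A \<open>k\<close>-tuple is a list of length \<open>k\<close>; the variable \<open>Var i\<close> denotes its entry with index \<open>i\<close>,
  counted from 0. An equation in the variables \<open>x\<^sub>1, \<dots>, x\<^sub>k\<close> is one with
  \<open>equation_vars \<phi> \<subseteq> {..<k}\<close>.
\<close>

definition tuples :: "nat \<Rightarrow> 'a set \<Rightarrow> 'a list set" where
  "tuples k A = {xs. length xs = k \<and> set xs \<subseteq> A}"

fun gterm_val :: "('a, 'b) monoid_scheme \<Rightarrow> 'a list \<Rightarrow> gterm \<Rightarrow> 'a" where
  "gterm_val G xs (Var i) = xs ! i"
| "gterm_val G xs One = \<one>\<^bsub>G\<^esub>"
| "gterm_val G xs (Inv t) = inv\<^bsub>G\<^esub> (gterm_val G xs t)"
| "gterm_val G xs (Mul s t) = gterm_val G xs s \<otimes>\<^bsub>G\<^esub> gterm_val G xs t"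

fun holds :: "('a, 'b) monoid_scheme \<Rightarrow> equation \<Rightarrow> 'a list \<Rightarrow> bool" where
  "holds G (Eq s t) xs \<longleftrightarrow> gterm_val G xs s = gterm_val G xs t"

section \<open>Finite index, virtual laws, transfer\<close>

definition finite_index :: "('a, 'b) monoid_scheme \<Rightarrow> 'a set \<Rightarrow> bool" where
  "finite_index G H \<longleftrightarrow> finite (lcosets\<^bsub>G\<^esub> H)"

definition inverse_index :: "('a, 'b) monoid_scheme \<Rightarrow> 'a set \<Rightarrow> real" where
  "inverse_index G H = (if finite_index G H then 1 / real (card (lcosets\<^bsub>G\<^esub> H)) else 0)"

definition virtual_law :: "('a, 'b) monoid_scheme \<Rightarrow> nat \<Rightarrow> equation \<Rightarrow> bool" where
  "virtual_law K k \<phi> \<longleftrightarrow>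
     (\<exists>L. subgroup L K \<and> finite_index K L \<and> (\<forall>xs \<in> tuples k L. holds K \<phi> xs))"

text \<open>
  HOL cannot quantify over all types inside a formula, so the universe of the quantified groups is
  an explicit type argument: \<open>transfers TYPE('a) k \<phi>\<close> is about all groups whose elements
  are of type \<open>'a\<close>. As a hypothesis it is implied by transfer for all groups whatsoever.
\<close>

definition transfers :: "'a itself \<Rightarrow> nat \<Rightarrow> equation \<Rightarrow> bool" where
  "transfers _ k \<phi> \<longleftrightarrow>
     (\<forall>(G :: 'a monoid) H. group G \<and> subgroup H G \<longrightarrow>
        (\<exists>gs \<in> tuples k (carrier G).
           \<forall>xs. list_all2 (\<lambda>x g. x \<in> g <#\<^bsub>G\<^esub> H) xs gs \<longrightarrow> holds G \<phi> xs) \<longrightarrow>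
        virtual_law (G\<lparr>carrier := H\<rparr>) k \<phi>)"

section \<open>Finitely generated and virtually nilpotent groups\<close>

definition finitely_generated_group :: "('a, 'b) monoid_scheme \<Rightarrow> bool" where
  "finitely_generated_group G \<longleftrightarrow>
     group G \<and> (\<exists>S. finite S \<and> S \<subseteq> carrier G \<and> generate G S = carrier G)"

primrec lower_central_series :: "('a, 'b) monoid_scheme \<Rightarrow> nat \<Rightarrow> 'a set" where
  "lower_central_series G 0 = carrier G"
| "lower_central_series G (Suc n) =
     generate G {x \<otimes>\<^bsub>G\<^esub> y \<otimes>\<^bsub>G\<^esub> inv\<^bsub>G\<^esub> x \<otimes>\<^bsub>G\<^esub> inv\<^bsub>G\<^esub> y | x y.
       x \<in> lower_central_series G n \<and> y \<in> carrier G}"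

definition nilpotent_group :: "('a, 'b) monoid_scheme \<Rightarrow> bool" where
  "nilpotent_group G \<longleftrightarrow> group G \<and> (\<exists>c. lower_central_series G c = {\<one>\<^bsub>G\<^esub>})"

definition virtually_nilpotent_group :: "('a, 'b) monoid_scheme \<Rightarrow> bool" where
  "virtually_nilpotent_group G \<longleftrightarrow>
     group G \<and> (\<exists>H. subgroup H G \<and> finite_index G H \<and> nilpotent_group (G\<lparr>carrier := H\<rparr>))"

section \<open>Densities and degree of satisfiability\<close>

definition density_on :: "'a set \<Rightarrow> ('a set \<Rightarrow> real) \<Rightarrow> bool" where
  "density_on \<Omega> m \<longleftrightarrow>
     (\<forall>A. A \<subseteq> \<Omega> \<longrightarrow> 0 \<le> m A) \<and> m \<Omega> = 1 \<and>
     (\<forall>A B. A \<subseteq> \<Omega> \<and> B \<subseteq> \<Omega> \<and> A \<inter> B = {} \<longrightarrow> m (A \<union> B) = m A + m B)"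

text \<open>
  Integral of a bounded function with respect to a finitely additive measure: the supremum of the
  lower sums over finite partitions. As every subset of \<open>\<Omega>\<close> is measurable, so is every function,
  and the infimum of the upper sums gives the same value. Only used for functions with values
  in \<open>[0, 1]\<close>; for unbounded functions \<open>Inf\<close> and \<open>Sup\<close> are meaningless here.
\<close>

definition density_integral :: "'a set \<Rightarrow> ('a set \<Rightarrow> real) \<Rightarrow> ('a \<Rightarrow> real) \<Rightarrow> real" where
  "density_integral \<Omega> m f =
     (SUP P \<in> {P. finite P \<and> partition_on \<Omega> P}. \<Sum>A\<in>P. (INF x\<in>A. f x) * m A)"

text \<open>
  \<open>\<integral> \<dots> \<integral> f(x\<^sub>1, \<dots>, x\<^sub>k) dm(x\<^sub>1) \<dots> dm(x\<^sub>k)\<close>: the innermost integration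
  is over \<open>x\<^sub>1\<close> and the outermost over \<open>x\<^sub>k\<close>, hence the recursion splits off the last
  entry. The order matters, as Fubini fails for finitely additive measures.
\<close>

primrec iterated_integral ::
    "'a set \<Rightarrow> ('a set \<Rightarrow> real) \<Rightarrow> nat \<Rightarrow> ('a list \<Rightarrow> real) \<Rightarrow> real" where
  "iterated_integral \<Omega> m 0 f = f []"
| "iterated_integral \<Omega> m (Suc k) f =
     density_integral \<Omega> m (\<lambda>x. iterated_integral \<Omega> m k (\<lambda>xs. f (xs @ [x])))"

definition product_density ::
    "'a set \<Rightarrow> ('a set \<Rightarrow> real) \<Rightarrow> nat \<Rightarrow> 'a list set \<Rightarrow> real" where
  "product_density \<Omega> m k A = iterated_integral \<Omega> m k (indicator A)"

definition measures_index_uniformly ::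
    "('a, 'b) monoid_scheme \<Rightarrow> (nat \<Rightarrow> 'a set \<Rightarrow> real) \<Rightarrow> bool" where
  "measures_index_uniformly G \<mu> \<longleftrightarrow>
     uniform_limit (carrier G \<times> {H. subgroup H G})
       (\<lambda>n (g, H). \<mu> n (g <#\<^bsub>G\<^esub> H)) (\<lambda>(g, H). inverse_index G H) sequentially"

definition degree_of_satisfiability ::
    "('a, 'b) monoid_scheme \<Rightarrow> (nat \<Rightarrow> 'a set \<Rightarrow> real) \<Rightarrow> nat \<Rightarrow> equation \<Rightarrow> ereal" where
  "degree_of_satisfiability G \<mu> k \<phi> =
     limsup (\<lambda>n. ereal (product_density (carrier G) (\<mu> n) k
                          {xs \<in> tuples k (carrier G). holds G \<phi> xs}))"

end

theory Submission
  imports Defs "HOL-Computational_Algebra.Primes"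
begin

text \<open>
  If \<open>\<phi>\<close> holds on a subgroup \<open>L\<close> of finite index, then the solutions contain \<open>L\<^sup>k\<close>, whose density tends
  to \<open>[G:L]\<^sup>-\<^sup>k > 0\<close>. The work is in the other direction.

  Fix a torsion-free nilpotent normal subgroup \<open>N\<close> of finite index
  (\<open>torsion_free_nilpotent_normal_subgroup\<close>). If \<open>\<phi>\<close> holds identically on some product
  \<open>g\<^sub>1N \<times> \<dots> \<times> g\<^sub>kN\<close> of cosets, then transfer makes \<open>\<phi>\<close> a virtual law in \<open>N\<close>, hence in \<open>G\<close>.
  Otherwise each such product contains a non-solution, and it has to be shown that the degree of
  satisfiability is zero.

  Since the densities of cosets converge to the inverse of the index, the degree is at most the
  proportion of solutions in the \<open>k\<close>-th power of any finite quotient \<open>G/M\<close>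
  (\<open>degree_le_finite_quotient\<close>). So it is enough to make that proportion small by a good choice of \<open>M\<close>.
  Given \<open>T \<ge> 2\<^sup>c\<close>, where \<open>c\<close> is the nilpotency class of \<open>N\<close>, take a prime \<open>p > T\<close>. The group \<open>N\<close> is
  residually a finite \<open>p\<close>-group (\<open>torsion_free_residually_p\<close>), and there are only finitely many
  products of cosets of \<open>N\<close>; hence for large \<open>s\<close> the subgroup \<open>M\<close> generated by the \<open>p\<^sup>s\<close>-th powers
  of elements of \<open>N\<close> is so small that one chosen non-solution in each product remains a
  non-solution in \<open>G/M\<close>.

  Now \<open>A = N/M\<close> is a finite group of exponent dividing \<open>p\<^sup>s\<close>, nilpotent of class at most \<open>c\<close>.
  Let \<open>x\<close> be a non-solution in a product of cosets of \<open>A\<close>, and let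
  \<open>h \<in> A\<^sup>k\<close>. Writing \<open>\<phi>\<close> as \<open>w(x) = 1\<close>, the sequence \<open>n \<mapsto> w(xh\<^sup>n)\<close> is polynomial in the sense of
  Lazard and Leibman (\<open>poly_upto_group\<close>): in the first central factor of \<open>A\<close> that detects it, it is
  an integer polynomial of degree less than \<open>2\<^sup>c\<close>. A nonzero such polynomial with values in an
  abelian \<open>p\<close>-group has fewer than \<open>2\<^sup>c\<close> zeros in \<open>{0, \<dots>, T}\<close>, because nonzero differences
  of these numbers are invertible modulo \<open>p\<close> (\<open>poly_seq_few_ones\<close>). On the other hand, for \<open>1 \<le> n \<le> T\<close> the
  map \<open>h \<mapsto> xh\<^sup>n\<close> is a bijection onto the product of cosets, as \<open>n\<close> is prime to \<open>p\<close>. Averaging over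
  these \<open>n\<close> bounds the proportion of solutions in the product by \<open>2\<^sup>c / T\<close>
  (\<open>coset_few_solutions\<close>). As \<open>T\<close> was arbitrary, the degree is zero.
\<close>

section \<open>Commutators\<close>

definition commutator :: "('a, 'b) monoid_scheme \<Rightarrow> 'a \<Rightarrow> 'a \<Rightarrow> 'a" where
  "commutator G x y = x \<otimes>\<^bsub>G\<^esub> y \<otimes>\<^bsub>G\<^esub> inv\<^bsub>G\<^esub> x \<otimes>\<^bsub>G\<^esub> inv\<^bsub>G\<^esub> y"

context group begin

lemma cancel_inv_left:
  assumes "x \<in> carrier G" "y \<in> carrier G"
  shows "inv x \<otimes> (x \<otimes> y) = y" "x \<otimes> (inv x \<otimes> y) = y"
  using assms by (simp_all flip: m_assoc)

lemmas group_word_simps = m_assoc inv_mult_group cancel_inv_left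

lemma commutator_closed [simp, intro]:
  "x \<in> carrier G \<Longrightarrow> y \<in> carrier G \<Longrightarrow> commutator G x y \<in> carrier G"
  by (simp add: commutator_def)

lemma commutator_mult_self:
  assumes "x \<in> carrier G" "y \<in> carrier G"
  shows "commutator G x y \<otimes> y = x \<otimes> y \<otimes> inv x"
  using assms by (simp add: commutator_def group_word_simps)

lemma commutator_mult_left:
  assumes "x \<in> carrier G" "y \<in> carrier G" "z \<in> carrier G"
  shows "commutator G (x \<otimes> y) z =
    commutator G x (commutator G y z) \<otimes> (commutator G y z \<otimes> commutator G x z)"
  using assms by (simp add: commutator_def group_word_simps)

lemma commutator_mult_right:
  assumes "x \<in> carrier G" "y \<in> carrier G" "z \<in> carrier G"
  shows "commutator G x (y \<otimes> z) =
    commutator G x y \<otimes> (commutator G y (commutator G x z) \<otimes> commutator G x z)"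
  using assms by (simp add: commutator_def group_word_simps)

end

section \<open>Polynomial sequences in a filtered group\<close>

text \<open>
  The commutator condition makes \<open>F 1 \<ge> F 2 \<ge> \<dots>\<close> a descending series of normal subgroups of \<open>G\<close> with
  factors that are central in \<open>F 1\<close>. Only weight \<open>0\<close> is required to be the whole group; so arbitrary
  constants may occur in polynomial sequences, although \<open>G\<close> itself need not be nilpotent.
\<close>

locale filtered_group = group G for G (structure) +
  fixes F :: "nat \<Rightarrow> 'a set"
  assumes F_0: "F 0 = carrier G"
    and F_subgroup: "subgroup (F i) G"
    and F_Suc_subset: "F (Suc i) \<subseteq> F i"
    and F_commutator: "x \<in> F i \<Longrightarrow> y \<in> F j \<Longrightarrow> commutator G x y \<in> F (i + j)"
begin

lemma F_carrier: "x \<in> F i \<Longrightarrow> x \<in> carrier G"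
  using subgroup.subset[OF F_subgroup] by blast

definition seq_diff :: "(nat \<Rightarrow> 'a) \<Rightarrow> nat \<Rightarrow> 'a" where
  "seq_diff f n = f (Suc n) \<otimes> inv (f n)"

text \<open>
  \<open>poly_upto m i f\<close> says that for \<open>l \<le> m\<close> the \<open>l\<close>-fold difference of \<open>f\<close> takes values in
  \<open>F (i + l)\<close>. A sequence is polynomial of weight \<open>i\<close> if this holds for all \<open>m\<close>; the cut-off \<open>m\<close> exists
  because closure under the group operations is proved by induction on it.
\<close>

primrec poly_upto :: "nat \<Rightarrow> nat \<Rightarrow> (nat \<Rightarrow> 'a) \<Rightarrow> bool" where
  "poly_upto 0 i f \<longleftrightarrow> (\<forall>n. f n \<in> F i)"
| "poly_upto (Suc m) i f \<longleftrightarrow> (\<forall>n. f n \<in> F i) \<and> poly_upto m (Suc i) (seq_diff f)"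

lemma poly_upto_in_F: "poly_upto m i f \<Longrightarrow> f n \<in> F i"
  by (cases m) auto

lemma poly_upto_closed: "poly_upto m i f \<Longrightarrow> f n \<in> carrier G"
  using poly_upto_in_F F_carrier by blast

lemma poly_upto_Suc_level: "poly_upto m (Suc i) f \<Longrightarrow> poly_upto m i f"
  by (induction m arbitrary: i f) (auto intro: subsetD[OF F_Suc_subset])

lemma poly_upto_level_mono: "poly_upto m j f \<Longrightarrow> i \<le> j \<Longrightarrow> poly_upto m i f"
  by (induction j) (auto simp: le_Suc_eq dest: poly_upto_Suc_level)

lemma poly_upto_lower_order: "poly_upto (Suc m) i f \<Longrightarrow> poly_upto m i f"
  by (induction m arbitrary: i f) auto

lemma poly_upto_const: "c \<in> F i \<Longrightarrow> poly_upto m i (\<lambda>n. c)"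
proof (induction m arbitrary: i c)
  case (Suc m)
  have "seq_diff (\<lambda>n. c) = (\<lambda>n. \<one>)"
    using Suc.prems F_carrier by (auto simp: seq_diff_def fun_eq_iff)
  then show ?case using Suc subgroup.one_closed[OF F_subgroup] by auto
qed auto

lemma poly_upto_shift: "poly_upto m i f \<Longrightarrow> poly_upto m i (\<lambda>n. f (Suc n))"
proof (induction m arbitrary: i f)
  case (Suc m)
  have "seq_diff (\<lambda>n. f (Suc n)) = (\<lambda>n. seq_diff f (Suc n))"
    by (simp add: seq_diff_def fun_eq_iff)
  then show ?case using Suc by auto
qed auto

text \<open>
  The Lazard--Leibman theorem: polynomial sequences form a group, and commutators add weights. The
  difference of a product, an inverse or a commutator of sequences is a product of differences of the
  factors and of commutators that involve such a difference. In the commutator case one of these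
  commutators contains \<open>w = [f, g]\<close> itself. This is not circular, since only its first \<open>m\<close>
  differences are needed for the order \<open>m + 1\<close>, and they are known by induction; this is why
  the three claims are proved together, one order at a time.
\<close>

lemma poly_upto_group:
  shows "poly_upto m i f \<Longrightarrow> poly_upto m i g \<Longrightarrow> poly_upto m i (\<lambda>n. f n \<otimes> g n)"
    and "poly_upto m i f \<Longrightarrow> poly_upto m i (\<lambda>n. inv (f n))"
    and "poly_upto m i f \<Longrightarrow> poly_upto m j g \<Longrightarrow> poly_upto m (i + j) (\<lambda>n. commutator G (f n) (g n))"
proof (induction m arbitrary: i j f g)
  case 0
  { case 1 then show ?case using subgroup.m_closed[OF F_subgroup] by auto }
  { case 2 then show ?case using subgroup.m_inv_closed[OF F_subgroup] by auto }
  { case 3 then show ?case using F_commutator by auto }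
next
  case (Suc m)
  note mult = Suc.IH(1) and invs = Suc.IH(2) and comm = Suc.IH(3)
  { case 1
    note cl = poly_upto_closed[OF 1(1)] poly_upto_closed[OF 1(2)]
    have f: "poly_upto m i f" using 1(1) by (rule poly_upto_lower_order)
    have df: "poly_upto m (Suc i) (seq_diff f)" and dg: "poly_upto m (Suc i) (seq_diff g)"
      using 1 by auto
    have eq: "seq_diff (\<lambda>n. f n \<otimes> g n) =
        (\<lambda>n. seq_diff f n \<otimes> (commutator G (f n) (seq_diff g n) \<otimes> seq_diff g n))"
      using cl by (simp add: fun_eq_iff seq_diff_def commutator_def group_word_simps)
    have "poly_upto m (i + Suc i) (\<lambda>n. commutator G (f n) (seq_diff g n))"
      using comm[OF f dg] .
    then have "poly_upto m (Suc i) (\<lambda>n. commutator G (f n) (seq_diff g n))"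
      by (rule poly_upto_level_mono) simp
    then have "poly_upto m (Suc i) (seq_diff (\<lambda>n. f n \<otimes> g n))"
      unfolding eq using df dg by (intro mult)
    moreover have "\<forall>n. f n \<otimes> g n \<in> F i"
      using poly_upto_in_F[OF 1(1)] poly_upto_in_F[OF 1(2)] subgroup.m_closed[OF F_subgroup] by blast
    ultimately show ?case by simp }
  { case 2
    note cl = poly_upto_closed[OF 2]
    have f: "poly_upto m i f" using 2 by (rule poly_upto_lower_order)
    have df: "poly_upto m (Suc i) (seq_diff f)" using 2 by auto
    have eq: "seq_diff (\<lambda>n. inv (f n)) =
        (\<lambda>n. commutator G (inv (f n)) (inv (seq_diff f n)) \<otimes> inv (seq_diff f n))"
      using cl by (simp add: fun_eq_iff seq_diff_def commutator_def group_word_simps)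
    have "poly_upto m (i + Suc i) (\<lambda>n. commutator G (inv (f n)) (inv (seq_diff f n)))"
      using comm[OF invs[OF f] invs[OF df]] .
    then have "poly_upto m (Suc i) (\<lambda>n. commutator G (inv (f n)) (inv (seq_diff f n)))"
      by (rule poly_upto_level_mono) simp
    then have "poly_upto m (Suc i) (seq_diff (\<lambda>n. inv (f n)))"
      unfolding eq using invs[OF df] by (rule mult)
    moreover have "\<forall>n. inv (f n) \<in> F i"
      using poly_upto_in_F[OF 2] subgroup.m_inv_closed[OF F_subgroup] by blast
    ultimately show ?case by simp }
  { case 3
    note cl = poly_upto_closed[OF 3(1)] poly_upto_closed[OF 3(2)]
    define a b w where "a = seq_diff f" and "b = seq_diff g"
      and "w = (\<lambda>n. commutator G (f n) (g n))"
    have clab: "a n \<in> carrier G" "b n \<in> carrier G" "w n \<in> carrier G" for n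
      using cl by (auto simp: a_def b_def w_def seq_diff_def)
    have f: "poly_upto m i f" and g: "poly_upto m j g" and g': "poly_upto m j (\<lambda>n. g (Suc n))"
      using 3 poly_upto_lower_order poly_upto_shift by blast+
    have a: "poly_upto m (Suc i) a" and b: "poly_upto m (Suc j) b"
      using 3 by (auto simp: a_def b_def)
    have w: "poly_upto m (i + j) w" unfolding w_def using f g by (rule comm)
    let ?u = "\<lambda>n. commutator G (f n) (g (Suc n))"
    let ?v = "\<lambda>n. commutator G (a n) (g (Suc n))"
    have u: "poly_upto m (i + j) ?u" using f g' by (rule comm)
    have v: "poly_upto m (Suc (i + j)) ?v" using comm[OF a g'] by simp
    have h1: "poly_upto m (Suc (i + j)) (\<lambda>n. commutator G (a n) (?u n))"
      using comm[OF a u] by (rule poly_upto_level_mono) simp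
    have h2: "poly_upto m (Suc (i + j)) (\<lambda>n. commutator G (f n) (b n))"
      using comm[OF f b] by simp
    have h3: "poly_upto m (Suc (i + j)) (\<lambda>n. commutator G (b n) (w n))"
      using comm[OF b w] by (rule poly_upto_level_mono) simp
    have h4: "poly_upto m (Suc (i + j)) (\<lambda>n. commutator G (w n) (?v n))"
      using comm[OF w v] by (rule poly_upto_level_mono) simp
    have eq: "seq_diff w = (\<lambda>n. commutator G (a n) (?u n) \<otimes> (commutator G (f n) (b n) \<otimes>
        (commutator G (b n) (w n) \<otimes> (commutator G (w n) (?v n) \<otimes> ?v n))))"
    proof
      fix n
      have fS: "f (Suc n) = a n \<otimes> f n" and gS: "g (Suc n) = b n \<otimes> g n"
        using cl by (simp_all add: a_def b_def seq_diff_def m_assoc)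
      have v: "commutator G (w n) (?v n) \<otimes> ?v n = w n \<otimes> ?v n \<otimes> inv (w n)"
        using cl clab by (simp add: commutator_mult_self)
      have u: "?u n = commutator G (f n) (b n) \<otimes> (commutator G (b n) (w n) \<otimes> w n)"
        unfolding gS w_def using cl clab by (simp add: commutator_mult_right)
      have wS: "w (Suc n) = commutator G (a n) (?u n) \<otimes> (?u n \<otimes> ?v n)"
        unfolding w_def fS using cl clab by (simp add: commutator_mult_left)
      have "seq_diff w n = commutator G (a n) (?u n) \<otimes> (commutator G (f n) (b n) \<otimes>
        (commutator G (b n) (w n) \<otimes> (w n \<otimes> ?v n \<otimes> inv (w n))))"
        unfolding seq_diff_def wS using cl clab by (subst (2) u) (simp add: m_assoc)
      then show "seq_diff w n = commutator G (a n) (?u n) \<otimes> (commutator G (f n) (b n) \<otimes>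
        (commutator G (b n) (w n) \<otimes> (commutator G (w n) (?v n) \<otimes> ?v n)))"
        unfolding v .
    qed
    have "poly_upto m (Suc (i + j)) (seq_diff w)"
      unfolding eq using h1 h2 h3 h4 v by (intro mult)
    moreover have "\<forall>n. w n \<in> F (i + j)"
      using F_commutator poly_upto_in_F[OF 3(1)] poly_upto_in_F[OF 3(2)] by (simp add: w_def)
    ultimately show ?case by (simp add: w_def) }
qed

lemma poly_upto_diff_power: "poly_upto m i f \<Longrightarrow> k \<le> m \<Longrightarrow> (seq_diff ^^ k) f n \<in> F (i + k)"
proof (induction k arbitrary: m i f)
  case 0 then show ?case using poly_upto_in_F by simp
next
  case (Suc k)
  then obtain m' where m: "m = Suc m'" by (cases m) auto
  have "(seq_diff ^^ k) (seq_diff f) n \<in> F (Suc i + k)"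
    using Suc m by (intro Suc.IH[of m']) auto
  then show ?case by (simp add: funpow_Suc_right del: funpow.simps)
qed

text \<open>
  Powers of an element of weight \<open>1\<close> have a constant first difference.
\<close>

lemma poly_upto_power:
  assumes "h \<in> F 1"
  shows "poly_upto m 0 (\<lambda>n. h [^] n)"
proof (cases m)
  case (Suc m')
  have h: "h \<in> carrier G" using assms F_carrier by blast
  have "seq_diff (\<lambda>n. h [^] n) = (\<lambda>n. h)"
  proof
    fix n :: nat
    have "h [^] n \<otimes> h = h \<otimes> h [^] n" using nat_pow_Suc2[OF h] by simp
    then show "seq_diff (\<lambda>n. h [^] n) n = h" using h by (simp add: seq_diff_def m_assoc)
  qed
  then show ?thesis using Suc poly_upto_const[of h 1 m'] assms h F_0 by simp
qed (use assms F_carrier F_0 in auto)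

lemma poly_upto_gterm:
  assumes "\<And>i. i \<in> gterm_vars t \<Longrightarrow> poly_upto m 0 (\<lambda>n. xs n ! i)"
  shows "poly_upto m 0 (\<lambda>n. gterm_val G (xs n) t)"
  using assms
proof (induction t)
  case One
  then show ?case using poly_upto_const F_0 by simp
next
  case (Inv t) then show ?case using poly_upto_group(2) by simp
next
  case (Mul s t) then show ?case using poly_upto_group(1) by simp
qed auto

end

section \<open>Zeros of integer polynomials with values in an abelian group\<close>

context comm_group begin

text \<open>
  The functions \<open>n \<mapsto> b\<^sub>0 + b\<^sub>1 n + \<dots> + b\<^sub>d\<^sub>-\<^sub>1 n\<^sup>d\<^sup>-\<^sup>1\<close> in Horner form, with coefficients in the abelian
  group, which is written multiplicatively. The index \<open>d\<close> counts the coefficients, so it exceeds the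
  degree by one.
\<close>

primrec int_poly :: "nat \<Rightarrow> (nat \<Rightarrow> 'a) \<Rightarrow> bool" where
  "int_poly 0 f \<longleftrightarrow> f = (\<lambda>n. \<one>)"
| "int_poly (Suc d) f \<longleftrightarrow>
     (\<exists>b u. b \<in> carrier G \<and> int_poly d u \<and> f = (\<lambda>n. b \<otimes> u n [^] n))"

lemma int_poly_closed: "int_poly d f \<Longrightarrow> f n \<in> carrier G"
  by (induction d arbitrary: f) auto

lemma int_poly_one: "int_poly d (\<lambda>n. \<one>)"
proof (induction d)
  case (Suc d)
  then show ?case by (auto intro!: exI[of _ "\<one>"] exI[of _ "\<lambda>n. \<one>"])
qed auto

lemma int_poly_mult: "int_poly d f \<Longrightarrow> int_poly d g \<Longrightarrow> int_poly d (\<lambda>n. f n \<otimes> g n)"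
proof (induction d arbitrary: f g)
  case (Suc d)
  obtain b u where bu: "b \<in> carrier G" "int_poly d u" "f = (\<lambda>n. b \<otimes> u n [^] n)"
    using Suc.prems(1) by auto
  obtain c v where cv: "c \<in> carrier G" "int_poly d v" "g = (\<lambda>n. c \<otimes> v n [^] n)"
    using Suc.prems(2) by auto
  have "f n \<otimes> g n = (b \<otimes> c) \<otimes> (u n \<otimes> v n) [^] n" for n
    using bu cv int_poly_closed[OF bu(2)] int_poly_closed[OF cv(2)]
    by (simp add: nat_pow_distrib m_ac)
  then show ?case using bu cv Suc.IH[OF bu(2) cv(2)]
    by (auto intro!: exI[of _ "b \<otimes> c"] exI[of _ "\<lambda>n. u n \<otimes> v n"])
qed auto

lemma int_poly_int_pow: "int_poly d f \<Longrightarrow> int_poly d (\<lambda>n. f n [^] (k :: int))"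
proof (induction d arbitrary: f)
  case (Suc d)
  obtain b u where bu: "b \<in> carrier G" "int_poly d u" "f = (\<lambda>n. b \<otimes> u n [^] n)"
    using Suc.prems(1) by auto
  have "f n [^] k = b [^] k \<otimes> (u n [^] k) [^] n" for n
    using bu int_poly_closed[OF bu(2)]
    by (simp add: int_pow_distrib int_pow_pow mult.commute flip: int_pow_int)
  then show ?case using bu Suc.IH[OF bu(2)]
    by (auto intro!: exI[of _ "b [^] k"] exI[of _ "\<lambda>n. u n [^] k"])
qed (simp add: int_pow_one)

lemma int_poly_nat_pow: "int_poly d f \<Longrightarrow> int_poly d (\<lambda>n. f n [^] (k :: nat))"
  using int_poly_int_pow[of d f "int k"] by (simp add: int_pow_int)

lemma int_poly_Suc: "int_poly d f \<Longrightarrow> int_poly (Suc d) f"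
proof (induction d arbitrary: f)
  case 0
  then show ?case using int_poly_one[of "Suc 0"] by simp
next
  case (Suc d)
  then show ?case by (subst int_poly.simps) (metis int_poly.simps(2))
qed

lemma int_poly_mono: "int_poly d f \<Longrightarrow> d \<le> e \<Longrightarrow> int_poly e f"
  by (induction e) (auto simp: le_Suc_eq intro: int_poly_Suc simp del: int_poly.simps)

lemma int_poly_times_linear:
  assumes "int_poly d f" shows "int_poly (Suc d) (\<lambda>n. f n [^] (int n - l))"
proof -
  have "int_poly (Suc d) (\<lambda>n. \<one> \<otimes> f n [^] n)"
    using assms by auto
  moreover have "int_poly (Suc d) (\<lambda>n. f n [^] (- l))"
    using assms int_poly_int_pow int_poly_Suc by blast
  ultimately have "int_poly (Suc d) (\<lambda>n. (\<one> \<otimes> f n [^] n) \<otimes> f n [^] (- l))"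
    by (rule int_poly_mult)
  moreover have "(\<one> \<otimes> f n [^] n) \<otimes> f n [^] (- l) = f n [^] (int n - l)" for n
    using int_poly_closed[OF assms, of n] int_pow_mult[of "f n" "int n" "- l"] by (simp add: int_pow_int)
  ultimately show ?thesis by simp
qed

text \<open>
  Division by a linear factor works over any abelian group, because the divisor is monic.
\<close>

lemma int_poly_factor:
  assumes "int_poly (Suc d) f"
  obtains u where "int_poly d u" "\<And>n. f n = f r \<otimes> u n [^] (int n - int r)"
proof -
  have "\<exists>u. int_poly d u \<and> (\<forall>n. f n = f r \<otimes> u n [^] (int n - int r))"
    using assms
  proof (induction d arbitrary: f)
    case 0
    then show ?case by (auto simp: int_pow_one)
  next
    case (Suc d)
    obtain b u where bu: "b \<in> carrier G" "int_poly (Suc d) u" "f = (\<lambda>n. b \<otimes> u n [^] n)"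
      using Suc.prems by (metis int_poly.simps(2))
    obtain w where w: "int_poly d w" "\<And>n. u n = u r \<otimes> w n [^] (int n - int r)"
      using Suc.IH[OF bu(2)] by blast
    note cl = int_poly_closed[OF bu(2)] int_poly_closed[OF w(1)]
    define z where "z = (\<lambda>n. u r \<otimes> w n [^] n)"
    have "int_poly (Suc d) z" using w(1) cl by (auto simp: z_def)
    moreover have "f n = f r \<otimes> z n [^] (int n - int r)" for n
    proof -
      have "f n = b \<otimes> (u r [^] int n \<otimes> (w n [^] (int n - int r)) [^] int n)"
        using bu(1) cl by (simp add: bu(3) w(2)[of n] int_pow_int int_pow_distrib flip: int_pow_int)
      also have "u r [^] int n = u r [^] int r \<otimes> u r [^] (int n - int r)"
        using cl by (simp flip: int_pow_mult)
      also have "(w n [^] (int n - int r)) [^] int n = (w n [^] int n) [^] (int n - int r)"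
        using cl by (simp add: int_pow_pow mult.commute)
      also have "b \<otimes> (u r [^] int r \<otimes> u r [^] (int n - int r) \<otimes> (w n [^] int n) [^] (int n - int r))
        = f r \<otimes> z n [^] (int n - int r)"
        using bu(1) cl by (simp add: bu(3) z_def int_pow_distrib int_pow_int m_ac)
      finally show ?thesis .
    qed
    ultimately show ?case by blast
  qed
  then show ?thesis using that by blast
qed

text \<open>
  The usual count of roots: splitting off the factor \<open>n - r\<close> at a zero \<open>r\<close> keeps all other zeros
  \<open>z\<close>, as multiplication by \<open>\<bar>z - r\<bar> \<le> T\<close> is injective.
\<close>

lemma int_poly_few_zeros:
  assumes "int_poly d f" and "finite Z" "d \<le> card Z" "Z \<subseteq> {..T}"
    and zero: "\<And>z. z \<in> Z \<Longrightarrow> f z = \<one>"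
    and inj: "\<And>x k. x \<in> carrier G \<Longrightarrow> 0 < k \<Longrightarrow> k \<le> T \<Longrightarrow> x [^] (k :: nat) = \<one> \<Longrightarrow> x = \<one>"
  shows "f n = \<one>"
  using assms(1-5)
proof (induction d arbitrary: f Z n)
  case (Suc d)
  then obtain r where r: "r \<in> Z" by fastforce
  obtain u where u: "int_poly d u" "\<And>n. f n = f r \<otimes> u n [^] (int n - int r)"
    using int_poly_factor[OF Suc.prems(1)] by blast
  have cl: "u n \<in> carrier G" for n using int_poly_closed[OF u(1)] .
  have "u z = \<one>" if z: "z \<in> Z - {r}" for z
  proof -
    have 1: "u z [^] (int z - int r) = \<one>"
      using u(2)[of z] Suc.prems(5) r z cl by simp
    have "u z [^] \<bar>int z - int r\<bar> = \<one>"
    proof (cases "z \<ge> r")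
      case False
      then have "u z [^] \<bar>int z - int r\<bar> = inv (u z [^] (int z - int r))"
        using cl by (simp flip: int_pow_neg)
      then show ?thesis using 1 by simp
    qed (use 1 in simp)
    then have "u z [^] nat \<bar>int z - int r\<bar> = \<one>"
      by (metis abs_ge_zero int_nat_eq int_pow_int)
    moreover have "0 < nat \<bar>int z - int r\<bar>" "nat \<bar>int z - int r\<bar> \<le> T"
      using z r subsetD[OF Suc.prems(4), of z] subsetD[OF Suc.prems(4), of r] by auto
    ultimately show ?thesis using inj cl by blast
  qed
  moreover have "d \<le> card (Z - {r})" using Suc.prems r by simp
  moreover have "finite (Z - {r})" "Z - {r} \<subseteq> {..T}" using Suc.prems by auto
  ultimately have "u n = \<one>" for n
    using Suc.IH[OF u(1)] by blast
  then show ?case using u(2)[of n] Suc.prems(5) r by (simp add: int_pow_one)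
qed auto

text \<open>
  Newton's forward difference polynomial \<open>\<Sum>\<^bsub>i<d\<^esub> (n choose i) b\<^sub>i\<close>.
\<close>

primrec newton :: "(nat \<Rightarrow> 'a) \<Rightarrow> nat \<Rightarrow> nat \<Rightarrow> 'a" where
  "newton b 0 n = \<one>"
| "newton b (Suc d) n = newton b d n \<otimes> b d [^] (n choose d)"

lemma newton_closed: "(\<And>i. b i \<in> carrier G) \<Longrightarrow> newton b d n \<in> carrier G"
  by (induction d) auto

lemma newton_step:
  assumes b: "\<And>i. b i \<in> carrier G"
  shows "newton b (Suc d) (Suc n) = newton b (Suc d) n \<otimes> newton (\<lambda>i. b (Suc i)) d n"
proof (induction d)
  case (Suc d)
  have "newton b (Suc (Suc d)) (Suc n) =
      (newton b (Suc d) n \<otimes> newton (\<lambda>i. b (Suc i)) d n) \<otimes>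
      (b (Suc d) [^] (n choose d) \<otimes> b (Suc d) [^] (n choose Suc d))"
    using b by (subst newton.simps(2), subst Suc) (simp add: nat_pow_mult)
  also have "\<dots> = newton b (Suc (Suc d)) n \<otimes> newton (\<lambda>i. b (Suc i)) (Suc d) n"
    using b by (simp add: newton_closed m_ac)
  finally show ?case .
qed (use b in simp)

text \<open>
  Here \<open>D i\<close> stands for the \<open>i\<close>-th difference of \<open>v\<close>. The induction on \<open>n\<close> treats all \<open>D j\<close> at once,
  since \<open>D j (n + 1)\<close> depends on \<open>D j n\<close> and \<open>D (j + 1) n\<close>.
\<close>

lemma newton_interpolation:
  assumes cl: "\<And>n. v n \<in> carrier G"
    and D: "\<And>i n. D i n \<in> carrier G" "\<And>n. D 0 n = v n" "\<And>i n. D (Suc i) n = D i (Suc n) \<otimes> inv (D i n)"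
    and zero: "\<And>n. D d n = \<one>"
  shows "v n = newton (\<lambda>i. D i 0) d n"
proof -
  have above: "D (i + d) n = \<one>" for i n
    by (induction i arbitrary: n) (use zero D(3) in auto)
  have "D j n = newton (\<lambda>i. D (i + j) 0) d n" for j
  proof (induction n arbitrary: j)
    case 0
    show ?case
    proof (cases "d = 0")
      case True
      then show ?thesis using above[of j] by simp
    next
      case False
      have "newton (\<lambda>i. D (i + j) 0) (Suc e) 0 = D j 0" for e
        by (induction e) (use D(1) in auto)
      then show ?thesis using False by (metis not0_implies_Suc)
    qed
  next
    case (Suc n)
    \<comment> \<open>The coefficient with index \<open>d\<close> is trivial; adding it gives the shape of \<open>newton_step\<close>.\<close>
    have last: "newton (\<lambda>i. D (i + j) 0) d n = newton (\<lambda>i. D (i + j) 0) (Suc d) n" for n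
      using above[of j] D(1) newton_closed[of "\<lambda>i. D (i + j) 0"] by (simp add: add.commute)
    have "D j (Suc n) = D j n \<otimes> D (Suc j) n"
      using D(1) by (simp add: D(3) m_lcomm[of "D j n"])
    also have "\<dots> = newton (\<lambda>i. D (i + j) 0) d n \<otimes> newton (\<lambda>i. D (i + Suc j) 0) d n"
      using Suc[of j] Suc[of "Suc j"] by simp
    also have "\<dots> = newton (\<lambda>i. D (i + j) 0) d (Suc n)"
      unfolding last using newton_step[of "\<lambda>i. D (i + j) 0" d n] D(1) by simp
    finally show ?case .
  qed
  from this[of 0] show ?thesis using D(2) by simp
qed

lemma int_poly_fact_choose:
  assumes "b \<in> carrier G"
  shows "int_poly (Suc i) (\<lambda>n. b [^] (fact i * (n choose i)))"
proof (induction i)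
  case 0
  show ?case using assms int_poly_one[of 0] by (auto intro!: exI[of _ b])
next
  case (Suc i)
  have "(b [^] (fact i * (n choose i))) [^] (int n - int i) = b [^] (fact (Suc i) * (n choose Suc i))" for n
  proof -
    have "int (fact i * (n choose i)) * (int n - int i) = int (fact (Suc i) * (n choose Suc i))"
    proof (cases "i \<le> n")
      case True
      then have "Suc i * (n choose Suc i) = (n - i) * (n choose i)"
        by (metis binomial_absorb_comp binomial_absorption mult.commute)
      then have "int (Suc i) * int (n choose Suc i) = (int n - int i) * int (n choose i)"
        using True by (metis of_nat_diff of_nat_mult)
      then have "int (fact i) * (int (Suc i) * int (n choose Suc i)) =
          int (fact i) * ((int n - int i) * int (n choose i))" by (simp only:)
      then show ?thesis by (simp add: algebra_simps)
    qed (simp add: binomial_eq_0)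
    then show ?thesis using assms by (simp add: int_pow_pow flip: int_pow_int)
  qed
  then show ?case using int_poly_times_linear[OF Suc, of "int i"] by simp
qed

text \<open>
  Binomial coefficients have denominators, which \<open>d!\<close> clears.
\<close>

lemma int_poly_newton:
  assumes b: "\<And>i. b i \<in> carrier G"
  shows "e \<le> d \<Longrightarrow> int_poly d (\<lambda>n. newton b e n [^] (fact d :: nat))"
proof (induction e)
  case 0
  then show ?case by (simp add: int_poly_one)
next
  case (Suc e)
  have "int_poly d (\<lambda>n. (b e [^] (fact e * (n choose e))) [^] (fact d div fact e :: nat))"
    using Suc.prems int_poly_fact_choose[OF b, of e e] int_poly_mono int_poly_nat_pow by blast
  moreover have "(b e [^] (fact e * (n choose e))) [^] (fact d div fact e :: nat)
      = (b e [^] (n choose e)) [^] (fact d :: nat)" for n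
  proof -
    have "(fact e :: nat) dvd fact d" using Suc.prems by (simp add: fact_dvd)
    then have "fact e * (n choose e) * (fact d div fact e) = (n choose e) * (fact d :: nat)"
      by (simp add: mult.assoc mult.left_commute)
    then show ?thesis by (simp only: nat_pow_pow[OF b[of e]])
  qed
  ultimately have "int_poly d (\<lambda>n. (b e [^] (n choose e)) [^] (fact d :: nat))" by simp
  then show ?case using int_poly_mult[OF Suc.IH] Suc.prems b newton_closed[OF b]
    by (simp add: nat_pow_distrib)
qed

text \<open>
  A function whose \<open>d\<close>-th differences vanish is determined by \<open>d\<close> zeros in \<open>{0, \<dots>, T}\<close>, if
  multiplication by \<open>1, \<dots>, T\<close> is injective: after multiplication by \<open>d!\<close> it is an integer
  polynomial, and \<open>d!\<close> can be cancelled because \<open>d \<le> T\<close>.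
\<close>

lemma vanishing_differences_few_zeros:
  assumes D: "\<And>i n. D i n \<in> carrier G" "\<And>i n. D (Suc i) n = D i (Suc n) \<otimes> inv (D i n)"
    and vanish: "\<And>n. D d n = \<one>"
    and Z: "Z \<subseteq> {..T}" "d \<le> card Z" "\<And>z. z \<in> Z \<Longrightarrow> D 0 z = \<one>"
    and inj: "\<And>x k. x \<in> carrier G \<Longrightarrow> 0 < k \<Longrightarrow> k \<le> T \<Longrightarrow> x [^] (k :: nat) = \<one> \<Longrightarrow> x = \<one>"
    and T: "d \<le> T"
  shows "D 0 n = \<one>"
proof -
  have newton: "D 0 n = newton (\<lambda>i. D i 0) d n" for n
    using D vanish by (intro newton_interpolation) auto
  have "int_poly d (\<lambda>n. D 0 n [^] (fact d :: nat))"
    unfolding newton using D(1) by (intro int_poly_newton) auto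
  then have 1: "D 0 n [^] (fact d :: nat) = \<one>"
  proof (rule int_poly_few_zeros[of d _ Z T])
    show "finite Z" using Z(1) by (rule finite_subset) simp
    show "D 0 z [^] (fact d :: nat) = \<one>" if "z \<in> Z" for z
      using Z(3)[OF that] by simp
  qed (fact | rule inj)+
  have "x = \<one>" if "x \<in> carrier G" "x [^] (fact e :: nat) = \<one>" "e \<le> T" for x e
    using that
  proof (induction e arbitrary: x)
    case (Suc e)
    have "(x [^] (fact e :: nat)) [^] Suc e = \<one>"
      using Suc.prems nat_pow_pow[of x "fact e" "Suc e"] by (simp only: fact_Suc mult.commute of_nat_id)
    then have "x [^] (fact e :: nat) = \<one>"
      by (rule inj[rotated 3]) (use Suc.prems in auto)
    then show ?case using Suc by simp
  qed simp
  then show ?thesis using 1 D(1) T by blast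
qed

end

section \<open>Subgroups of finite index\<close>

lemma finite_image_factor:
  assumes "finite (f ` A)" and "\<And>x y. x \<in> A \<Longrightarrow> y \<in> A \<Longrightarrow> f x = f y \<Longrightarrow> g x = g y"
  shows "finite (g ` A)"
proof -
  have "g ` A \<subseteq> (\<lambda>v. g (inv_into A f v)) ` (f ` A)"
  proof
    fix z assume "z \<in> g ` A"
    then obtain x where x: "x \<in> A" "z = g x" by blast
    then have "g (inv_into A f (f x)) = g x"
      using assms(2) f_inv_into_f[of "f x" f A] inv_into_into[of "f x" f A] by blast
    then show "z \<in> (\<lambda>v. g (inv_into A f v)) ` (f ` A)" using x by (auto simp: image_iff intro!: bexI)
  qed
  then show ?thesis using assms(1) finite_surj by blast
qed

lemma lcosets_eq_image: "lcosets\<^bsub>G\<^esub> H = (\<lambda>a. a <#\<^bsub>G\<^esub> H) ` carrier G"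
  by (auto simp: LCOSETS_def)

context group begin

lemma lcos_eq_iff:
  assumes "subgroup H G" "x \<in> carrier G" "y \<in> carrier G"
  shows "x <# H = y <# H \<longleftrightarrow> inv x \<otimes> y \<in> H"
proof
  assume "x <# H = y <# H"
  then have "y \<in> x <# H" using lcos_self assms by simp
  then show "inv x \<otimes> y \<in> H" using subgroup.lcos_module_imp[OF assms(1) is_group assms(2)] by simp
next
  assume "inv x \<otimes> y \<in> H"
  then have "y \<in> x <# H" using subgroup.lcos_module_rev[OF assms(1) is_group] assms by simp
  then show "x <# H = y <# H" using l_repr_independence assms by blast
qed

text \<open>
  The most convenient way to establish finite index: an invariant with finitely many values that
  separates the cosets.
\<close>

lemma finite_indexI:
  assumes "subgroup H G" "finite (f ` carrier G)"
    and "\<And>x y. x \<in> carrier G \<Longrightarrow> y \<in> carrier G \<Longrightarrow> f x = f y \<Longrightarrow> inv x \<otimes> y \<in> H"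
  shows "finite_index G H"
  unfolding finite_index_def lcosets_eq_image
  by (rule finite_image_factor[OF assms(2)]) (use assms lcos_eq_iff in blast)

lemma finite_index_image: "finite_index G H \<Longrightarrow> finite ((\<lambda>x. x <# H) ` carrier G)"
  by (simp add: finite_index_def lcosets_eq_image)

lemma finite_index_representatives:
  assumes "subgroup H G" "finite_index G H"
  obtains R where "finite R" "R \<subseteq> carrier G" "\<And>x. x \<in> carrier G \<Longrightarrow> \<exists>r\<in>R. inv r \<otimes> x \<in> H"
proof -
  obtain R where R: "R \<subseteq> carrier G" "finite R" "(\<lambda>x. x <# H) ` carrier G = (\<lambda>x. x <# H) ` R"
    using finite_index_image[OF assms(2)] finite_subset_image[of _ "\<lambda>x. x <# H" "carrier G"]
    by (metis order_refl)
  have "\<exists>r\<in>R. inv r \<otimes> x \<in> H" if x: "x \<in> carrier G" for x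
  proof -
    have "x <# H \<in> (\<lambda>x. x <# H) ` R" using x R(3) by blast
    then obtain r where "r \<in> R" "r <# H = x <# H" by force
    then show ?thesis using lcos_eq_iff[OF assms(1)] x R(1) by blast
  qed
  then show ?thesis using R that by blast
qed

lemma finite_index_carrier: "finite_index G (carrier G)"
  by (rule finite_indexI[of _ "\<lambda>x. ()"]) (auto simp: subgroup_self)

lemma finite_index_Int:
  assumes "subgroup H G" "subgroup K G" "finite_index G H" "finite_index G K"
  shows "finite_index G (H \<inter> K)"
proof (rule finite_indexI[of _ "\<lambda>x. (x <# H, x <# K)"])
  show "subgroup (H \<inter> K) G" using assms subgroups_Inter_pair by blast
  show "finite ((\<lambda>x. (x <# H, x <# K)) ` carrier G)"
    by (rule finite_subset[OF _ finite_cartesian_product[OF finite_index_image[OF assms(3)]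
            finite_index_image[OF assms(4)]]]) auto
qed (use assms lcos_eq_iff in auto)

lemma finite_index_trans:
  assumes "subgroup H G" "subgroup K (G\<lparr>carrier := H\<rparr>)" "finite_index G H"
    "finite_index (G\<lparr>carrier := H\<rparr>) K"
  shows "finite_index G K"
proof -
  interpret H: group "G\<lparr>carrier := H\<rparr>" using assms(1) subgroup_imp_group by blast
  have K: "subgroup K G" using assms incl_subgroup by blast
  obtain R where R: "finite R" "R \<subseteq> carrier G" "\<And>x. x \<in> carrier G \<Longrightarrow> \<exists>r\<in>R. inv r \<otimes> x \<in> H"
    using finite_index_representatives[OF assms(1,3)] by blast
  then obtain r where r: "\<And>x. x \<in> carrier G \<Longrightarrow> r x \<in> R \<and> inv (r x) \<otimes> x \<in> H" by metis
  show ?thesis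
  proof (rule finite_indexI[OF K, of "\<lambda>x. (r x, (inv (r x) \<otimes> x) <# K)"])
    have "(\<lambda>x. (r x, (inv (r x) \<otimes> x) <# K)) ` carrier G \<subseteq> R \<times> (\<lambda>x. x <# K) ` H"
      using r by auto
    then show "finite ((\<lambda>x. (r x, (inv (r x) \<otimes> x) <# K)) ` carrier G)"
      by (rule finite_subset) (use R(1) H.finite_index_image[OF assms(4)] in simp)
  next
    fix x y assume xy: "x \<in> carrier G" "y \<in> carrier G"
      "(r x, (inv (r x) \<otimes> x) <# K) = (r y, (inv (r y) \<otimes> y) <# K)"
    define s where "s = r x"
    have s: "s \<in> carrier G" using r xy R(2) s_def by blast
    have "r y = s" using xy(3) by (simp add: s_def)
    moreover have "(inv (r x) \<otimes> x) <# K = (inv (r y) \<otimes> y) <# K" using xy(3) by (rule Pair_inject)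
    ultimately have "(inv s \<otimes> x) <# K = (inv s \<otimes> y) <# K" by (simp only: s_def)
    then have "inv (inv s \<otimes> x) \<otimes> (inv s \<otimes> y) \<in> K"
      using xy(1,2) lcos_eq_iff[OF K, of "inv s \<otimes> x" "inv s \<otimes> y"] s by simp
    then show "inv x \<otimes> y \<in> K" using xy s by (simp add: group_word_simps)
  qed
qed

text \<open>
  The core is the kernel of the action on the finite set of left cosets, and an element's
  action on this set is the invariant to which \<open>finite_indexI\<close> is applied.
\<close>

lemma finite_index_normal_core:
  assumes H: "subgroup H G" and fin: "finite_index G H"
  obtains N where "N \<lhd> G" "N \<subseteq> H" "finite_index G N"
proof -
  define N where "N = {n \<in> carrier G. \<forall>g\<in>carrier G. inv g \<otimes> n \<otimes> g \<in> H}"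
  have sub: "subgroup N G"
  proof (rule subgroupI)
    show "N \<subseteq> carrier G" by (auto simp: N_def)
    have "\<one> \<in> N" using subgroup.one_closed[OF H] by (auto simp: N_def)
    then show "N \<noteq> {}" by blast
  next
    fix a assume a: "a \<in> N"
    have "inv g \<otimes> inv a \<otimes> g = inv (inv g \<otimes> a \<otimes> g)" if "g \<in> carrier G" for g
      using a that by (simp add: N_def group_word_simps)
    then show "inv a \<in> N" using a subgroup.m_inv_closed[OF H] by (auto simp: N_def)
  next
    fix a b assume ab: "a \<in> N" "b \<in> N"
    have "inv g \<otimes> (a \<otimes> b) \<otimes> g = (inv g \<otimes> a \<otimes> g) \<otimes> (inv g \<otimes> b \<otimes> g)" if "g \<in> carrier G" for g
      using ab that by (simp add: N_def group_word_simps)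
    then show "a \<otimes> b \<in> N" using ab subgroup.m_closed[OF H] by (auto simp: N_def)
  qed
  have "N \<lhd> G"
    unfolding normal_inv_iff
  proof (intro conjI ballI sub)
    fix x h assume x: "x \<in> carrier G" and h: "h \<in> N"
    have "inv g \<otimes> (x \<otimes> h \<otimes> inv x) \<otimes> g = inv (inv x \<otimes> g) \<otimes> h \<otimes> (inv x \<otimes> g)" if "g \<in> carrier G" for g
      using x h that by (simp add: N_def group_word_simps)
    then show "x \<otimes> h \<otimes> inv x \<in> N" using x h by (auto simp: N_def)
  qed
  moreover have "N \<subseteq> H"
  proof
    fix n assume "n \<in> N"
    then have "inv \<one> \<otimes> n \<otimes> \<one> \<in> H" "n \<in> carrier G" unfolding N_def by blast+
    then show "n \<in> H" by simp
  qed
  moreover have "finite_index G N"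
  proof (rule finite_indexI[OF sub, of "\<lambda>x. restrict (\<lambda>c. x <# c) (lcosets H)"])
    have "(\<lambda>x. restrict (\<lambda>c. x <# c) (lcosets H)) ` carrier G \<subseteq> lcosets H \<rightarrow>\<^sub>E lcosets H"
      using lcos_m_assoc[OF subgroup.subset[OF H]] by (auto simp: lcosets_eq_image)
    moreover have "finite (lcosets H \<rightarrow>\<^sub>E lcosets H)"
      using fin by (intro finite_PiE) (auto simp: finite_index_def)
    ultimately show "finite ((\<lambda>x. restrict (\<lambda>c. x <# c) (lcosets H)) ` carrier G)"
      by (rule finite_subset)
  next
    fix x y assume xy: "x \<in> carrier G" "y \<in> carrier G"
      "restrict (\<lambda>c. x <# c) (lcosets H) = restrict (\<lambda>c. y <# c) (lcosets H)"
    have "inv g \<otimes> (inv x \<otimes> y) \<otimes> g \<in> H" if g: "g \<in> carrier G" for g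
    proof -
      have "g <# H \<in> lcosets H" using g by (auto simp: lcosets_eq_image)
      then have "x <# (g <# H) = y <# (g <# H)" using xy(3) by (metis restrict_apply')
      then have "(x \<otimes> g) <# H = (y \<otimes> g) <# H"
        using xy g lcos_m_assoc[OF subgroup.subset[OF H]] by simp
      then have "inv (x \<otimes> g) \<otimes> (y \<otimes> g) \<in> H" using lcos_eq_iff[OF H] xy g by simp
      then show ?thesis using xy g by (simp add: group_word_simps)
    qed
    then show "inv x \<otimes> y \<in> N" using xy by (auto simp: N_def)
  qed
  ultimately show ?thesis using that by blast
qed

lemma finite_index_iff_FactGroup:
  assumes "K \<lhd> G"
  shows "finite_index G K \<longleftrightarrow> finite (carrier (G Mod K))"
proof -
  have "carrier (G Mod K) = lcosets K"
    unfolding carrier_FactGroup lcosets_eq_image using assms by (auto simp: normal.coset_eq)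
  then show ?thesis by (simp add: finite_index_def)
qed

lemma finite_index_finite_carrier:
  assumes "subgroup H G" "finite_index G H" "finite H"
  shows "finite (carrier G)"
proof -
  have "finite (\<Union> (lcosets H))"
    using assms by (auto simp: finite_index_def lcosets_eq_image l_coset_def)
  then show ?thesis using lcosets_part_G[OF assms(1)] by simp
qed

text \<open>
  Schreier's lemma. Let \<open>R\<close> be a finite set of representatives of the right cosets of \<open>H\<close>. The elements
  \<open>r t r'\<^sup>-\<^sup>1\<close> of \<open>H\<close>, with \<open>r, r' \<in> R\<close> and \<open>t\<close> a generator or the inverse of one, generate a subgroup
  \<open>K\<close> for which \<open>KR\<close> is closed under multiplication by generators, so \<open>KR\<close> is everything.
\<close>

lemma finite_index_finitely_generated:
  assumes S: "finite S" "S \<subseteq> carrier G" "generate G S = carrier G"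
    and H: "subgroup H G" "finite_index G H"
  obtains S' where "finite S'" "S' \<subseteq> H" "generate G S' = H"
proof -
  interpret H: subgroup H G by fact
  obtain R0 where R0: "finite R0" "R0 \<subseteq> carrier G"
    "\<And>x. x \<in> carrier G \<Longrightarrow> \<exists>r\<in>R0. inv r \<otimes> x \<in> H"
    using finite_index_representatives[OF H] by blast
  define R where "R = insert \<one> ((\<lambda>r. inv r) ` R0)"
  have R: "finite R" "R \<subseteq> carrier G" "\<one> \<in> R" using R0 by (auto simp: R_def)
  have rep: "\<exists>r\<in>R. g \<otimes> inv r \<in> H" if g: "g \<in> carrier G" for g
  proof -
    obtain r where r: "r \<in> R0" "inv r \<otimes> inv g \<in> H" using R0(3)[of "inv g"] g by auto
    then have rG: "r \<in> carrier G" using R0 by blast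
    have "inv (inv r \<otimes> inv g) \<in> H" using r H.m_inv_closed by blast
    then have "g \<otimes> inv (inv r) \<in> H" using g rG by (simp add: inv_mult_group)
    then show ?thesis using r by (auto simp: R_def)
  qed
  define T where "T = S \<union> (\<lambda>s. inv s) ` S"
  \<comment> \<open>Adding \<open>R \<inter> H\<close> saves the choice of a transversal that meets \<open>H\<close> in \<open>\<one>\<close> only.\<close>
  define S' where "S' = (\<lambda>(a, t, b). a \<otimes> t \<otimes> inv b) ` (R \<times> T \<times> R) \<inter> H \<union> R \<inter> H"
  have S': "finite S'" "S' \<subseteq> H" using S R by (auto simp: S'_def T_def)
  define K where "K = generate G S'"
  have KH: "K \<subseteq> H" using generate_subgroup_incl[OF S'(2) H(1)] by (simp add: K_def)
  have K: "subgroup K G" using generate_is_subgroup[of S'] S' H.subset by (auto simp: K_def)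
  have S'K: "S' \<subseteq> K" by (auto simp: K_def intro: generate.incl)
  define W where "W = {k \<otimes> r | k r. k \<in> K \<and> r \<in> R}"
  have step: "w \<otimes> t \<in> W" if w: "w \<in> W" and t: "t \<in> T" for w t
  proof -
    obtain k r where kr: "w = k \<otimes> r" "k \<in> K" "r \<in> R" using w by (auto simp: W_def)
    have tG: "t \<in> carrier G" using t S by (auto simp: T_def)
    have rG: "r \<in> carrier G" "k \<in> carrier G" using kr R subgroup.subset[OF K] by auto
    obtain b where b: "b \<in> R" "r \<otimes> t \<otimes> inv b \<in> H" using rep[of "r \<otimes> t"] rG tG by auto
    have bG: "b \<in> carrier G" using b R by auto
    have "r \<otimes> t \<otimes> inv b \<in> (\<lambda>(a, t, b). a \<otimes> t \<otimes> inv b) ` (R \<times> T \<times> R)"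
      using kr(3) t b(1) by (intro image_eqI[of _ _ "(r, t, b)"]) auto
    then have "r \<otimes> t \<otimes> inv b \<in> K" using b(2) S'K unfolding S'_def by blast
    then have "k \<otimes> (r \<otimes> t \<otimes> inv b) \<in> K" using kr(2) subgroup.m_closed[OF K] by blast
    moreover have "w \<otimes> t = k \<otimes> (r \<otimes> t \<otimes> inv b) \<otimes> b"
      using rG tG bG by (simp add: kr(1) group_word_simps)
    ultimately show ?thesis using b(1) by (auto simp: W_def)
  qed
  have WG: "W \<subseteq> carrier G" using R subgroup.subset[OF K] by (auto simp: W_def)
  have all: "g \<in> generate G S \<Longrightarrow> \<forall>w\<in>W. w \<otimes> g \<in> W" for g
  proof (induction rule: generate.induct)
    case one
    then show ?case using WG by auto
  next
    case (incl h)
    then show ?case using step by (auto simp: T_def)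
  next
    case (inv h)
    then show ?case using step by (auto simp: T_def)
  next
    case (eng h1 h2)
    then have "h1 \<in> carrier G" "h2 \<in> carrier G" using generate_in_carrier[OF S(2)] by auto
    then have "w \<otimes> (h1 \<otimes> h2) = (w \<otimes> h1) \<otimes> h2" if "w \<in> W" for w
      using that WG by (simp add: m_assoc subset_iff)
    then show ?case using eng by simp
  qed
  have "H \<subseteq> K"
  proof
    fix g assume g: "g \<in> H"
    have "\<one> \<in> W" using subgroup.one_closed[OF K] R by (auto simp: W_def intro!: exI[of _ "\<one>"])
    then have "\<one> \<otimes> g \<in> W" using all[of g] g S(3) H.subset by auto
    then obtain k r where kr: "g = k \<otimes> r" "k \<in> K" "r \<in> R" using g by (auto simp: W_def)
    have kG: "k \<in> carrier G" "r \<in> carrier G" using kr R subgroup.subset[OF K] by auto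
    have "inv k \<otimes> g \<in> H" using kr KH g by auto
    then have "r \<in> H" using kG kr(1) by (simp add: cancel_inv_left)
    then have "r \<in> K" using kr(3) S'K by (auto simp: S'_def)
    then show "g \<in> K" using kr subgroup.m_closed[OF K] by blast
  qed
  then show ?thesis using that S' KH K_def by blast
qed

lemma subgroup_finitely_generated_group:
  assumes "subgroup H G" "finite S" "S \<subseteq> H" "generate G S = H"
  shows "finitely_generated_group (G\<lparr>carrier := H\<rparr>)"
  using assms generate_consistent[OF assms(3,1)] subgroup_imp_group[OF assms(1)]
  unfolding finitely_generated_group_def by auto

lemma finitely_generated_group_finite_index:
  assumes "finitely_generated_group G" "subgroup H G" "finite_index G H"
  shows "finitely_generated_group (G\<lparr>carrier := H\<rparr>)"
  using assms finite_index_finitely_generated subgroup_finitely_generated_group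
  unfolding finitely_generated_group_def by metis

end

section \<open>Nilpotent groups\<close>

context group begin

primrec upper_central :: "nat \<Rightarrow> 'a set" where
  "upper_central 0 = {\<one>}"
| "upper_central (Suc i) = {x \<in> carrier G. \<forall>y\<in>carrier G. commutator G x y \<in> upper_central i}"

lemma normal_conj_closed:
  "N \<lhd> G \<Longrightarrow> n \<in> N \<Longrightarrow> g \<in> carrier G \<Longrightarrow> g \<otimes> n \<otimes> inv g \<in> N"
  by (auto simp: normal_inv_iff)

lemma normal_conj_closed':
  "N \<lhd> G \<Longrightarrow> n \<in> N \<Longrightarrow> g \<in> carrier G \<Longrightarrow> inv g \<otimes> n \<otimes> g \<in> N"
  using normal_conj_closed[of N n "inv g"] by simp

lemma inv_commutator:
  "x \<in> carrier G \<Longrightarrow> y \<in> carrier G \<Longrightarrow> inv (commutator G x y) = commutator G y x"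
  by (simp add: commutator_def group_word_simps)

lemma commutator_swap_in:
  assumes "subgroup K G" "x \<in> carrier G" "y \<in> carrier G" "commutator G x y \<in> K"
  shows "commutator G y x \<in> K"
  using subgroup.m_inv_closed[OF assms(1,4)] inv_commutator assms by simp

lemma commutator_normal_left:
  assumes "N \<lhd> G" "x \<in> N" "y \<in> carrier G"
  shows "commutator G x y \<in> N"
proof -
  interpret N: normal N G by fact
  have "commutator G x y = x \<otimes> (y \<otimes> inv x \<otimes> inv y)"
    using assms by (simp add: commutator_def m_assoc)
  then show ?thesis using assms normal_conj_closed[OF assms(1), of "inv x" y] by simp
qed

lemma commutator_normal_right:
  "N \<lhd> G \<Longrightarrow> x \<in> carrier G \<Longrightarrow> y \<in> N \<Longrightarrow> commutator G x y \<in> N"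
  using commutator_normal_left commutator_swap_in normal_imp_subgroup
  by (metis subgroup.mem_carrier)

text \<open>
  Reduces the verification of commutator conditions modulo \<open>K\<close> to generators.
\<close>

lemma centralizer_mod_subgroup:
  assumes K: "K \<lhd> G" and Y: "Y \<subseteq> carrier G"
  shows "subgroup {x \<in> carrier G. \<forall>y\<in>Y. commutator G x y \<in> K} G" (is "subgroup ?C G")
proof (rule subgroupI)
  interpret K: normal K G by fact
  show "?C \<subseteq> carrier G" by blast
  have "commutator G \<one> y = \<one>" if "y \<in> Y" for y
    using that Y by (auto simp: commutator_def)
  then have "\<one> \<in> ?C" by simp
  then show "?C \<noteq> {}" by blast
  show "inv x \<in> ?C" if x: "x \<in> ?C" for x
  proof -
    have "commutator G (inv x) y = inv x \<otimes> inv (commutator G x y) \<otimes> x" if "y \<in> Y" for y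
      using x that Y by (auto simp: commutator_def group_word_simps)
    then show ?thesis using x normal_conj_closed'[OF K] by auto
  qed
  show "x \<otimes> z \<in> ?C" if x: "x \<in> ?C" and z: "z \<in> ?C" for x z
  proof -
    have "commutator G (x \<otimes> z) y \<in> K" if y: "y \<in> Y" for y
    proof -
      have yG: "y \<in> carrier G" using y Y by blast
      have "commutator G (x \<otimes> z) y =
          commutator G x (commutator G z y) \<otimes> (commutator G z y \<otimes> commutator G x y)"
        using x z yG by (intro commutator_mult_left) auto
      then show ?thesis using x z y commutator_normal_right[OF K] by auto
    qed
    then show ?thesis using x z by auto
  qed
qed

lemma upper_central_normal: "upper_central i \<lhd> G"
proof (induction i)
  case 0
  then show ?case using one_is_normal by simp
next
  case (Suc i)
  show ?case
    unfolding normal_inv_iff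
  proof (intro conjI ballI)
    show "subgroup (upper_central (Suc i)) G"
      using centralizer_mod_subgroup[OF Suc, of "carrier G"] by simp
  next
    fix g x assume g: "g \<in> carrier G" and x: "x \<in> upper_central (Suc i)"
    have "commutator G (g \<otimes> x \<otimes> inv g) y \<in> upper_central i" if y: "y \<in> carrier G" for y
    proof -
      have "commutator G (g \<otimes> x \<otimes> inv g) y = g \<otimes> commutator G x (inv g \<otimes> y \<otimes> g) \<otimes> inv g"
        using g x y by (simp add: commutator_def group_word_simps)
      then show ?thesis using g x y normal_conj_closed[OF Suc] by simp
    qed
    then show "g \<otimes> x \<otimes> inv g \<in> upper_central (Suc i)" using g x by simp
  qed
qed

lemma upper_central_subgroup: "subgroup (upper_central i) G"
  using upper_central_normal normal_imp_subgroup by blast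

lemma upper_central_carrier: "x \<in> upper_central i \<Longrightarrow> x \<in> carrier G"
  using subgroup.subset[OF upper_central_subgroup] by blast

lemma upper_central_Suc_subset: "upper_central i \<subseteq> upper_central (Suc i)"
  using commutator_normal_left[OF upper_central_normal] upper_central_carrier by auto

lemma upper_central_mono: "i \<le> j \<Longrightarrow> upper_central i \<subseteq> upper_central j"
  using upper_central_Suc_subset lift_Suc_mono_le by metis

lemma upper_central_commutator:
  "x \<in> upper_central (Suc i) \<Longrightarrow> y \<in> carrier G \<Longrightarrow> commutator G x y \<in> upper_central i"
  by simp

lemma lower_central_Suc:
  "lower_central_series G (Suc i) =
    generate G {commutator G x y | x y. x \<in> lower_central_series G i \<and> y \<in> carrier G}"
  by (simp add: commutator_def)

lemma lower_central_commutator: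
  "x \<in> lower_central_series G i \<Longrightarrow> y \<in> carrier G \<Longrightarrow> commutator G x y \<in> lower_central_series G (Suc i)"
  unfolding lower_central_Suc by (intro generate.incl) blast

lemma lower_central_normal: "lower_central_series G i \<lhd> G"
proof (induction i)
  case 0
  then show ?case using normal_self by simp
next
  case (Suc i)
  have carr: "x \<in> carrier G" if "x \<in> lower_central_series G i" for x
    using that Suc normal_imp_subgroup subgroup.mem_carrier by metis
  show ?case
    unfolding lower_central_Suc
  proof (rule normal_generateI)
    show "{commutator G x y | x y. x \<in> lower_central_series G i \<and> y \<in> carrier G} \<subseteq> carrier G"
      using carr by auto
  next
    fix h g assume h: "h \<in> {commutator G x y | x y. x \<in> lower_central_series G i \<and> y \<in> carrier G}"
      and g: "g \<in> carrier G"
    then obtain x y where xy: "h = commutator G x y" "x \<in> lower_central_series G i" "y \<in> carrier G"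
      by blast
    have "g \<otimes> h \<otimes> inv g = commutator G (g \<otimes> x \<otimes> inv g) (g \<otimes> y \<otimes> inv g)"
      using g xy carr by (simp add: commutator_def group_word_simps)
    then show "g \<otimes> h \<otimes> inv g \<in> {commutator G x y | x y. x \<in> lower_central_series G i \<and> y \<in> carrier G}"
      using g xy normal_conj_closed[OF Suc] by blast
  qed
qed

lemma lower_central_Suc_subset: "lower_central_series G (Suc i) \<subseteq> lower_central_series G i"
  unfolding lower_central_Suc
  by (rule generate_subgroup_incl[OF _ normal_imp_subgroup[OF lower_central_normal]])
    (use commutator_normal_left[OF lower_central_normal] in blast)

lemma nilpotent_upper_central:
  assumes "nilpotent_group G"
  obtains c where "upper_central c = carrier G"
proof -
  obtain c where c: "lower_central_series G c = {\<one>}"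
    using assms by (auto simp: nilpotent_group_def)
  have "i \<le> c \<Longrightarrow> lower_central_series G (c - i) \<subseteq> upper_central i" for i
  proof (induction i)
    case (Suc i)
    then have "Suc (c - Suc i) = c - i" by simp
    then have "commutator G x y \<in> upper_central i"
      if "x \<in> lower_central_series G (c - Suc i)" "y \<in> carrier G" for x y
      using lower_central_commutator[OF that] Suc by auto
    moreover have "lower_central_series G (c - Suc i) \<subseteq> carrier G"
      using lower_central_normal normal_imp_subgroup subgroup.subset by blast
    ultimately show ?case by auto
  qed (use c in simp)
  from this[of c] have "carrier G \<subseteq> upper_central c" by simp
  then show ?thesis using that upper_central_carrier by blast
qed

lemma commutator_subgroup:
  "subgroup H G \<Longrightarrow> x \<in> H \<Longrightarrow> y \<in> H \<Longrightarrow> commutator (G\<lparr>carrier := H\<rparr>) x y = commutator G x y"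
  by (simp add: commutator_def m_inv_consistent)

lemma upper_central_subgroup_incl:
  assumes "subgroup H G"
  shows "H \<inter> upper_central i \<subseteq> group.upper_central (G\<lparr>carrier := H\<rparr>) i"
proof -
  interpret H: group "G\<lparr>carrier := H\<rparr>" using assms subgroup_imp_group by blast
  show ?thesis
  proof (induction i)
    case (Suc i)
    have "commutator G x y \<in> H \<inter> upper_central i"
      if "x \<in> H \<inter> upper_central (Suc i)" "y \<in> H" for x y
      using that H.commutator_closed[of x y] commutator_subgroup[OF assms] subgroup.subset[OF assms] by auto
    then show ?case using Suc commutator_subgroup[OF assms] by auto
  qed simp
qed

lemma upper_central_full_subgroup:
  assumes "subgroup H G" "H \<subseteq> upper_central c"
  shows "group.upper_central (G\<lparr>carrier := H\<rparr>) c = H"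
proof -
  interpret H: group "G\<lparr>carrier := H\<rparr>" using assms subgroup_imp_group by blast
  show ?thesis
    using upper_central_subgroup_incl[OF assms(1), of c] assms(2) H.upper_central_carrier by auto
qed

lemma upper_central_FactGroup:
  assumes "M \<lhd> G" "x \<in> upper_central i"
  shows "M #> x \<in> group.upper_central (G Mod M) i"
proof -
  interpret M: normal M G by fact
  interpret Q: group "G Mod M" by (rule M.factorgroup_is_group)
  interpret h: group_hom G "G Mod M" "\<lambda>x. M #> x"
    by unfold_locales (rule M.r_coset_hom_Mod)
  show ?thesis using assms(2)
  proof (induction i arbitrary: x)
    case 0
    then show ?case using h.hom_one by simp
  next
    case (Suc i)
    have x: "x \<in> carrier G" using Suc.prems by simp
    have "commutator (G Mod M) (M #> x) Y \<in> Q.upper_central i" if Y: "Y \<in> carrier (G Mod M)" for Y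
    proof -
      obtain y where y: "y \<in> carrier G" "Y = M #> y" using Y by (auto simp: carrier_FactGroup)
      have "commutator (G Mod M) (M #> x) Y = M #> commutator G x y"
        unfolding commutator_def y(2) using x y(1) by (simp del: mult_FactGroup)
      then show ?thesis using Suc y(1) by simp
    qed
    then show ?case using h.hom_closed[OF x] by simp
  qed
qed

lemma upper_central_full_FactGroup:
  assumes "M \<lhd> G" "upper_central c = carrier G"
  shows "group.upper_central (G Mod M) c = carrier (G Mod M)"
proof -
  interpret Q: group "G Mod M" using assms(1) by (rule normal.factorgroup_is_group)
  show ?thesis
    using upper_central_FactGroup[OF assms(1)] assms(2) Q.upper_central_carrier
    by (auto simp: carrier_FactGroup)
qed

lemma FactGroup_finitely_generated:
  assumes "M \<lhd> G" "finitely_generated_group G"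
  shows "finitely_generated_group (G Mod M)"
proof -
  interpret M: normal M G by fact
  interpret Q: group "G Mod M" by (rule M.factorgroup_is_group)
  interpret h: group_hom G "G Mod M" "\<lambda>x. M #> x"
    by unfold_locales (rule M.r_coset_hom_Mod)
  obtain S where S: "finite S" "S \<subseteq> carrier G" "generate G S = carrier G"
    using assms(2) by (auto simp: finitely_generated_group_def)
  have "generate (G Mod M) ((\<lambda>x. M #> x) ` S) = carrier (G Mod M)"
    using h.generate_img[OF S(2)] S(3) by (simp add: carrier_FactGroup)
  then show ?thesis unfolding finitely_generated_group_def
    using S h.hom_closed by (intro conjI exI[of _ "(\<lambda>x. M #> x) ` S"]) auto
qed

lemma FactGroup_eq_one_iff:
  assumes "M \<lhd> G" "x \<in> carrier G"
  shows "M #> x = M \<longleftrightarrow> x \<in> M"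
  using assms coset_join1 coset_join2 normal_imp_subgroup subgroup.subset by metis

text \<open>
  Iterated commutators with \<open>x\<close>, stopped just before they become trivial, lead into the centre without
  leaving any normal subgroup that contains \<open>x\<close>.
\<close>

lemma central_consequence:
  assumes "x \<in> upper_central i" "x \<noteq> \<one>"
  obtains z where "z \<in> upper_central 1" "z \<noteq> \<one>" "\<And>M. M \<lhd> G \<Longrightarrow> x \<in> M \<Longrightarrow> z \<in> M"
proof -
  have "\<exists>z\<in>upper_central 1. z \<noteq> \<one> \<and> (\<forall>M. M \<lhd> G \<longrightarrow> x \<in> M \<longrightarrow> z \<in> M)"
    using assms
  proof (induction i arbitrary: x)
    case (Suc i)
    show ?case
    proof (cases "\<forall>y\<in>carrier G. commutator G x y = \<one>")
      case True
      then show ?thesis using Suc.prems by (intro bexI[of _ x]) auto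
    next
      case False
      then obtain y where y: "y \<in> carrier G" "commutator G x y \<noteq> \<one>" by blast
      then show ?thesis
        using Suc.IH[of "commutator G x y"] Suc.prems upper_central_commutator[OF Suc.prems(1) y(1)]
          commutator_normal_left by blast
    qed
  qed simp
  then show ?thesis using that by blast
qed

text \<open>
  Commutators of \<open>x\<close> are central modulo \<open>upper_central i\<close>, so \<open>[-, y]\<close> is multiplicative on
  powers of \<open>x\<close> there.
\<close>

lemma commutator_pow_mod:
  assumes "x \<in> upper_central (Suc (Suc i))" "y \<in> carrier G"
  shows "\<exists>w\<in>upper_central i. commutator G (x [^] (m::nat)) y = w \<otimes> commutator G x y [^] m"
proof (induction m)
  case 0
  have "commutator G \<one> y = \<one>" using assms by (simp add: commutator_def)
  then show ?case using subgroup.one_closed[OF upper_central_subgroup] by (auto intro!: bexI[of _ "\<one>"])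
next
  case (Suc m)
  interpret Z: normal "upper_central i" G by (rule upper_central_normal)
  obtain w where w: "w \<in> upper_central i" "commutator G (x [^] m) y = w \<otimes> commutator G x y [^] m"
    using Suc by blast
  define c where "c = commutator G x y"
  have x: "x \<in> carrier G" using assms upper_central_carrier by blast
  have c: "c \<in> carrier G" "c \<in> upper_central (Suc i)"
    using x assms(2) upper_central_commutator[OF assms] by (simp_all only: c_def commutator_closed)
  define v where "v = commutator G (x [^] m) c"
  have cx: "commutator G c (x [^] m) \<in> upper_central i"
    using upper_central_commutator[OF c(2)] x by simp
  have v: "v \<in> upper_central i"
    unfolding v_def by (rule commutator_swap_in[OF upper_central_subgroup c(1) _ cx]) (use x in simp)
  have "commutator G (x [^] Suc m) y = v \<otimes> (c \<otimes> (w \<otimes> c [^] m))"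
    using commutator_mult_left[of "x [^] m" x y] x assms(2) w by (simp add: c_def v_def)
  also have "\<dots> = (v \<otimes> (c \<otimes> w \<otimes> inv c)) \<otimes> (c \<otimes> c [^] m)"
    using c v w Z.mem_carrier by (simp add: group_word_simps)
  also have "c \<otimes> c [^] m = c [^] Suc m" using c nat_pow_Suc2[of c m] by simp
  finally show ?case
    using v w normal_conj_closed[OF upper_central_normal w(1) c(1)] unfolding c_def[symmetric] by blast
qed

text \<open>
  Torsion spreads from the centre to the whole upper central series: if \<open>x \<in> upper_central (i + 2)\<close>, then
  the commutators of \<open>x\<close> with generators are torsion modulo \<open>upper_central i\<close> by induction. Finitely
  many generators admit a common exponent \<open>m\<close>, and then \<open>x\<^sup>m\<close> commutes with everything modulo
  \<open>upper_central i\<close>.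
\<close>

lemma torsion_lift:
  assumes fg: "finitely_generated_group G"
    and centre: "\<And>x. x \<in> upper_central 1 \<Longrightarrow> \<exists>s. x [^] (q ^ s :: nat) = \<one>"
  shows "x \<in> upper_central i \<Longrightarrow> \<exists>s. x [^] (q ^ s :: nat) = \<one>"
proof -
  obtain S where S: "finite S" "S \<subseteq> carrier G" "generate G S = carrier G"
    using fg by (auto simp: finitely_generated_group_def)
  have step: "\<exists>s. x [^] (q ^ s :: nat) \<in> upper_central i" if "x \<in> upper_central (Suc i)" for x i
    using that
  proof (induction i arbitrary: x)
    case 0
    then show ?case using centre by simp
  next
    case (Suc i)
    interpret Z: normal "upper_central i" G by (rule upper_central_normal)
    have x: "x \<in> carrier G" using Suc.prems upper_central_carrier by blast
    have "\<exists>s. commutator G x y [^] (q ^ s :: nat) \<in> upper_central i" if "y \<in> carrier G" for y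
      using Suc.IH upper_central_commutator[OF Suc.prems that] by blast
    then obtain s where s: "\<And>y. y \<in> carrier G \<Longrightarrow> commutator G x y [^] (q ^ s y :: nat) \<in> upper_central i"
      by metis
    define n where "n = sum s S"
    have "commutator G (x [^] (q ^ n)) y \<in> upper_central i" if y: "y \<in> S" for y
    proof -
      have yG: "y \<in> carrier G" using y S by blast
      obtain w where w: "w \<in> upper_central i"
        "commutator G (x [^] (q ^ n)) y = w \<otimes> commutator G x y [^] (q ^ n)"
        using commutator_pow_mod[OF Suc.prems yG] by blast
      have "s y \<le> n" unfolding n_def using S(1) y by (simp add: member_le_sum)
      then have "q ^ n = q ^ s y * q ^ (n - s y)" by (simp flip: power_add)
      then have "commutator G x y [^] (q ^ n) = (commutator G x y [^] (q ^ s y)) [^] (q ^ (n - s y))"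
        using x yG by (simp add: nat_pow_pow)
      then have "commutator G x y [^] (q ^ n) \<in> upper_central i"
        using s[OF yG] subgroup_int_pow_closed[OF upper_central_subgroup, of _ i "int (q ^ (n - s y))"]
        by (simp add: int_pow_int del: of_nat_power)
      then show ?thesis using w by simp
    qed
    then have "S \<subseteq> {y \<in> carrier G. \<forall>u\<in>{x [^] (q ^ n)}. commutator G y u \<in> upper_central i}"
      using S(2) x commutator_swap_in[OF upper_central_subgroup] nat_pow_closed by blast
    then have "generate G S \<subseteq> {y \<in> carrier G. \<forall>u\<in>{x [^] (q ^ n)}. commutator G y u \<in> upper_central i}"
      by (rule generate_subgroup_incl)
        (use centralizer_mod_subgroup[OF upper_central_normal, of "{x [^] (q ^ n)}" i] x in simp)
    then have "commutator G y (x [^] (q ^ n)) \<in> upper_central i" if "y \<in> carrier G" for y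
      using S(3) that by blast
    then have "\<forall>y\<in>carrier G. commutator G (x [^] (q ^ n)) y \<in> upper_central i"
      using x commutator_swap_in[OF upper_central_subgroup] nat_pow_closed by blast
    then show ?case using x by auto
  qed
  show "x \<in> upper_central i \<Longrightarrow> \<exists>s. x [^] (q ^ s :: nat) = \<one>"
  proof (induction i arbitrary: x)
    case (Suc i)
    obtain s where s: "x [^] (q ^ s) \<in> upper_central i" using step[OF Suc.prems] by blast
    then obtain t where "(x [^] (q ^ s)) [^] (q ^ t) = \<one>" using Suc.IH by blast
    then have "x [^] (q ^ (s + t)) = \<one>"
      using upper_central_carrier[OF Suc.prems] by (simp add: nat_pow_pow power_add)
    then show ?case by blast
  qed (auto intro: exI[of _ 0])
qed

end

lemma (in comm_group) finite_generate_torsion: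
  assumes "finite S" "S \<subseteq> carrier G" "\<And>x. x \<in> S \<Longrightarrow> \<exists>n>0. x [^] (n::nat) = \<one>"
  shows "finite (generate G S)"
  using assms
proof (induction S)
  case empty
  then show ?case by (simp add: generate_empty)
next
  case (insert a S)
  have a: "a \<in> carrier G" and S: "S \<subseteq> carrier G" using insert.prems by auto
  obtain n where n: "n > 0" "a [^] (n::nat) = \<one>" using insert.prems(2) by blast
  interpret K: subgroup "generate G S" G by (rule generate_is_subgroup[OF S])
  define A where "A = (\<lambda>(e, t). a [^] (e::nat) \<otimes> t) ` (UNIV \<times> generate G S)"
  have red: "a [^] e = a [^] (e mod n)" for e :: nat
  proof -
    have "a [^] e = a [^] (n * (e div n) + e mod n)" by simp
    also have "\<dots> = (a [^] n) [^] (e div n) \<otimes> a [^] (e mod n)"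
      using a by (simp only: nat_pow_pow nat_pow_mult)
    finally show ?thesis using n a by simp
  qed
  have "A = (\<lambda>(e, t). a [^] (e::nat) \<otimes> t) ` ({..<n} \<times> generate G S)"
  proof -
    have "a [^] e \<otimes> t \<in> (\<lambda>(e, t). a [^] (e::nat) \<otimes> t) ` ({..<n} \<times> generate G S)"
      if "t \<in> generate G S" for e :: nat and t
      using that n(1) by (subst red) (auto intro!: image_eqI[of _ _ "(e mod n, t)"])
    then show ?thesis by (auto simp: A_def)
  qed
  then have "finite A" using insert by simp
  have A_I: "a [^] e \<otimes> t \<in> A" if "t \<in> generate G S" for e :: nat and t
    using that unfolding A_def by (intro image_eqI[of _ _ "(e, t)"]) auto
  have "generate G (insert a S) \<subseteq> A"
  proof (rule generate_subgroup_incl)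
    have "a \<in> A" using A_I[OF K.one_closed, of 1] a by simp
    moreover have "x \<in> A" if "x \<in> S" for x
      using A_I[OF generate.incl[OF that], of 0] that S by auto
    ultimately show "insert a S \<subseteq> A" by blast
    show "subgroup A G"
    proof (rule subgroupI)
      show "A \<subseteq> carrier G" using a by (auto simp: A_def)
      show "A \<noteq> {}" using \<open>a \<in> A\<close> by blast
    next
      fix x assume "x \<in> A"
      then obtain e t where x: "x = a [^] (e::nat) \<otimes> t" "t \<in> generate G S" by (auto simp: A_def)
      have "a [^] ((n - 1) * e) \<otimes> a [^] e = \<one>"
      proof -
        have "(n - 1) * e + e = n * e" using n(1) by (cases n) auto
        then have "a [^] ((n - 1) * e) \<otimes> a [^] e = (a [^] n) [^] e"
          using a by (simp add: nat_pow_mult nat_pow_pow)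
        then show ?thesis using n by simp
      qed
      then have "inv (a [^] e) = a [^] ((n - 1) * e)" using a by (intro inv_equality) auto
      then have "inv x = a [^] ((n - 1) * e) \<otimes> inv t" using x a by (simp add: inv_mult)
      then show "inv x \<in> A" using A_I x K.m_inv_closed by simp
    next
      fix x y assume "x \<in> A" "y \<in> A"
      then obtain e t e' t' where x: "x = a [^] (e::nat) \<otimes> t" "t \<in> generate G S"
        and y: "y = a [^] (e'::nat) \<otimes> t'" "t' \<in> generate G S" by (auto simp: A_def)
      have "x \<otimes> y = a [^] (e + e') \<otimes> (t \<otimes> t')"
        using a x y by (simp add: m_ac flip: nat_pow_mult)
      then show "x \<otimes> y \<in> A" using A_I x y K.m_closed by simp
    qed
  qed
  then show ?case using \<open>finite A\<close> finite_subset by blast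
qed

lemma (in group) FactGroup_comm_group:
  assumes "K \<lhd> G" "\<And>x y. x \<in> carrier G \<Longrightarrow> y \<in> carrier G \<Longrightarrow> commutator G x y \<in> K"
  shows "comm_group (G Mod K)"
proof -
  interpret K: normal K G by fact
  interpret Q: group "G Mod K" by (rule K.factorgroup_is_group)
  interpret h: group_hom G "G Mod K" "\<lambda>x. K #> x"
    by unfold_locales (rule K.r_coset_hom_Mod)
  show ?thesis
  proof (rule Q.group_comm_groupI)
    fix X Y assume "X \<in> carrier (G Mod K)" "Y \<in> carrier (G Mod K)"
    then obtain x y where xy: "x \<in> carrier G" "X = K #> x" "y \<in> carrier G" "Y = K #> y"
      by (auto simp: carrier_FactGroup)
    have "x \<otimes> y = commutator G x y \<otimes> (y \<otimes> x)"
      using xy by (simp add: commutator_def group_word_simps)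
    then have "K #> (x \<otimes> y) = (K #> commutator G x y) \<otimes>\<^bsub>G Mod K\<^esub> (K #> (y \<otimes> x))"
      using xy by (metis commutator_closed h.hom_mult m_closed)
    also have "K #> commutator G x y = \<one>\<^bsub>G Mod K\<^esub>"
      using FactGroup_eq_one_iff[OF assms(1)] assms(2) xy by simp
    finally have "K #> (x \<otimes> y) = K #> (y \<otimes> x)"
      using xy h.hom_closed[of "y \<otimes> x"] Q.l_one by (simp del: mult_FactGroup one_FactGroup)
    then show "X \<otimes>\<^bsub>G Mod K\<^esub> Y = Y \<otimes>\<^bsub>G Mod K\<^esub> X"
      using xy h.hom_mult by metis
  qed
qed

text \<open>
  Induction on the class. The quotient by \<open>upper_central c\<close> is abelian, generated by finitely many
  torsion elements, hence finite; so \<open>upper_central c\<close> is again finitely generated by Schreier's lemma,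
  and its class is smaller.
\<close>

lemma nilpotent_torsion_finite:
  assumes "group G" "finitely_generated_group G" "group.upper_central G c = carrier G"
    and "\<And>x. x \<in> carrier G \<Longrightarrow> \<exists>n>0. x [^]\<^bsub>G\<^esub> (n::nat) = \<one>\<^bsub>G\<^esub>"
  shows "finite (carrier G)"
  using assms
proof (induction c arbitrary: G)
  case 0
  then interpret group G by simp
  show ?case using 0 by (metis finite.emptyI finite.insertI upper_central.simps(1))
next
  case (Suc c)
  interpret group G by fact
  define K where "K = upper_central c"
  have K: "K \<lhd> G" "subgroup K G" using upper_central_normal upper_central_subgroup by (auto simp: K_def)
  interpret K: normal K G by fact
  have "commutator G x y \<in> K" if "x \<in> carrier G" "y \<in> carrier G" for x y
    using that Suc.prems(3) upper_central_commutator unfolding K_def by blast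
  then interpret Q: comm_group "G Mod K" by (rule FactGroup_comm_group[OF K(1)])
  interpret h: group_hom G "G Mod K" "\<lambda>x. K #>\<^bsub>G\<^esub> x"
    by unfold_locales (rule K.r_coset_hom_Mod)
  obtain T where T: "finite T" "T \<subseteq> carrier (G Mod K)" "generate (G Mod K) T = carrier (G Mod K)"
    using FactGroup_finitely_generated[OF K(1) Suc.prems(2)] by (auto simp: finitely_generated_group_def)
  have "\<exists>n>0. X [^]\<^bsub>G Mod K\<^esub> (n::nat) = \<one>\<^bsub>G Mod K\<^esub>" if X: "X \<in> T" for X
  proof -
    obtain x where x: "x \<in> carrier G" "X = K #>\<^bsub>G\<^esub> x" using subsetD[OF T(2) X] unfolding carrier_FactGroup by blast
    then obtain n where "n > 0" "x [^]\<^bsub>G\<^esub> (n::nat) = \<one>\<^bsub>G\<^esub>" using Suc.prems(4) by blast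
    then show ?thesis using x h.hom_nat_pow[of x n] h.hom_one by metis
  qed
  then have "finite (carrier (G Mod K))" using Q.finite_generate_torsion[OF T(1,2)] T(3) by simp
  then have fin: "finite_index G K" using finite_index_iff_FactGroup[OF K(1)] by simp
  have "finite (carrier (G\<lparr>carrier := K\<rparr>))"
  proof (rule Suc.IH)
    show "group (G\<lparr>carrier := K\<rparr>)" using K subgroup_imp_group by blast
    show "finitely_generated_group (G\<lparr>carrier := K\<rparr>)"
      using finitely_generated_group_finite_index[OF Suc.prems(2) K(2) fin] .
    show "group.upper_central (G\<lparr>carrier := K\<rparr>) c = carrier (G\<lparr>carrier := K\<rparr>)"
      using upper_central_full_subgroup[OF K(2), of c] by (simp add: K_def)
    show "\<exists>n>0. x [^]\<^bsub>G\<lparr>carrier := K\<rparr>\<^esub> (n::nat) = \<one>\<^bsub>G\<lparr>carrier := K\<rparr>\<^esub>"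
      if "x \<in> carrier (G\<lparr>carrier := K\<rparr>)" for x
      using that Suc.prems(4)[of x] by (auto simp flip: nat_pow_consistent)
  qed
  then show ?case using finite_index_finite_carrier[OF K(2) fin] by simp
qed

section \<open>Residual finiteness and torsion\<close>

context group begin

lemma prime_order_power:
  assumes "x \<in> carrier G" "x \<noteq> \<one>" "n > 0" "x [^] (n::nat) = \<one>"
  obtains q k where "prime q" "q dvd n" "x [^] (k::nat) \<noteq> \<one>" "(x [^] k) [^] (q::nat) = \<one>"
proof -
  have "\<exists>q k. prime q \<and> q dvd n \<and> x [^] (k::nat) \<noteq> \<one> \<and> (x [^] k) [^] (q::nat) = \<one>"
    using assms(3,4)
  proof (induction n rule: less_induct)
    case (less n)
    have "n \<noteq> 1" using less.prems assms by auto
    then obtain q where q: "prime q" "q dvd n" using prime_factor_nat by blast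
    then obtain m where m: "n = m * q" by (metis dvd_def mult.commute)
    have mn: "m < n" "0 < m" using m q less.prems prime_gt_1_nat[OF q(1)] by auto
    show ?case
    proof (cases "x [^] m = \<one>")
      case True
      then show ?thesis using less.IH[OF mn] m by (meson dvd_mult2)
    next
      case False
      then show ?thesis using q less.prems(2) assms(1) by (auto simp: m nat_pow_pow)
    qed
  qed
  then show ?thesis using that by blast
qed

lemma prime_power_torsion_or_other_prime:
  assumes "y \<in> carrier G" "n > 0" "y [^] (n::nat) = \<one>" "prime (q::nat)"
  obtains s where "y [^] (q ^ s) = \<one>"
  | r k where "prime r" "r \<noteq> q" "y [^] (k::nat) \<noteq> \<one>" "(y [^] k) [^] (r::nat) = \<one>"
proof -
  obtain s m where m: "n = q ^ s * m" "\<not> q dvd m"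
    using prime_power_canonical[OF assms(4)] assms(2) by (metis mult.commute)
  show ?thesis
  proof (cases "y [^] (q ^ s) = \<one>")
    case True
    then show ?thesis using that by blast
  next
    case False
    have "(y [^] (q ^ s)) [^] m = \<one>" "m > 0" using assms m by (auto simp: nat_pow_pow)
    then obtain r k where "prime r" "r dvd m" "(y [^] (q ^ s)) [^] (k::nat) \<noteq> \<one>"
        "((y [^] (q ^ s)) [^] k) [^] (r::nat) = \<one>"
      using prime_order_power[of "y [^] (q ^ s)" m] False assms by auto
    then show ?thesis using that(2)[of r "q ^ s * k"] m(2) assms(1) by (auto simp: nat_pow_pow)
  qed
qed

lemma central_generate_normal:
  assumes "y \<in> upper_central 1"
  shows "generate G {y} \<lhd> G"
proof (rule normal_generateI)
  have y: "y \<in> carrier G" using assms upper_central_carrier by blast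
  then show "{y} \<subseteq> carrier G" by simp
  fix h g assume hg: "h \<in> {y}" "g \<in> carrier G"
  have "commutator G y g = \<one>" using assms hg by simp
  then have "y \<otimes> g = g \<otimes> y"
    using hg y by (simp add: commutator_def) (metis inv_solve_right' m_assoc m_closed inv_closed l_one inv_equality inv_inv)
  then show "g \<otimes> h \<otimes> inv g \<in> {y}" using hg y by (metis inv_solve_right insertE emptyE insertI1 m_closed)
qed

text \<open>
  The element \<open>x\<close> is central, and it is a power of every nontrivial central element. In particular
  \<open>x\<^sup>2 = \<one>\<close> or \<open>x\<close> is a power of \<open>x\<^sup>2\<close>, so \<open>x\<close> is torsion. Some power of \<open>x\<close> has prime order \<open>q\<close>, and
  \<open>x\<close> is a power of it, so \<open>x\<close> itself has order \<open>q\<close>. If another prime divided the order of a central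
  element, then \<open>x\<close> would also be a power of an element with that prime order. So the centre is
  \<open>q\<close>-torsion, and then so is the whole group.
\<close>

lemma monolith_torsion:
  assumes fg: "finitely_generated_group G" and nil: "upper_central c = carrier G"
    and x: "x \<in> carrier G" "x \<noteq> \<one>"
    and mono: "\<And>K. K \<lhd> G \<Longrightarrow> K \<noteq> {\<one>} \<Longrightarrow> x \<in> K"
  obtains q where "prime (q::nat)" "x [^] q = \<one>" "\<And>y. y \<in> carrier G \<Longrightarrow> \<exists>s. y [^] (q ^ s) = \<one>"
proof -
  obtain z where z: "z \<in> upper_central 1" "z \<noteq> \<one>"
    using central_consequence[of x c] x nil by metis
  then have xZ: "x \<in> upper_central 1"
    using mono[OF upper_central_normal] by blast
  have cyc: "\<exists>e::int. x = y [^] e" if y: "y \<in> upper_central 1" "y \<noteq> \<one>" for y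
  proof -
    have "y \<in> generate G {y}" by (simp add: generate.incl)
    then have "x \<in> generate G {y}"
      using mono[OF central_generate_normal[OF y(1)]] y(2) by blast
    then show ?thesis using generate_pow[of y] upper_central_carrier[OF y(1)] by auto
  qed
  have torsion: "\<exists>n>0. y [^] (n::nat) = \<one>" if "y \<in> carrier G" "y [^] (e::int) = \<one>" "e \<noteq> 0" for y e
  proof (intro exI[of _ "nat \<bar>e\<bar>"] conjI)
    show "0 < nat \<bar>e\<bar>" using that by simp
    have "y [^] \<bar>e\<bar> = \<one>" using that int_pow_neg[of y e] by (cases "e \<ge> 0") auto
    then show "y [^] nat \<bar>e\<bar> = \<one>" by (metis abs_ge_zero int_nat_eq int_pow_int)
  qed
  have pow_central: "y [^] (k::nat) \<in> upper_central 1" if "y \<in> upper_central 1" for y k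
    using that subgroup_int_pow_closed[OF upper_central_subgroup, of y 1 "int k"] by (simp only: int_pow_int)
  have "\<exists>n>0. x [^] (n::nat) = \<one>"
  proof (cases "x [^] (2::nat) = \<one>")
    case False
    obtain e :: int where e: "x = (x [^] (2::nat)) [^] e"
      using cyc[OF pow_central[OF xZ] False] by blast
    then have "x = x [^] (2 * e)" using x by (metis int_pow_int int_pow_pow mult.commute of_nat_numeral)
    then have "x [^] (2 * e - 1) = \<one>" using x int_pow_diff[of x "2 * e" 1] by simp
    moreover have "2 * e - 1 \<noteq> 0" by presburger
    ultimately show ?thesis using torsion x by blast
  qed (auto intro!: exI[of _ 2])
  then obtain n where n: "n > 0" "x [^] (n::nat) = \<one>" by blast
  obtain q k where q: "prime q" "x [^] (k::nat) \<noteq> \<one>" "(x [^] k) [^] (q::nat) = \<one>"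
    using prime_order_power[OF x n] by metis
  have power_one: "x [^] r = \<one>"
    if y: "y \<in> upper_central 1" "y \<noteq> \<one>" "y [^] (r::nat) = \<one>" for y r
  proof -
    have yG: "y \<in> carrier G" using y upper_central_carrier by blast
    obtain e :: int where "x = y [^] e" using cyc[OF y(1,2)] by blast
    then have "x [^] int r = (y [^] int r) [^] e" using yG by (simp add: int_pow_pow mult.commute)
    then show ?thesis using y by (simp add: int_pow_int int_pow_one)
  qed
  have xq: "x [^] q = \<one>" using power_one[OF pow_central[OF xZ] q(2,3)] .
  have centre: "\<exists>s. y [^] (q ^ s) = \<one>" if y: "y \<in> upper_central 1" for y
  proof (cases "y = \<one>")
    case True
    then show ?thesis by auto
  next
    case False
    have yG: "y \<in> carrier G" using y upper_central_carrier by blast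
    obtain e :: int where e: "x = y [^] e" using cyc[OF y False] by blast
    then have "e \<noteq> 0" using x by auto
    moreover have "y [^] (e * int q) = \<one>"
      using xq e yG by (metis int_pow_int int_pow_pow)
    ultimately obtain m where m: "m > 0" "y [^] (m::nat) = \<one>"
      using torsion[of y "e * int q"] yG prime_gt_0_nat[OF q(1)] by auto
    show ?thesis
    proof (rule prime_power_torsion_or_other_prime[OF yG m q(1)])
      fix r k :: nat
      assume r: "prime r" "r \<noteq> q" "y [^] k \<noteq> \<one>" "(y [^] k) [^] r = \<one>"
      have "x [^] r = \<one>" using power_one[OF pow_central[OF y] r(3,4)] .
      moreover obtain u v :: int where "u * int r + v * int q = 1"
        using r q(1) primes_coprime[of r q] bezout_int[of "int r" "int q"] by auto
      ultimately have "x [^] (1::int) = \<one>"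
        using xq x by (metis int_pow_closed int_pow_int int_pow_mult int_pow_one int_pow_pow l_one mult.commute)
      then show ?thesis using x by simp
    qed blast
  qed
  show ?thesis
    using that[OF q(1) xq] torsion_lift[OF fg centre] nil by blast
qed

lemma FactGroup_preimage_normal:
  assumes M: "M \<lhd> G" and K: "K \<lhd> G Mod M"
  shows "{a \<in> carrier G. M #> a \<in> K} \<lhd> G" and "M \<subseteq> {a \<in> carrier G. M #> a \<in> K}"
proof -
  interpret M: normal M G by fact
  interpret K: normal K "G Mod M" by fact
  interpret Q: group "G Mod M" by (rule M.factorgroup_is_group)
  interpret h: group_hom G "G Mod M" "\<lambda>x. M #> x"
    by unfold_locales (rule M.r_coset_hom_Mod)
  note K_sub = normal_imp_subgroup[OF K]
  have one: "M \<in> K" using subgroup.one_closed[OF K_sub] by simp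
  show "M \<subseteq> {a \<in> carrier G. M #> a \<in> K}"
  proof
    fix x assume "x \<in> M"
    moreover from this have x: "x \<in> carrier G" using M.subset by blast
    ultimately have "M #> x = M" using FactGroup_eq_one_iff[OF M] by blast
    then show "x \<in> {a \<in> carrier G. M #> a \<in> K}" using x one by simp
  qed
  show "{a \<in> carrier G. M #> a \<in> K} \<lhd> G" unfolding normal_inv_iff
  proof (intro conjI ballI subgroupI)
    show "{a \<in> carrier G. M #> a \<in> K} \<noteq> {}"
      using one FactGroup_eq_one_iff[OF M one_closed] by auto
    show "inv a \<in> {a \<in> carrier G. M #> a \<in> K}" if "a \<in> {a \<in> carrier G. M #> a \<in> K}" for a
      using that h.hom_inv[of a] subgroup.m_inv_closed[OF K_sub, of "M #> a"] by auto
    show "a \<otimes> b \<in> {a \<in> carrier G. M #> a \<in> K}"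
      if "a \<in> {a \<in> carrier G. M #> a \<in> K}" "b \<in> {a \<in> carrier G. M #> a \<in> K}" for a b
      using that h.hom_mult[of a b] subgroup.m_closed[OF K_sub, of "M #> a" "M #> b"] by auto
    show "g \<otimes> a \<otimes> inv g \<in> {a \<in> carrier G. M #> a \<in> K}"
      if "g \<in> carrier G" "a \<in> {a \<in> carrier G. M #> a \<in> K}" for g a
    proof -
      have "M #> (g \<otimes> a \<otimes> inv g) = (M #> g) \<otimes>\<^bsub>G Mod M\<^esub> (M #> a) \<otimes>\<^bsub>G Mod M\<^esub> inv\<^bsub>G Mod M\<^esub> (M #> g)"
        using that by (simp del: mult_FactGroup)
      then show ?thesis
        using that group.normal_conj_closed[OF M.factorgroup_is_group K, of "M #> a" "M #> g"] h.hom_closed by auto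
    qed
  qed auto
qed

lemma exists_maximal_normal_avoiding:
  assumes L: "L \<lhd> G" "x \<notin> L"
  obtains M where "M \<lhd> G" "L \<subseteq> M" "x \<notin> M" "\<And>N. N \<lhd> G \<Longrightarrow> M \<subset> N \<Longrightarrow> x \<in> N"
proof -
  let ?A = "{M. M \<lhd> G \<and> L \<subseteq> M \<and> x \<notin> M}"
  have "\<exists>M\<in>?A. \<forall>X\<in>?A. M \<subseteq> X \<longrightarrow> X = M"
  proof (rule subset_Zorn_nonempty)
    show "?A \<noteq> {}" using L by blast
    fix C assume C: "C \<noteq> {}" "subset.chain ?A C"
    have CA: "C \<subseteq> ?A" and lin: "\<And>A B. A \<in> C \<Longrightarrow> B \<in> C \<Longrightarrow> A \<subseteq> B \<or> B \<subseteq> A"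
      using C(2) by (auto simp: subset.chain_def)
    have N: "A \<lhd> G" "subgroup A G" if "A \<in> C" for A
      using that CA normal_imp_subgroup by auto
    have "\<Union>C \<lhd> G" unfolding normal_inv_iff
    proof (intro conjI ballI subgroupI)
      show "\<Union>C \<subseteq> carrier G" using subgroup.subset[OF N(2)] by blast
      show "\<Union>C \<noteq> {}" using C(1) subgroup.one_closed[OF N(2)] by blast
      show "inv a \<in> \<Union>C" if a: "a \<in> \<Union>C" for a
      proof -
        obtain A where "A \<in> C" "a \<in> A" using a by blast
        then show ?thesis using subgroup.m_inv_closed[OF N(2)] by blast
      qed
      show "a \<otimes> b \<in> \<Union>C" if ab: "a \<in> \<Union>C" "b \<in> \<Union>C" for a b
      proof -
        obtain A B where "A \<in> C" "B \<in> C" "a \<in> A" "b \<in> B" using ab by blast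
        then show ?thesis using lin[of A B] subgroup.m_closed[OF N(2)] by blast
      qed
      show "g \<otimes> a \<otimes> inv g \<in> \<Union>C" if g: "g \<in> carrier G" and a: "a \<in> \<Union>C" for g a
      proof -
        obtain A where "A \<in> C" "a \<in> A" using a by blast
        then show ?thesis using normal_conj_closed[OF N(1)] g by blast
      qed
    qed
    moreover obtain A where "A \<in> C" using C(1) by blast
    moreover have "L \<subseteq> A" "x \<notin> \<Union>C" using CA \<open>A \<in> C\<close> by auto
    ultimately show "\<Union>C \<in> ?A" by auto
  qed
  then obtain M where M: "M \<in> ?A" "\<forall>X\<in>?A. M \<subseteq> X \<longrightarrow> X = M" by (rule bexE)
  show ?thesis
  proof (rule that[of M])
    fix N assume N: "N \<lhd> G" "M \<subset> N"
    show "x \<in> N"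
    proof (rule ccontr)
      assume "x \<notin> N"
      then have "N \<in> ?A" using N M(1) by auto
      then have "M \<subseteq> N \<longrightarrow> N = M" by (rule bspec[OF M(2)])
      then show False using N(2) by auto
    qed
  qed (use M(1) in simp_all)
qed

text \<open>
  In the quotient by a normal subgroup \<open>M\<close> that is maximal among those avoiding \<open>x\<close>, the image of \<open>x\<close>
  lies in every nontrivial normal subgroup. This contains residual finiteness; moreover,
  \<open>q\<close> is determined if a power of \<open>x\<close> with prime exponent is known to be in \<open>L\<close>.
\<close>

lemma residual_prime_quotient:
  assumes fg: "finitely_generated_group G" and nil: "upper_central c = carrier G"
    and L: "L \<lhd> G" "x \<in> carrier G" "x \<notin> L"
  obtains M q where "M \<lhd> G" "L \<subseteq> M" "x \<notin> M" "prime (q::nat)" "x [^] q \<in> M"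
    "\<And>y. y \<in> carrier G \<Longrightarrow> \<exists>s. y [^] (q ^ s) \<in> M" "finite_index G M"
proof -
  obtain M where M: "M \<lhd> G" "L \<subseteq> M" "x \<notin> M" "\<And>N. N \<lhd> G \<Longrightarrow> M \<subset> N \<Longrightarrow> x \<in> N"
    using exists_maximal_normal_avoiding[OF L(1,3)] by blast
  interpret M: normal M G by (rule M(1))
  interpret Q: group "G Mod M" by (rule M.factorgroup_is_group)
  interpret h: group_hom G "G Mod M" "\<lambda>x. M #> x"
    by unfold_locales (rule M.r_coset_hom_Mod)
  have fgQ: "finitely_generated_group (G Mod M)" by (rule FactGroup_finitely_generated[OF M(1) fg])
  have nilQ: "Q.upper_central c = carrier (G Mod M)" by (rule upper_central_full_FactGroup[OF M(1) nil])
  have pow: "M #> (y [^] (n::nat)) = (M #> y) [^]\<^bsub>G Mod M\<^esub> n" if "y \<in> carrier G" for y n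
    using that by (rule h.hom_nat_pow)
  have mono: "M #> x \<in> K" if K: "K \<lhd> G Mod M" "K \<noteq> {\<one>\<^bsub>G Mod M\<^esub>}" for K
  proof -
    interpret K: normal K "G Mod M" by (rule K(1))
    let ?N = "{a \<in> carrier G. M #> a \<in> K}"
    obtain Y where Y: "Y \<in> K" "Y \<noteq> M" using K(2) subgroup.one_closed[OF normal_imp_subgroup[OF K(1)]] by auto
    then obtain y where y: "y \<in> carrier G" "Y = M #> y"
      using K.subset by (auto simp: carrier_FactGroup)
    have "y \<notin> M" using Y y FactGroup_eq_one_iff[OF M(1)] by blast
    then have "M \<subset> ?N" using FactGroup_preimage_normal(2)[OF M(1) K(1)] Y y by blast
    then show ?thesis using M(4) FactGroup_preimage_normal(1)[OF M(1) K(1)] by blast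
  qed
  have "M #> x \<noteq> \<one>\<^bsub>G Mod M\<^esub>" using FactGroup_eq_one_iff[OF M(1) L(2)] M(3) by simp
  then obtain q where q: "prime (q::nat)" "(M #> x) [^]\<^bsub>G Mod M\<^esub> q = \<one>\<^bsub>G Mod M\<^esub>"
      "\<And>Y. Y \<in> carrier (G Mod M) \<Longrightarrow> \<exists>s. Y [^]\<^bsub>G Mod M\<^esub> (q ^ s) = \<one>\<^bsub>G Mod M\<^esub>"
    using Q.monolith_torsion[OF fgQ nilQ h.hom_closed[OF L(2)] _ mono] by blast
  have tors: "\<exists>s. y [^] (q ^ s) \<in> M" if y: "y \<in> carrier G" for y
    using q(3)[OF h.hom_closed[OF y]] FactGroup_eq_one_iff[OF M(1)] y
    by (auto simp flip: pow[OF y])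
  have "finite (carrier (G Mod M))"
    using nilpotent_torsion_finite[OF Q.is_group fgQ nilQ] q(1,3) prime_gt_0_nat
    by (metis zero_less_power)
  then have "finite_index G M" using finite_index_iff_FactGroup[OF M(1)] by simp
  moreover have "x [^] q \<in> M"
    using q(2) FactGroup_eq_one_iff[OF M(1)] L(2) by (simp flip: pow[OF L(2)])
  ultimately show ?thesis using that M q(1) tors by blast
qed

lemma residually_finite_subset:
  assumes fg: "finitely_generated_group G" and nil: "upper_central c = carrier G"
    and K: "K \<lhd> G" and E: "finite E" "E \<subseteq> carrier G" "E \<inter> K = {}"
  obtains W where "subgroup W G" "finite_index G W" "K \<subseteq> W" "E \<inter> W = {}"
proof -
  have "\<exists>W. subgroup W G \<and> finite_index G W \<and> K \<subseteq> W \<and> E \<inter> W = {}"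
    using E
  proof (induction E)
    case empty
    then show ?case using subgroup_self finite_index_carrier K normal_imp_subgroup subgroup.subset by blast
  next
    case (insert e E)
    then obtain W where W: "subgroup W G" "finite_index G W" "K \<subseteq> W" "E \<inter> W = {}" by auto
    have e: "e \<in> carrier G" "e \<notin> K" using insert.prems by auto
    obtain M where M: "M \<lhd> G" "K \<subseteq> M" "e \<notin> M" "finite_index G M"
      by (rule residual_prime_quotient[OF fg nil K e])
    then show ?case
      using W finite_index_Int[OF W(1) normal_imp_subgroup[OF M(1)] W(2) M(4)]
        subgroups_Inter_pair[OF W(1) normal_imp_subgroup[OF M(1)]]
      by (intro exI[of _ "W \<inter> M"]) auto
  qed
  then show ?thesis using that by blast
qed

lemma generate_insert_normal:
  assumes K: "K \<lhd> G" and a: "a \<in> carrier G" and x: "x \<in> generate G (insert a K)"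
  shows "\<exists>e::int. \<exists>k\<in>K. x = a [^] e \<otimes> k"
proof -
  interpret K: normal K G by fact
  have "x \<in> carrier G \<and> (\<exists>e::int. \<exists>k\<in>K. x = a [^] e \<otimes> k)" using x
  proof (induction rule: generate.induct)
    case one
    then show ?case by (auto intro!: exI[of _ 0] bexI[of _ \<one>])
  next
    case (incl h)
    then show ?case
    proof (cases "h = a")
      case True
      then show ?thesis using a by (auto intro!: exI[of _ 1] bexI[of _ \<one>])
    next
      case False
      then have "h \<in> K" using incl by simp
      then show ?thesis by (auto intro!: exI[of _ 0] bexI[of _ h])
    qed
  next
    case (inv h)
    then show ?case
    proof (cases "h = a")
      case True
      then show ?thesis using a by (auto intro!: exI[of _ "-1"] bexI[of _ \<one>] simp: int_pow_neg)
    next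
      case False
      then have "inv h \<in> K" using inv by simp
      then show ?thesis by (auto intro!: exI[of _ 0] bexI[of _ "inv h"])
    qed
  next
    case (eng h1 h2)
    then obtain e1 e2 :: int and k1 k2 where k: "k1 \<in> K" "k2 \<in> K" "h1 = a [^] e1 \<otimes> k1" "h2 = a [^] e2 \<otimes> k2"
      by blast
    define b where "b = a [^] e2"
    have b: "b \<in> carrier G" using a by (simp add: b_def)
    have "h1 \<otimes> h2 = a [^] e1 \<otimes> b \<otimes> ((inv b \<otimes> k1 \<otimes> b) \<otimes> k2)"
      using k a b by (simp add: b_def[symmetric] group_word_simps)
    also have "a [^] e1 \<otimes> b = a [^] (e1 + e2)" using a by (simp add: b_def int_pow_mult)
    finally show ?case
      using eng k b normal_conj_closed'[OF K k(1) b] by blast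
  qed
  then show ?thesis by blast
qed

text \<open>
  For normal \<open>L\<close> this says that \<open>G/L\<close> is virtually torsion-free. It is phrased inside \<open>G\<close> because it is
  propagated down a chain of subgroups \<open>L\<close>: the subgroups \<open>V\<close> for all of them then live in one group.
\<close>

definition virtually_torsion_free_mod :: "'a set \<Rightarrow> bool" where
  "virtually_torsion_free_mod L \<longleftrightarrow> (\<exists>V. subgroup V G \<and> finite_index G V \<and>
     (\<forall>x\<in>V. \<forall>m>0. x [^] (m::nat) \<in> L \<longrightarrow> x \<in> L))"

text \<open>
  The passage from \<open>\<langle>a\<rangle>K\<close> to \<open>K\<close>. If \<open>a\<close> is torsion modulo \<open>K\<close>, then \<open>\<langle>a\<rangle>K / K\<close> is finite, and residual
  finiteness provides a subgroup of finite index that meets it trivially. If not, then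
  \<open>\<langle>a\<rangle>K / K\<close> is infinite cyclic, and no further shrinking is needed.
\<close>

lemma virtually_torsion_free_mod_step:
  assumes fg: "finitely_generated_group G" and nil: "upper_central c = carrier G"
    and K: "K \<lhd> G" and a: "a \<in> carrier G"
    and L: "virtually_torsion_free_mod (generate G (insert a K))"
  shows "virtually_torsion_free_mod K"
proof -
  interpret K: normal K G by fact
  let ?L = "generate G (insert a K)"
  obtain V where V: "subgroup V G" "finite_index G V"
    "\<And>x m. x \<in> V \<Longrightarrow> m > 0 \<Longrightarrow> x [^] (m::nat) \<in> ?L \<Longrightarrow> x \<in> ?L"
    using L unfolding virtually_torsion_free_mod_def by blast
  have KL: "K \<subseteq> ?L" by (auto intro: generate.incl)
  show ?thesis
  proof (cases "\<exists>n::nat. n > 0 \<and> a [^] n \<in> K")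
    case True
    then obtain n :: nat where n: "n > 0" "a [^] n \<in> K" by blast
    define E where "E = (\<lambda>e. a [^] (e::nat)) ` {..<n} - K"
    obtain W where W: "subgroup W G" "finite_index G W" "K \<subseteq> W" "E \<inter> W = {}"
      using residually_finite_subset[OF fg nil K, of E] a by (auto simp: E_def)
    have WL: "x \<in> K" if x: "x \<in> W" "x \<in> ?L" for x
    proof -
      obtain e :: int and k where k: "k \<in> K" "x = a [^] e \<otimes> k"
        using generate_insert_normal[OF K a x(2)] by blast
      define r where "r = nat (e mod int n)"
      have r: "r < n" "int r = e mod int n" using n by (auto simp: r_def nat_less_iff)
      have "e = int r + int n * (e div int n)" using r(2) by simp
      then have "a [^] e = a [^] int r \<otimes> (a [^] int n) [^] (e div int n)"
        using a by (metis int_pow_mult int_pow_pow)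
      then have ae: "a [^] e = a [^] r \<otimes> (a [^] n) [^] (e div int n)" by (simp only: int_pow_int)
      have k': "(a [^] n) [^] (e div int n) \<otimes> k \<in> K"
        using n k subgroup_int_pow_closed[OF K.is_subgroup] by auto
      define k' where "k' = (a [^] n) [^] (e div int n) \<otimes> k"
      have x_eq: "x = a [^] r \<otimes> k'" unfolding k(2) ae k'_def using a k by (simp add: m_assoc)
      have "a [^] r = x \<otimes> inv k'" unfolding x_eq using a k' by (simp add: k'_def[symmetric] m_assoc)
      moreover have "x \<otimes> inv k' \<in> W"
        using x(1) k' W(1,3) unfolding k'_def by (meson subgroup.m_closed subgroup.m_inv_closed subsetD)
      ultimately have "a [^] r \<in> K" using W(4) r(1) by (auto simp: E_def)
      then show ?thesis unfolding x_eq using k' unfolding k'_def[symmetric] by simp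
    qed
    show ?thesis
      unfolding virtually_torsion_free_mod_def
    proof (intro exI[of _ "V \<inter> W"] conjI ballI allI impI)
      show "subgroup (V \<inter> W) G" using subgroups_Inter_pair V W by blast
      show "finite_index G (V \<inter> W)" using finite_index_Int V W by blast
      show "x \<in> K" if "x \<in> V \<inter> W" "m > 0" "x [^] (m::nat) \<in> K" for x m
        using that V(3)[of x m] KL WL by blast
    qed
  next
    case False
    interpret Q: group "G Mod K" by (rule K.factorgroup_is_group)
    interpret h: group_hom G "G Mod K" "\<lambda>x. K #> x"
      by unfold_locales (rule K.r_coset_hom_Mod)
    have aint: "e = 0" if "a [^] (e::int) \<in> K" for e
    proof (rule ccontr)
      assume e: "e \<noteq> 0"
      have "a [^] int (nat \<bar>e\<bar>) \<in> K"
        using that subgroup.m_inv_closed[OF K.is_subgroup that] int_pow_neg[OF a, of e] by (cases "e \<ge> 0") auto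
      then show False using False e by (metis int_pow_int zero_less_abs_iff zero_less_nat_eq)
    qed
    have "x \<in> K" if x: "x \<in> V" "m > 0" "x [^] (m::nat) \<in> K" for x m
    proof -
      have "x \<in> ?L" using V(3)[OF x(1,2)] x(3) KL by blast
      then obtain e :: int and k where k: "k \<in> K" "x = a [^] e \<otimes> k"
        using generate_insert_normal[OF K a] by blast
      have "K #> k = \<one>\<^bsub>G Mod K\<^esub>" using k FactGroup_eq_one_iff[OF K] by simp
      then have "K #> x = K #> (a [^] e)"
        unfolding k(2) using a k(1) Q.r_one[OF h.hom_closed[of "a [^] e"]]
        by (metis K.mem_carrier h.hom_mult int_pow_closed)
      then have "K #> (x [^] int m) = K #> ((a [^] e) [^] int m)"
        using a k by (simp only: h.hom_int_pow int_pow_closed K.mem_carrier m_closed)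
      moreover have "K #> (x [^] int m) = K"
        using x(3) FactGroup_eq_one_iff[OF K, of "x [^] int m"] K.mem_carrier by (simp only: int_pow_int)
      ultimately have "a [^] (e * int m) \<in> K"
        using a FactGroup_eq_one_iff[OF K, of "(a [^] e) [^] int m"] by (simp add: int_pow_pow)
      then have "e = 0" using aint[of "e * int m"] x(2) by simp
      then show ?thesis using k by simp
    qed
    then show ?thesis using V unfolding virtually_torsion_free_mod_def by blast
  qed
qed

lemma between_central_normal:
  assumes "subgroup K G" "K \<subseteq> lower_central_series G i" "lower_central_series G (Suc i) \<subseteq> K"
  shows "K \<lhd> G"
  unfolding normal_inv_iff
proof (intro conjI ballI assms(1))
  fix g k assume g: "g \<in> carrier G" and k: "k \<in> K"
  then have kG: "k \<in> carrier G" using subgroup.subset[OF assms(1)] by blast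
  have "commutator G k g \<in> K" using lower_central_commutator[of k i g] g k assms by blast
  then have "commutator G g k \<otimes> k \<in> K"
    using commutator_swap_in[OF assms(1) kG g] k subgroup.m_closed[OF assms(1)] by blast
  then show "g \<otimes> k \<otimes> inv g \<in> K" using commutator_mult_self[OF g kG] by simp
qed

text \<open>
  Modulo the next term, the lower central series is generated by commutators of generators, since
  commutators are bilinear there. Bilinearity enters through \<open>centralizer_mod_subgroup\<close>, first in one
  argument and then in the other.
\<close>

lemma lower_central_finitely_generated_mod:
  assumes "finitely_generated_group G"
  obtains T where "finite T" "T \<subseteq> lower_central_series G i"
    "generate G (T \<union> lower_central_series G (Suc i)) = lower_central_series G i"
proof -
  note C_sub = normal_imp_subgroup[OF lower_central_normal]
  obtain S where S: "finite S" "S \<subseteq> carrier G" "generate G S = carrier G"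
    using assms by (auto simp: finitely_generated_group_def)
  have "\<exists>T. finite T \<and> T \<subseteq> lower_central_series G i \<and>
    generate G (T \<union> lower_central_series G (Suc i)) = lower_central_series G i"
  proof (induction i)
    case 0
    have "generate G S \<subseteq> generate G (S \<union> lower_central_series G (Suc 0))"
      by (rule mono_generate) simp
    moreover have "generate G (S \<union> lower_central_series G (Suc 0)) \<subseteq> carrier G"
      by (rule generate_incl) (use S(2) subgroup.subset[OF C_sub, of "Suc 0"] in blast)
    ultimately show ?case using S by (intro exI[of _ S]) (auto simp del: lower_central_series.simps(2))
  next
    case (Suc i)
    let ?C = "lower_central_series G"
    obtain T where T: "finite T" "T \<subseteq> ?C i" "generate G (T \<union> ?C (Suc i)) = ?C i"
      using Suc by blast
    have CG: "?C j \<subseteq> carrier G" for j by (rule subgroup.subset[OF C_sub])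
    define T' where "T' = (\<lambda>(a, s). commutator G a s) ` (T \<times> S)"
    have T': "finite T'" "T' \<subseteq> ?C (Suc i)"
      using T S(1) subsetD[OF T(2)] subsetD[OF S(2)] lower_central_commutator
      unfolding T'_def by (auto simp del: lower_central_series.simps)
    define K where "K = generate G (T' \<union> ?C (Suc (Suc i)))"
    have KC: "K \<subseteq> ?C (Suc i)"
      unfolding K_def by (rule generate_subgroup_incl[OF _ C_sub])
        (use T' lower_central_Suc_subset[of "Suc i"] in blast)
    have Ksub: "subgroup K G"
      unfolding K_def by (rule generate_is_subgroup) (use T' CG in blast)
    have K_C: "?C (Suc (Suc i)) \<subseteq> K" unfolding K_def by (meson UnCI generate.incl subsetI)
    have K: "K \<lhd> G" by (rule between_central_normal[OF Ksub KC K_C])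
    have 1: "generate G (T \<union> ?C (Suc i)) \<subseteq> {x \<in> carrier G. \<forall>y\<in>S. commutator G x y \<in> K}"
    proof (rule generate_subgroup_incl[OF _ centralizer_mod_subgroup[OF K S(2)]])
      have "commutator G x y \<in> K" if "x \<in> T" "y \<in> S" for x y
        unfolding K_def T'_def using that by (intro generate.incl) auto
      moreover have "commutator G x y \<in> K" if "x \<in> ?C (Suc i)" "y \<in> S" for x y
        using lower_central_commutator[OF that(1)] that(2) S(2) K_C by blast
      ultimately show "T \<union> ?C (Suc i) \<subseteq> {x \<in> carrier G. \<forall>y\<in>S. commutator G x y \<in> K}"
        using T(2) CG by blast
    qed
    have "generate G S \<subseteq> {y \<in> carrier G. \<forall>x\<in>?C i. commutator G y x \<in> K}"
    proof (rule generate_subgroup_incl[OF _ centralizer_mod_subgroup[OF K CG]])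
      show "S \<subseteq> {y \<in> carrier G. \<forall>x\<in>?C i. commutator G y x \<in> K}"
        using 1 T(3) S(2) CG commutator_swap_in[OF Ksub] by blast
    qed
    then have "{commutator G x y | x y. x \<in> ?C i \<and> y \<in> carrier G} \<subseteq> K"
      using S(3) CG commutator_swap_in[OF Ksub] by blast
    then have "?C (Suc i) \<subseteq> K"
      unfolding lower_central_Suc[of i] by (rule generate_subgroup_incl[OF _ Ksub])
    then show ?case using T' KC unfolding K_def by blast
  qed
  then show ?thesis using that by blast
qed

text \<open>
  The lower central series, refined by adding the finitely many generators of each term one at a time,
  descends to the trivial subgroup in steps with cyclic factors.
\<close>

lemma nilpotent_virtually_torsion_free:
  assumes fg: "finitely_generated_group G" and nil: "nilpotent_group G"
  obtains V where "subgroup V G" "finite_index G V"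
    "\<And>x m. x \<in> V \<Longrightarrow> m > 0 \<Longrightarrow> x [^] (m::nat) = \<one> \<Longrightarrow> x = \<one>"
proof -
  let ?C = "lower_central_series G"
  obtain c where c: "upper_central c = carrier G" using nilpotent_upper_central[OF nil] .
  obtain l where l: "?C l = {\<one>}" using nil by (auto simp: nilpotent_group_def)
  have "virtually_torsion_free_mod (?C i)" for i
  proof (induction i)
    case 0
    show ?case unfolding virtually_torsion_free_mod_def
      by (intro exI[of _ "carrier G"]) (auto simp: subgroup_self finite_index_carrier)
  next
    case (Suc i)
    obtain T where T: "finite T" "T \<subseteq> ?C i" "generate G (T \<union> ?C (Suc i)) = ?C i"
      using lower_central_finitely_generated_mod[OF fg] by blast
    have CG: "?C j \<subseteq> carrier G" for j
      using lower_central_normal normal_imp_subgroup subgroup.subset by blast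
    have "virtually_torsion_free_mod (generate G (U \<union> ?C (Suc i))) \<Longrightarrow>
        virtually_torsion_free_mod (generate G (?C (Suc i)))" if "finite U" "U \<subseteq> ?C i" for U
      using that
    proof (induction U)
      case (insert a U)
      let ?K = "generate G (U \<union> ?C (Suc i))"
      have UG: "U \<union> ?C (Suc i) \<subseteq> carrier G" "a \<in> carrier G" using insert.prems CG by blast+
      have Ksub: "subgroup ?K G" using generate_is_subgroup UG by blast
      have "?K \<lhd> G"
      proof (rule between_central_normal[OF Ksub, of i])
        show "?K \<subseteq> ?C i"
          by (rule generate_subgroup_incl[OF _ normal_imp_subgroup[OF lower_central_normal]])
            (use insert.prems lower_central_Suc_subset[of i] in blast)
        show "?C (Suc i) \<subseteq> ?K" by (meson UnCI generate.incl subsetI)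
      qed
      moreover have "generate G (insert a ?K) = generate G (insert a U \<union> ?C (Suc i))"
      proof
        show "generate G (insert a ?K) \<subseteq> generate G (insert a U \<union> ?C (Suc i))"
        proof (rule generate_subgroup_incl)
          show "subgroup (generate G (insert a U \<union> ?C (Suc i))) G"
            by (rule generate_is_subgroup) (use UG in blast)
          show "insert a ?K \<subseteq> generate G (insert a U \<union> ?C (Suc i))"
            using mono_generate[of "U \<union> ?C (Suc i)" "insert a U \<union> ?C (Suc i)"]
            by (simp add: generate.incl subset_insertI del: lower_central_series.simps)
        qed
        show "generate G (insert a U \<union> ?C (Suc i)) \<subseteq> generate G (insert a ?K)"
          by (rule mono_generate) (auto intro: generate.incl simp del: lower_central_series.simps)
      qed
      ultimately have "virtually_torsion_free_mod ?K"
        using virtually_torsion_free_mod_step[OF fg c _ UG(2), of ?K] insert.prems by simp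
      then show ?case using insert by blast
    qed simp
    from this[OF T(1,2)] show ?case
      using Suc T(3) generateI[OF normal_imp_subgroup[OF lower_central_normal], of "?C (Suc i)" "Suc i"]
        generate_subgroup_incl[OF order_refl normal_imp_subgroup[OF lower_central_normal], of "Suc i"]
        generate.incl by (metis subsetI subset_antisym)
  qed
  from this[of l] show ?thesis
    unfolding l virtually_torsion_free_mod_def using that by auto
qed

definition power_subgroup :: "nat \<Rightarrow> 'a set" where
  "power_subgroup m = generate G ((\<lambda>x. x [^] m) ` carrier G)"

lemma power_in_power_subgroup: "x \<in> carrier G \<Longrightarrow> x [^] m \<in> power_subgroup m"
  by (simp add: power_subgroup_def generate.incl)

lemma power_subgroup_minimal:
  assumes "subgroup H G" "\<And>x. x \<in> carrier G \<Longrightarrow> x [^] (m::nat) \<in> H"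
  shows "power_subgroup m \<subseteq> H"
  unfolding power_subgroup_def by (rule generate_subgroup_incl[OF _ assms(1)]) (use assms(2) in auto)

lemma pow_conj:
  assumes "x \<in> carrier G" "g \<in> carrier G"
  shows "g \<otimes> x [^] (m::nat) \<otimes> inv g = (g \<otimes> x \<otimes> inv g) [^] m"
proof (induction m)
  case (Suc m)
  have "(g \<otimes> x \<otimes> inv g) [^] Suc m = (g \<otimes> x [^] m \<otimes> inv g) \<otimes> (g \<otimes> x \<otimes> inv g)"
    by (simp add: Suc)
  also have "\<dots> = g \<otimes> x [^] Suc m \<otimes> inv g"
    using assms by (simp add: group_word_simps)
  finally show ?case ..
qed (use assms in simp)

lemma power_subgroup_normal: "power_subgroup m \<lhd> G"
  unfolding power_subgroup_def
  by (rule normal_generateI) (auto simp: pow_conj)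

lemma power_subgroup_finite_index:
  assumes fg: "finitely_generated_group G" and nil: "upper_central c = carrier G" and m: "m > 0"
  shows "finite_index G (power_subgroup m)"
proof -
  let ?M = "power_subgroup m"
  interpret M: normal ?M G by (rule power_subgroup_normal)
  interpret Q: group "G Mod ?M" by (rule M.factorgroup_is_group)
  interpret h: group_hom G "G Mod ?M" "\<lambda>x. ?M #> x"
    by unfold_locales (rule M.r_coset_hom_Mod)
  have "X [^]\<^bsub>G Mod ?M\<^esub> m = \<one>\<^bsub>G Mod ?M\<^esub>" if X: "X \<in> carrier (G Mod ?M)" for X
  proof -
    obtain x where x: "x \<in> carrier G" "X = ?M #> x" using X by (auto simp: carrier_FactGroup)
    have "?M #> (x [^] m) = ?M"
      using x FactGroup_eq_one_iff[OF power_subgroup_normal] power_in_power_subgroup by simp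
    then show ?thesis using x h.hom_nat_pow[OF x(1), of m] by simp
  qed
  then have "finite (carrier (G Mod ?M))"
    using nilpotent_torsion_finite[OF Q.is_group FactGroup_finitely_generated[OF power_subgroup_normal fg]
        upper_central_full_FactGroup[OF power_subgroup_normal nil]] m by blast
  then show ?thesis using finite_index_iff_FactGroup[OF power_subgroup_normal] by simp
qed

lemma power_subgroup_mono:
  "m dvd n \<Longrightarrow> power_subgroup n \<subseteq> power_subgroup m"
proof (rule power_subgroup_minimal)
  show "subgroup (power_subgroup m) G" using power_subgroup_normal normal_imp_subgroup by blast
  fix x assume x: "x \<in> carrier G" and "m dvd n"
  then obtain k where "n = m * k" by blast
  then have "x [^] n = (x [^] k) [^] m" using x by (simp add: nat_pow_pow mult.commute)
  then show "x [^] n \<in> power_subgroup m" using x power_in_power_subgroup by simp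
qed

text \<open>
  It is enough to treat a central element \<open>z\<close> with the property of \<open>central_consequence\<close>. As \<open>z\<close> has
  infinite order, it is not in the normal subgroup generated by \<open>z\<^sup>p\<close>. A maximal normal subgroup \<open>M\<close>
  above the latter that avoids \<open>z\<close> has a finite \<open>q\<close>-group as quotient, and \<open>q = p\<close> since the image of \<open>z\<close>
  has order \<open>p\<close>. A common exponent \<open>p\<^sup>s\<close> of this finite quotient gives the claim.
\<close>

lemma torsion_free_residually_p:
  assumes fg: "finitely_generated_group G" and nil: "upper_central c = carrier G"
    and tf: "\<And>x m. x \<in> carrier G \<Longrightarrow> m > 0 \<Longrightarrow> x [^] (m::nat) = \<one> \<Longrightarrow> x = \<one>"
    and p: "prime (p::nat)" and x: "x \<in> carrier G" "x \<noteq> \<one>"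
  obtains s where "x \<notin> power_subgroup (p ^ s)"
proof -
  obtain z where z: "z \<in> upper_central 1" "z \<noteq> \<one>" "\<And>M. M \<lhd> G \<Longrightarrow> x \<in> M \<Longrightarrow> z \<in> M"
    using central_consequence[of x c] x nil by metis
  have zG: "z \<in> carrier G" using z(1) upper_central_carrier by blast
  let ?L = "generate G {z [^] p}"
  have "z [^] p \<in> upper_central 1"
    using z(1) subgroup_int_pow_closed[OF upper_central_subgroup, of z 1 "int p"] by (simp only: int_pow_int)
  then have L: "?L \<lhd> G" by (rule central_generate_normal)
  have "z \<notin> ?L"
  proof
    assume "z \<in> ?L"
    then obtain e :: int where "z = (z [^] p) [^] e" using generate_pow[of "z [^] p"] zG by auto
    then have "z = z [^] (int p * e)" using zG by (metis int_pow_int int_pow_pow mult.commute)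
    then have 1: "z [^] (int p * e - 1) = \<one>" using zG int_pow_diff[of z "int p * e" 1] by simp
    have "int p * e - 1 \<noteq> 0" using prime_gt_1_nat[OF p] zmult_eq_1_iff[of "int p" e] by auto
    moreover have "z [^] nat \<bar>int p * e - 1\<bar> = \<one>"
    proof -
      have "z [^] \<bar>int p * e - 1\<bar> = \<one>"
        using 1 int_pow_neg[OF zG, of "int p * e - 1"] by (cases "int p * e - 1 \<ge> 0") auto
      then show ?thesis by (metis abs_ge_zero int_nat_eq int_pow_int)
    qed
    ultimately show False using tf[OF zG, of "nat \<bar>int p * e - 1\<bar>"] z(2) by simp
  qed
  then obtain M q where M: "M \<lhd> G" "?L \<subseteq> M" "z \<notin> M" "prime (q::nat)" "z [^] q \<in> M"
    "\<And>y. y \<in> carrier G \<Longrightarrow> \<exists>s. y [^] (q ^ s) \<in> M" "finite_index G M"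
    using residual_prime_quotient[OF fg nil L zG] by blast
  interpret M: normal M G by (rule M(1))
  have zp: "z [^] p \<in> M" using M(2) by (auto intro: generate.incl)
  have "q = p"
  proof (rule ccontr)
    assume "q \<noteq> p"
    then obtain u v :: int where uv: "u * int q + v * int p = 1"
      using M(4) p primes_coprime[of q p] bezout_int[of "int q" "int p"] by auto
    have "z [^] (u * int q) \<in> M" "z [^] (v * int p) \<in> M"
      using zp M(5) zG subgroup_int_pow_closed[OF M.is_subgroup, of "z [^] q" u]
        subgroup_int_pow_closed[OF M.is_subgroup, of "z [^] p" v]
      by (simp_all add: int_pow_pow mult.commute flip: int_pow_int)
    then have "z [^] (u * int q + v * int p) \<in> M" using zG by (simp add: int_pow_mult)
    then show False using uv M(3) zG by simp
  qed
  obtain R where R: "finite R" "R \<subseteq> carrier G" "\<And>y. y \<in> carrier G \<Longrightarrow> \<exists>r\<in>R. inv r \<otimes> y \<in> M"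
    using finite_index_representatives[OF M.is_subgroup M(7)] by blast
  obtain s where s: "\<And>y. y \<in> carrier G \<Longrightarrow> y [^] (p ^ s y) \<in> M" using M(6) \<open>q = p\<close> by metis
  interpret Q: group "G Mod M" by (rule M.factorgroup_is_group)
  interpret h: group_hom G "G Mod M" "\<lambda>x. M #> x"
    by unfold_locales (rule M.r_coset_hom_Mod)
  have "y [^] (p ^ sum s R) \<in> M" if y: "y \<in> carrier G" for y
  proof -
    obtain r where r: "r \<in> R" "inv r \<otimes> y \<in> M" using R(3)[OF y] by blast
    have rG: "r \<in> carrier G" using r R by blast
    have "s r \<le> sum s R" using R(1) r(1) by (simp add: member_le_sum)
    then have ps: "p ^ sum s R = p ^ s r * p ^ (sum s R - s r)" by (simp flip: power_add)
    have "(r [^] (p ^ s r)) [^] (int (p ^ (sum s R - s r))) \<in> M"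
      using s[OF rG] subgroup_int_pow_closed[OF M.is_subgroup] by blast
    then have rM: "r [^] (p ^ sum s R) \<in> M"
      unfolding ps using rG by (simp add: int_pow_int nat_pow_pow del: of_nat_power)
    have "M #> (inv r \<otimes> y) = M" using r FactGroup_eq_one_iff[OF M(1)] by simp
    then have "\<one>\<^bsub>G Mod M\<^esub> = inv\<^bsub>G Mod M\<^esub> (M #> r) \<otimes>\<^bsub>G Mod M\<^esub> (M #> y)"
      using rG y by (metis h.hom_inv h.hom_mult inv_closed one_FactGroup)
    then have "M #> r = M #> y"
      using rG y by (metis Q.inv_solve_left Q.r_one h.hom_closed Q.one_closed)
    then have "M #> (r [^] (p ^ sum s R)) = M #> (y [^] (p ^ sum s R))"
      using rG y by (simp only: h.hom_nat_pow)
    then show ?thesis using rM FactGroup_eq_one_iff[OF M(1)] rG y nat_pow_closed by metis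
  qed
  then have "power_subgroup (p ^ sum s R) \<subseteq> M" by (rule power_subgroup_minimal[OF M.is_subgroup])
  then show ?thesis using that[of "sum s R"] M(1,3) z(3) by blast
qed

end

section \<open>Counting solutions in finite groups\<close>

context group begin

lemma coprime_power_inj:
  assumes "x \<in> carrier G" "y \<in> carrier G" "x [^] (n::nat) = y [^] n" "coprime n m"
    "x [^] (m::nat) = \<one>" "y [^] m = \<one>"
  shows "x = y"
proof -
  obtain u v :: int where uv: "u * int n + v * int m = 1"
    using assms(4) bezout_int[of "int n" "int m"] by auto
  have "z = (z [^] n) [^] u \<otimes> (z [^] m) [^] v" if "z \<in> carrier G" for z
  proof -
    have "(z [^] int n) [^] u \<otimes> (z [^] int m) [^] v = z [^] (u * int n + v * int m)"
      using that by (simp add: int_pow_pow int_pow_mult mult.commute)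
    then show ?thesis using that by (simp add: uv int_pow_int)
  qed
  from this[OF assms(1)] this[OF assms(2)] show ?thesis using assms by metis
qed

lemma coprime_powers_one:
  assumes "x \<in> carrier G" "x [^] (a::nat) = \<one>" "x [^] (b::nat) = \<one>" "coprime a b"
  shows "x = \<one>"
  using coprime_power_inj[of x \<one> a b] assms by simp

lemma upper_central_of_normal_normal:
  assumes A: "A \<lhd> G"
  shows "group.upper_central (G\<lparr>carrier := A\<rparr>) i \<lhd> G"
proof -
  note A_sub = normal_imp_subgroup[OF A]
  interpret A: group "G\<lparr>carrier := A\<rparr>" using A_sub subgroup_imp_group by blast
  have AG: "a \<in> carrier G" if "a \<in> A" for a using that subgroup.subset[OF A_sub] by blast
  have ZA: "z \<in> A" if "z \<in> A.upper_central i" for z i using A.upper_central_carrier[OF that] by simp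
  have "g \<otimes> x \<otimes> inv g \<in> A.upper_central i" if "g \<in> carrier G" "x \<in> A.upper_central i" for g x
    using that(2)
  proof (induction i arbitrary: x)
    case 0
    then show ?case using that(1) by simp
  next
    case (Suc i)
    have xA: "x \<in> A" using ZA[OF Suc.prems] .
    have "commutator (G\<lparr>carrier := A\<rparr>) (g \<otimes> x \<otimes> inv g) y \<in> A.upper_central i" if y: "y \<in> A" for y
    proof -
      let ?y = "inv g \<otimes> y \<otimes> g"
      have y': "?y \<in> A" using normal_conj_closed'[OF A y \<open>g \<in> carrier G\<close>] .
      have "commutator G (g \<otimes> x \<otimes> inv g) y = g \<otimes> commutator G x ?y \<otimes> inv g"
        using \<open>g \<in> carrier G\<close> AG[OF xA] AG[OF y] by (simp add: commutator_def group_word_simps)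
      moreover have "commutator G x ?y \<in> A.upper_central i"
        using A.upper_central_commutator[OF Suc.prems, of ?y] y' commutator_subgroup[OF A_sub xA y'] by simp
      ultimately show ?thesis
        using Suc.IH commutator_subgroup[OF A_sub normal_conj_closed[OF A xA \<open>g \<in> carrier G\<close>] y] by simp
    qed
    then show ?case using normal_conj_closed[OF A xA \<open>g \<in> carrier G\<close>] by simp
  qed
  then show ?thesis
    unfolding normal_inv_iff using incl_subgroup[OF A_sub A.upper_central_subgroup] by blast
qed

end

text \<open>
  The logarithm to base \<open>2\<close>, rounded up.
\<close>

definition dyadic_level :: "nat \<Rightarrow> nat" where
  "dyadic_level n = (LEAST j. n \<le> 2 ^ j)"

lemma le_dyadic_level: "n \<le> 2 ^ dyadic_level n"
  unfolding dyadic_level_def by (rule LeastI[of _ n]) (simp add: less_imp_le)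

lemma dyadic_level_le: "n \<le> 2 ^ j \<Longrightarrow> dyadic_level n \<le> j"
  unfolding dyadic_level_def by (rule Least_le)

lemma dyadic_level_mono: "m \<le> n \<Longrightarrow> dyadic_level m \<le> dyadic_level n"
  using le_dyadic_level le_trans dyadic_level_le by blast

lemma dyadic_level_add: "dyadic_level (m + n) \<le> Suc (max (dyadic_level m) (dyadic_level n))"
proof (rule dyadic_level_le)
  let ?M = "max (dyadic_level m) (dyadic_level n)"
  have "(2::nat) ^ dyadic_level m \<le> 2 ^ ?M" "(2::nat) ^ dyadic_level n \<le> 2 ^ ?M"
    by (rule power_increasing; simp)+
  then show "m + n \<le> 2 ^ Suc (max (dyadic_level m) (dyadic_level n))"
    using le_dyadic_level[of m] le_dyadic_level[of n] unfolding power_Suc by linarith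
qed

lemma dyadic_level_power [simp]: "dyadic_level (2 ^ j) = j"
  using dyadic_level_le[of "2 ^ j" j] le_dyadic_level[of "2 ^ j"] by simp

text \<open>
  The situation in a finite quotient \<open>G/M\<close>, with \<open>A = N/M\<close>.
\<close>

locale nilpotent_normal = group G for G (structure) +
  fixes A :: "'a set" and c :: nat
  assumes normal_A: "A \<lhd> G"
    and nilpotent_A: "group.upper_central (G\<lparr>carrier := A\<rparr>) c = A"
begin

abbreviation Z :: "nat \<Rightarrow> 'a set" where
  "Z \<equiv> group.upper_central (G\<lparr>carrier := A\<rparr>)"

lemma subgroup_A: "subgroup A G"
  using normal_A normal_imp_subgroup by blast

sublocale A: group "G\<lparr>carrier := A\<rparr>"
  by (rule subgroup_imp_group[OF subgroup_A])

lemma A_carrier: "a \<in> A \<Longrightarrow> a \<in> carrier G"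
  using subgroup.subset[OF subgroup_A] by blast

lemma Z_normal: "Z i \<lhd> G"
  by (rule upper_central_of_normal_normal[OF normal_A])

lemma Z_subset_A: "Z i \<subseteq> A"
  using A.upper_central_carrier by auto

lemma Z_commutator: "x \<in> Z (Suc i) \<Longrightarrow> y \<in> A \<Longrightarrow> commutator G x y \<in> Z i"
  using A.upper_central_commutator[of x i y] commutator_subgroup[OF subgroup_A] Z_subset_A by auto

text \<open>
  Any central series becomes a filtration with additive weights when the \<open>j\<close>-th term from the top is
  given the weights in \<open>(2\<^sup>j\<^sup>-\<^sup>1, 2\<^sup>j]\<close>: a commutator is one term below both of its entries, and
  the weight at most doubles when two weights are added. The price, a bound \<open>2\<^sup>c\<close> instead of \<open>c + 1\<close>
  for the length of the filtration, is harmless here.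
\<close>

definition filtration :: "nat \<Rightarrow> 'a set" where
  "filtration n = (if n = 0 then carrier G else Z (c - dyadic_level n))"

lemma filtration_commutator:
  assumes "0 < i" "0 < j" "x \<in> filtration i" "y \<in> filtration j" "dyadic_level j \<le> dyadic_level i"
  shows "commutator G x y \<in> filtration (i + j)"
proof -
  have x: "x \<in> Z (c - dyadic_level i)" and y: "y \<in> A"
    using assms Z_subset_A by (auto simp: filtration_def)
  have "dyadic_level (i + j) \<le> Suc (dyadic_level i)" using dyadic_level_add[of i j] assms by simp
  then have sub: "Z (c - Suc (dyadic_level i)) \<subseteq> filtration (i + j)"
    using assms(1) unfolding filtration_def by (auto intro: subsetD[OF A.upper_central_mono, rotated])
  show ?thesis
  proof (cases "c - dyadic_level i")
    case 0
    then have "x = \<one>" using x by simp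
    then have "commutator G x y = \<one>" using A_carrier[OF y] by (simp add: commutator_def)
    then show ?thesis
      using subgroup.one_closed[OF normal_imp_subgroup[OF Z_normal]] assms(1) by (simp add: filtration_def)
  next
    case (Suc d)
    then have "commutator G x y \<in> Z d" using x y Z_commutator by metis
    moreover have "c - Suc (dyadic_level i) = d" using Suc by simp
    ultimately show ?thesis using sub by blast
  qed
qed

sublocale filtered_group G filtration
proof (intro filtered_group.intro filtered_group_axioms.intro is_group)
  show "filtration 0 = carrier G" by (simp add: filtration_def)
  have sub: "subgroup (filtration i) G" for i
    using subgroup_self normal_imp_subgroup[OF Z_normal] by (simp add: filtration_def)
  fix i
  show "subgroup (filtration i) G" by (rule sub)
  show "filtration (Suc i) \<subseteq> filtration i"
  proof (cases "i = 0")
    case True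
    then show ?thesis using subgroup.subset[OF sub, of "Suc i"] by (simp add: filtration_def)
  next
    case False
    have "c - dyadic_level (Suc i) \<le> c - dyadic_level i"
      using dyadic_level_mono[of i "Suc i"] by simp
    from A.upper_central_mono[OF this] False show ?thesis by (simp add: filtration_def)
  qed
  fix j x y assume x: "x \<in> filtration i" and y: "y \<in> filtration j"
  have norm: "filtration i \<lhd> G" for i
    using Z_normal normal_self by (simp add: filtration_def)
  have xG: "x \<in> carrier G" and yG: "y \<in> carrier G"
    using x y subgroup.subset[OF sub] by blast+
  consider "i = 0" | "j = 0" | "0 < i" "0 < j" by blast
  then show "commutator G x y \<in> filtration (i + j)"
  proof cases
    case 1
    then show ?thesis using commutator_normal_right[OF norm xG y] by simp
  next
    case 2
    then show ?thesis using commutator_normal_left[OF norm x yG] by simp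
  next
    case 3
    show ?thesis
    proof (cases "dyadic_level j \<le> dyadic_level i")
      case True
      then show ?thesis using filtration_commutator 3 x y by blast
    next
      case False
      then have "commutator G y x \<in> filtration (j + i)"
        using filtration_commutator[of j i y x] 3 x y by simp
      then show ?thesis using commutator_swap_in[OF sub yG xG] by (simp add: add.commute)
    qed
  qed
qed

lemma filtration_1: "filtration 1 = A"
proof -
  have "dyadic_level 1 = 0" using dyadic_level_power[of 0] by simp
  then show ?thesis using nilpotent_A by (simp add: filtration_def)
qed

lemma filtration_last: "filtration (2 ^ c) = {\<one>}"
  by (simp add: filtration_def)

text \<open>
  Suppose that \<open>u\<close> has \<open>2\<^sup>c\<close> ones. Since \<open>u\<close> is constant modulo \<open>A\<close>, it takes values in \<open>A\<close>. If its values
  are in \<open>Z (j + 1)\<close>, then modulo \<open>Z j\<close> it is a function into an abelian group of exponent dividing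
  \<open>p\<^sup>s\<close> with vanishing \<open>2\<^sup>c\<close>-th differences and too many zeros, hence trivial. So the values
  descend through the upper central series of \<open>A\<close> to \<open>Z 0\<close>.
\<close>

lemma poly_seq_few_ones:
  assumes u: "poly_upto (2 ^ c) 0 u" and u0: "u 0 \<noteq> \<one>"
    and p: "prime p" "2 ^ c \<le> T" "T < p" and exp: "\<And>x. x \<in> A \<Longrightarrow> x [^] (p ^ s :: nat) = \<one>"
  shows "card {n \<in> {..T}. u n = \<one>} < 2 ^ c"
proof (rule ccontr)
  define R where "R = {n \<in> {..T}. u n = \<one>}"
  assume "\<not> card {n \<in> {..T}. u n = \<one>} < 2 ^ c"
  then have card: "2 ^ c \<le> card R" by (simp add: R_def)
  moreover have "(0::nat) < 2 ^ c" by simp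
  ultimately have "R \<noteq> {}" by auto
  then obtain m where m: "u m = \<one>" by (auto simp: R_def)
  have uG: "u n \<in> carrier G" for n using poly_upto_closed[OF u] .
  have d_in_A: "u (Suc n) \<otimes> inv (u n) \<in> A" for n
    using poly_upto_diff_power[OF u, of 1] filtration_1 by (simp add: seq_diff_def)
  have "u (Suc n) \<in> A \<longleftrightarrow> u n \<in> A" for n
  proof
    assume "u (Suc n) \<in> A"
    then have "inv (u (Suc n) \<otimes> inv (u n)) \<otimes> u (Suc n) \<in> A"
      using d_in_A subgroup.m_closed[OF subgroup_A] subgroup.m_inv_closed[OF subgroup_A] by blast
    then show "u n \<in> A" using uG[of n] uG[of "Suc n"] by (simp add: group_word_simps)
  next
    assume "u n \<in> A"
    then have "u (Suc n) \<otimes> inv (u n) \<otimes> u n \<in> A"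
      using d_in_A subgroup.m_closed[OF subgroup_A] by blast
    then show "u (Suc n) \<in> A" using uG[of n] uG[of "Suc n"] by (simp add: group_word_simps)
  qed
  then have iff0: "u n \<in> A \<longleftrightarrow> u 0 \<in> A" for n by (induction n) auto
  have inA: "u n \<in> A" for n using iff0[of n] iff0[of m] m subgroup.one_closed[OF subgroup_A] by simp
  have "k \<le> c \<Longrightarrow> \<forall>n. u n \<in> Z (c - k)" for k
  proof (induction k)
    case 0
    then show ?case using inA nilpotent_A by simp
  next
    case (Suc k)
    define j where "j = c - Suc k"
    have "c - k = Suc j" using Suc.prems by (simp add: j_def)
    then have uZ: "u n \<in> Z (Suc j)" for n using Suc by simp
    define H where "H = G\<lparr>carrier := Z (Suc j)\<rparr>"
    note ZS_sub = normal_imp_subgroup[OF Z_normal[of "Suc j"]]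
    interpret H: group H unfolding H_def by (rule subgroup_imp_group[OF ZS_sub])
    have H_ops: "x \<otimes>\<^bsub>H\<^esub> y = x \<otimes> y" "\<one>\<^bsub>H\<^esub> = \<one>" "carrier H = Z (Suc j)" for x y
      by (simp_all add: H_def)
    have H_inv: "inv\<^bsub>H\<^esub> x = inv x" if "x \<in> Z (Suc j)" for x
      unfolding H_def using m_inv_consistent[OF ZS_sub that] .
    have H_pow: "x [^]\<^bsub>H\<^esub> (n::nat) = x [^] n" for x n
      unfolding H_def by (simp add: nat_pow_def)
    have ZZ: "Z j \<subseteq> Z (Suc j)" by (rule A.upper_central_Suc_subset)
    have K: "Z j \<lhd> H"
      unfolding H_def by (rule normal_restrict_supergroup[OF ZS_sub Z_normal ZZ])
    have comm: "commutator H x y \<in> Z j" if "x \<in> carrier H" "y \<in> carrier H" for x y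
      using that Z_commutator[of x j y] Z_subset_A[of "Suc j"] commutator_subgroup[OF ZS_sub, of x y]
      unfolding H_def by auto
    interpret B: comm_group "H Mod Z j" by (rule H.FactGroup_comm_group[OF K comm])
    interpret K: normal "Z j" H by (rule K)
    interpret h: group_hom H "H Mod Z j" "\<lambda>x. Z j #>\<^bsub>H\<^esub> x"
      by unfold_locales (rule K.r_coset_hom_Mod)
    have one_iff: "Z j #>\<^bsub>H\<^esub> x = \<one>\<^bsub>H Mod Z j\<^esub> \<longleftrightarrow> x \<in> Z j" if "x \<in> Z (Suc j)" for x
      using H.FactGroup_eq_one_iff[OF K, of x] that H_ops by simp
    have dZ: "(seq_diff ^^ i) u n \<in> Z (Suc j)" for i n
    proof (induction i arbitrary: n)
      case (Suc i)
      have "(seq_diff ^^ Suc i) u n = (seq_diff ^^ i) u (Suc n) \<otimes> inv ((seq_diff ^^ i) u n)"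
        by (simp add: seq_diff_def)
      also have "\<dots> \<in> Z (Suc j)"
        by (intro subgroup.m_closed[OF ZS_sub] subgroup.m_inv_closed[OF ZS_sub] Suc)
      finally show ?case .
    qed (use uZ in \<open>simp only: funpow.simps id_apply\<close>)
    have "Z j #>\<^bsub>H\<^esub> u n = \<one>\<^bsub>H Mod Z j\<^esub>" for n
    proof -
      define D where "D = (\<lambda>i n. Z j #>\<^bsub>H\<^esub> ((seq_diff ^^ i) u n))"
      have D_closed: "D i n \<in> carrier (H Mod Z j)" for i n
        unfolding D_def by (rule h.hom_closed) (use dZ in \<open>simp only: H_ops(3)\<close>)
      have D_Suc: "D (Suc i) n = D i (Suc n) \<otimes>\<^bsub>H Mod Z j\<^esub> inv\<^bsub>H Mod Z j\<^esub> (D i n)" for i n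
      proof -
        have "D (Suc i) n = Z j #>\<^bsub>H\<^esub> ((seq_diff ^^ i) u (Suc n) \<otimes>\<^bsub>H\<^esub> inv\<^bsub>H\<^esub> ((seq_diff ^^ i) u n))"
          by (simp add: D_def seq_diff_def H_ops H_inv[OF dZ])
        also have "\<dots> = D i (Suc n) \<otimes>\<^bsub>H Mod Z j\<^esub> inv\<^bsub>H Mod Z j\<^esub> (D i n)"
          unfolding D_def using dZ h.hom_mult h.hom_inv H.inv_closed by (simp only: H_ops(3))
        finally show ?thesis .
      qed
      have D_last: "D (2 ^ c) n = \<one>\<^bsub>H Mod Z j\<^esub>" for n
      proof -
        have "(seq_diff ^^ (2 ^ c)) u n = \<one>"
          using poly_upto_diff_power[OF u order_refl, of n] filtration_last by simp
        then show ?thesis unfolding D_def using h.hom_one H_ops(2) by metis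
      qed
      have "D 0 n = \<one>\<^bsub>H Mod Z j\<^esub>"
      proof (rule B.vanishing_differences_few_zeros[where D = D and d = "2 ^ c" and Z = R and T = T])
        show "D i n \<in> carrier (H Mod Z j)" for i n by (rule D_closed)
        show "D (Suc i) n = D i (Suc n) \<otimes>\<^bsub>H Mod Z j\<^esub> inv\<^bsub>H Mod Z j\<^esub> (D i n)" for i n
          by (rule D_Suc)
        show "D (2 ^ c) n = \<one>\<^bsub>H Mod Z j\<^esub>" for n by (rule D_last)
        show "2 ^ c \<le> card R" "2 ^ c \<le> T" by (fact card, fact p(2))
        show "R \<subseteq> {..T}" by (auto simp: R_def)
        show "D 0 z = \<one>\<^bsub>H Mod Z j\<^esub>" if "z \<in> R" for z
          using that h.hom_one by (simp add: D_def R_def H_ops)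
        fix X k assume X: "X \<in> carrier (H Mod Z j)" "0 < k" "k \<le> T" "X [^]\<^bsub>H Mod Z j\<^esub> (k::nat) = \<one>\<^bsub>H Mod Z j\<^esub>"
        obtain x where x: "x \<in> carrier H" "X = Z j #>\<^bsub>H\<^esub> x" using X(1) unfolding carrier_FactGroup by blast
        have "x [^]\<^bsub>H\<^esub> (p ^ s) = \<one>\<^bsub>H\<^esub>" using exp[of x] x(1) Z_subset_A H_ops H_pow by auto
        then have "X [^]\<^bsub>H Mod Z j\<^esub> (p ^ s) = \<one>\<^bsub>H Mod Z j\<^esub>"
          unfolding x(2) using h.hom_nat_pow[OF x(1), of "p ^ s"] h.hom_one by metis
        moreover have "coprime k (p ^ s)"
        proof -
          have "\<not> p dvd k" using X(2,3) p(3) by (auto dest: dvd_imp_le)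
          then show ?thesis using prime_imp_coprime[OF p(1)] by (simp add: coprime_commute)
        qed
        ultimately show "X = \<one>\<^bsub>H Mod Z j\<^esub>" using B.coprime_powers_one[OF X(1,4)] by blast
      qed
      then show ?thesis by (simp add: D_def)
    qed
    then show ?case using one_iff uZ unfolding j_def[symmetric] by blast
  qed
  from this[of c] have "u 0 = \<one>" by simp
  then show False using u0 by simp
qed

end

lemma gterm_val_closed:
  assumes "group G" "xs \<in> tuples k (carrier G)" "gterm_vars t \<subseteq> {..<k}"
  shows "gterm_val G xs t \<in> carrier G"
proof -
  interpret group G by fact
  show ?thesis using assms(3)
    by (induction t) (use assms(2) in \<open>auto simp: tuples_def\<close>)
qed

lemma tuples_iff_nth: "xs \<in> tuples k A \<longleftrightarrow> length xs = k \<and> (\<forall>i<k. xs ! i \<in> A)"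
  by (auto simp: tuples_def set_conv_nth)

lemma finite_tuples: "finite A \<Longrightarrow> finite (tuples k A)"
  using finite_lists_length_eq[of A k] by (simp add: tuples_def conj_commute)

lemma card_tuples: "finite A \<Longrightarrow> card (tuples k A) = card A ^ k"
  using card_lists_length_eq[of A k] by (simp add: tuples_def conj_commute)

lemma sum_card_filter_swap:
  assumes "finite A" "finite B"
  shows "(\<Sum>a\<in>A. card {b \<in> B. P a b}) = (\<Sum>b\<in>B. card {a \<in> A. P a b})"
proof -
  have "(\<Sum>a\<in>A. card {b \<in> B. P a b}) = (\<Sum>a\<in>A. \<Sum>b\<in>B. if P a b then 1 else 0)"
    using assms by (simp add: sum.If_cases Int_def)
  also have "\<dots> = (\<Sum>b\<in>B. \<Sum>a\<in>A. if P a b then 1 else 0)" by (rule sum.swap)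
  also have "\<dots> = (\<Sum>b\<in>B. card {a \<in> A. P a b})"
    using assms by (simp add: sum.If_cases Int_def)
  finally show ?thesis .
qed

lemma card_filter_reindex:
  assumes "finite X" "inj_on f X" "f ` X \<subseteq> X"
  shows "card {x \<in> X. P (f x)} = card {x \<in> X. P x}"
proof (rule bij_betw_same_card[of f])
  have "f ` X = X" using endo_inj_surj[OF assms(1,3,2)] .
  then show "bij_betw f {x \<in> X. P (f x)} {x \<in> X. P x}"
    using assms(2) by (auto simp: bij_betw_def inj_on_def)
qed

context nilpotent_normal begin

text \<open>
  Count the pairs \<open>(n, h)\<close> with \<open>1 \<le> n \<le> T\<close> and \<open>h \<in> A\<^sup>k\<close> for which \<open>x\<^sub>0 h\<^sup>n\<close> gives a solution in two ways.
  For fixed \<open>n\<close>, the map \<open>h \<mapsto> x\<^sub>0 h\<^sup>n\<close> permutes \<open>A\<^sup>k\<close>. For fixed \<open>h\<close>, there are at most \<open>2\<^sup>c\<close> values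
  of \<open>n\<close>, as the quotient of the two sides of the equation is a polynomial sequence that is not \<open>\<one>\<close> at \<open>n = 0\<close>.
\<close>

lemma coset_few_solutions:
  assumes fin: "finite (carrier G)" and vars: "equation_vars \<phi> \<subseteq> {..<k}"
    and p: "prime p" "2 ^ c \<le> T" "T < p" and exp: "\<And>x. x \<in> A \<Longrightarrow> x [^] (p ^ s :: nat) = \<one>"
    and gs: "gs \<in> tuples k (carrier G)"
    and x0: "x0 \<in> tuples k A" "\<not> holds G \<phi> (map2 (\<otimes>) gs x0)"
  shows "T * card {xs \<in> tuples k A. holds G \<phi> (map2 (\<otimes>) gs xs)} \<le> 2 ^ c * card (tuples k A)"
proof -
  obtain l r where \<phi>: "\<phi> = Eq l r" by (cases \<phi>)
  let ?X = "tuples k A"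
  let ?sol = "\<lambda>xs. holds G \<phi> (map2 (\<otimes>) gs xs)"
  let ?m = "\<lambda>n hs. map2 (\<otimes>) x0 (map (\<lambda>h. h [^] (n::nat)) hs)"
  have finX: "finite ?X" using finite_tuples finite_subset[OF subgroup.subset[OF subgroup_A] fin] by blast
  have powA: "h [^] (n::nat) \<in> A" if "h \<in> A" for h n
    using that subgroup_int_pow_closed[OF subgroup_A that, of "int n"] by (simp add: int_pow_int)
  have mX: "?m n hs \<in> ?X" if "hs \<in> ?X" for n hs
    using that x0(1) powA subgroup.m_closed[OF subgroup_A] by (auto simp: tuples_iff_nth)
  have inj: "inj_on (?m n) ?X" if n: "n \<in> {1..T}" for n
  proof (rule inj_onI)
    fix hs hs' assume hs: "hs \<in> ?X" "hs' \<in> ?X" and eq: "?m n hs = ?m n hs'"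
    have "\<not> p dvd n" using n p(3) by (auto dest: dvd_imp_le)
    then have cop: "coprime n (p ^ s)"
      using prime_imp_coprime[OF p(1)] by (simp add: coprime_commute)
    show "hs = hs'"
    proof (rule nth_equalityI)
      show "length hs = length hs'" using hs by (simp add: tuples_def)
      fix i assume "i < length hs"
      then have i: "i < k" using hs by (simp add: tuples_def)
      then have A: "hs ! i \<in> A" "hs' ! i \<in> A" "x0 ! i \<in> A" using hs x0 by (auto simp: tuples_iff_nth)
      have "?m n hs ! i = ?m n hs' ! i" using eq by simp
      then have "x0 ! i \<otimes> hs ! i [^] n = x0 ! i \<otimes> hs' ! i [^] n"
        using i hs x0 by (simp add: tuples_def)
      then have "hs ! i [^] n = hs' ! i [^] n" using A A_carrier by simp
      then show "hs ! i = hs' ! i"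
        using coprime_power_inj[OF A_carrier[OF A(1)] A_carrier[OF A(2)] _ cop] exp A by blast
    qed
  qed
  have few: "card {n \<in> {1..T}. ?sol (?m n hs)} \<le> 2 ^ c" if hs: "hs \<in> ?X" for hs
  proof -
    define zs where "zs = (\<lambda>n. map2 (\<otimes>) gs (?m n hs))"
    have zs: "zs n \<in> tuples k (carrier G)" for n
      using mX[OF hs, of n] gs A_carrier by (auto simp: zs_def tuples_iff_nth)
    define u where "u = (\<lambda>n. gterm_val G (zs n) l \<otimes> inv (gterm_val G (zs n) r))"
    have cl: "gterm_val G (zs n) l \<in> carrier G" "gterm_val G (zs n) r \<in> carrier G" for n
      using gterm_val_closed[OF is_group zs] vars by (auto simp: \<phi>)
    have holds_iff: "?sol (?m n hs) \<longleftrightarrow> u n = \<one>" for n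
    proof -
      have "u n = \<one> \<longleftrightarrow> gterm_val G (zs n) l = gterm_val G (zs n) r"
        unfolding u_def using cl[of n] by (metis inv_solve_right' l_one one_closed)
      then show ?thesis by (simp add: \<phi> zs_def)
    qed
    have entry: "poly_upto m 0 (\<lambda>n. zs n ! i)" if "i < k" for i m
    proof -
      have "zs n ! i = gs ! i \<otimes> (x0 ! i \<otimes> hs ! i [^] n)" for n
        using that gs hs x0 by (simp add: zs_def tuples_def)
      moreover have "gs ! i \<in> filtration 0" "x0 ! i \<in> filtration 0" "hs ! i \<in> filtration 1"
        using that gs hs x0 A_carrier F_0 unfolding filtration_1 by (auto simp: tuples_iff_nth)
      ultimately show ?thesis
        by (auto intro!: poly_upto_group(1) poly_upto_const poly_upto_power)
    qed
    have "poly_upto (2 ^ c) 0 u"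
      unfolding u_def using vars
      by (intro poly_upto_group(1,2) poly_upto_gterm entry) (auto simp: \<phi>)
    moreover have "u 0 \<noteq> \<one>"
    proof -
      have "?m 0 hs = x0"
        using hs x0 A_carrier by (intro nth_equalityI) (auto simp: tuples_iff_nth)
      then show ?thesis using holds_iff[of 0] x0(2) by simp
    qed
    ultimately have "card {n \<in> {..T}. u n = \<one>} < 2 ^ c"
      using poly_seq_few_ones p exp by blast
    moreover have "card {n \<in> {1..T}. u n = \<one>} \<le> card {n \<in> {..T}. u n = \<one>}"
      by (rule card_mono) auto
    ultimately show ?thesis by (simp add: holds_iff)
  qed
  have "T * card {xs \<in> ?X. ?sol xs} = (\<Sum>n\<in>{1..T}. card {xs \<in> ?X. ?sol xs})" by simp
  also have "\<dots> = (\<Sum>n\<in>{1..T}. card {hs \<in> ?X. ?sol (?m n hs)})"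
  proof (rule sum.cong[OF refl])
    fix n assume n: "n \<in> {1..T}"
    show "card {xs \<in> ?X. ?sol xs} = card {hs \<in> ?X. ?sol (?m n hs)}"
    proof (rule card_filter_reindex[OF finX inj[OF n], of ?sol, symmetric])
      show "?m n ` ?X \<subseteq> ?X" using mX by (rule image_subsetI)
    qed
  qed
  also have "\<dots> = (\<Sum>hs\<in>?X. card {n \<in> {1..T}. ?sol (?m n hs)})"
    by (rule sum_card_filter_swap) (use finX in auto)
  also have "\<dots> \<le> (\<Sum>hs\<in>?X. 2 ^ c)" by (rule sum_mono) (use few in blast)
  also have "\<dots> = 2 ^ c * card ?X" by simp
  finally show ?thesis .
qed

text \<open>
  Average the preceding lemma over all \<open>gs\<close>; every tuple arises equally often as a product of \<open>gs\<close>
  with an element of \<open>A\<^sup>k\<close>.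
\<close>

lemma few_solutions:
  assumes fin: "finite (carrier G)" and vars: "equation_vars \<phi> \<subseteq> {..<k}"
    and p: "prime p" "2 ^ c \<le> T" "T < p" and exp: "\<And>x. x \<in> A \<Longrightarrow> x [^] (p ^ s :: nat) = \<one>"
    and nonsol: "\<And>gs. gs \<in> tuples k (carrier G) \<Longrightarrow>
      \<exists>xs\<in>tuples k A. \<not> holds G \<phi> (map2 (\<otimes>) gs xs)"
  shows "T * card {xs \<in> tuples k (carrier G). holds G \<phi> xs} \<le> 2 ^ c * card (carrier G) ^ k"
proof -
  let ?X = "tuples k A" and ?Y = "tuples k (carrier G)"
  have finA: "finite A" using finite_subset[OF subgroup.subset[OF subgroup_A] fin] .
  have finX: "finite ?X" and finY: "finite ?Y" using finite_tuples finA fin by blast+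
  have "replicate k \<one> \<in> ?X" using subgroup.one_closed[OF subgroup_A] by (simp add: tuples_iff_nth)
  then have X_pos: "card ?X > 0" using finX card_gt_0_iff by blast
  have "card ?X * card {ys \<in> ?Y. holds G \<phi> ys} = (\<Sum>xs\<in>?X. card {ys \<in> ?Y. holds G \<phi> ys})" by simp
  also have "\<dots> = (\<Sum>xs\<in>?X. card {gs \<in> ?Y. holds G \<phi> (map2 (\<otimes>) gs xs)})"
  proof (rule sum.cong[OF refl])
    fix xs assume xs: "xs \<in> ?X"
    have "inj_on (\<lambda>gs. map2 (\<otimes>) gs xs) ?Y"
    proof (rule inj_onI)
      fix gs gs' assume gs: "gs \<in> ?Y" "gs' \<in> ?Y" and eq: "map2 (\<otimes>) gs xs = map2 (\<otimes>) gs' xs"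
      show "gs = gs'"
      proof (rule nth_equalityI)
        show "length gs = length gs'" using gs by (simp add: tuples_def)
        fix i assume "i < length gs"
        then have i: "i < k" using gs by (simp add: tuples_def)
        have "map2 (\<otimes>) gs xs ! i = map2 (\<otimes>) gs' xs ! i" using eq by simp
        then have "gs ! i \<otimes> xs ! i = gs' ! i \<otimes> xs ! i"
          using i gs xs by (simp add: tuples_def)
        moreover have "gs ! i \<in> carrier G" "gs' ! i \<in> carrier G" "xs ! i \<in> carrier G"
          using i gs xs A_carrier by (auto simp: tuples_iff_nth)
        ultimately show "gs ! i = gs' ! i" by simp
      qed
    qed
    moreover have "(\<lambda>gs. map2 (\<otimes>) gs xs) ` ?Y \<subseteq> ?Y"
      using xs A_carrier by (auto simp: tuples_iff_nth)
    ultimately show "card {ys \<in> ?Y. holds G \<phi> ys} = card {gs \<in> ?Y. holds G \<phi> (map2 (\<otimes>) gs xs)}"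
      using card_filter_reindex[OF finY, of "\<lambda>gs. map2 (\<otimes>) gs xs" "holds G \<phi>"] by simp
  qed
  also have "\<dots> = (\<Sum>gs\<in>?Y. card {xs \<in> ?X. holds G \<phi> (map2 (\<otimes>) gs xs)})"
    by (rule sum_card_filter_swap[OF finX finY])
  finally have eq: "card ?X * card {ys \<in> ?Y. holds G \<phi> ys} =
      (\<Sum>gs\<in>?Y. card {xs \<in> ?X. holds G \<phi> (map2 (\<otimes>) gs xs)})" .
  have "T * (card ?X * card {ys \<in> ?Y. holds G \<phi> ys}) =
      (\<Sum>gs\<in>?Y. T * card {xs \<in> ?X. holds G \<phi> (map2 (\<otimes>) gs xs)})"
    unfolding eq by (rule sum_distrib_left)
  also have "\<dots> \<le> (\<Sum>gs\<in>?Y. 2 ^ c * card ?X)"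
  proof (rule sum_mono)
    fix gs assume gs: "gs \<in> ?Y"
    then obtain x0 where "x0 \<in> ?X" "\<not> holds G \<phi> (map2 (\<otimes>) gs x0)" using nonsol by blast
    then show "T * card {xs \<in> ?X. holds G \<phi> (map2 (\<otimes>) gs xs)} \<le> 2 ^ c * card ?X"
      using coset_few_solutions[OF fin vars p exp gs] by blast
  qed
  also have "\<dots> = card ?X * (2 ^ c * card ?Y)" by simp
  finally have "card ?X * (T * card {ys \<in> ?Y. holds G \<phi> ys}) \<le> card ?X * (2 ^ c * card ?Y)"
    by (simp only: mult.left_commute)
  then show ?thesis using X_pos card_tuples[OF fin, of k] by simp
qed

end

section \<open>Densities\<close>

lemma density_empty:
  assumes "density_on \<Omega> m" shows "m {} = 0"
proof -
  have "m ({} \<union> {}) = m {} + m {}" using assms unfolding density_on_def by (metis empty_subsetI inf_bot_left)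
  then show ?thesis by simp
qed

lemma density_split:
  assumes m: "density_on \<Omega> m" and P: "finite P" "partition_on \<Omega> P" and B: "B \<subseteq> \<Omega>"
  shows "m B = (\<Sum>A\<in>P. m (A \<inter> B))"
proof -
  have sub: "\<Union>Q \<subseteq> \<Omega>" and eq: "m (\<Union>Q \<inter> B) = (\<Sum>A\<in>Q. m (A \<inter> B))" if "Q \<subseteq> P" for Q
  proof -
    show "\<Union>Q \<subseteq> \<Omega>" using that P(2) by (auto simp: partition_on_def)
    have "finite Q" using that P(1) finite_subset by blast
    then show "m (\<Union>Q \<inter> B) = (\<Sum>A\<in>Q. m (A \<inter> B))" using that
    proof (induction Q)
      case (insert A Q)
      have "A \<inter> A' = {}" if "A' \<in> Q" for A'
      proof -
        have "A \<in> P" "A' \<in> P" "A \<noteq> A'" using that insert.prems insert.hyps(2) by auto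
        then show ?thesis using partition_onD2[OF P(2)] by (simp add: disjoint_def)
      qed
      then have "(A \<inter> B) \<inter> (\<Union>Q \<inter> B) = {}" by blast
      moreover have "A \<inter> B \<subseteq> \<Omega>" "\<Union>Q \<inter> B \<subseteq> \<Omega>" using B by auto
      ultimately have "m ((A \<inter> B) \<union> (\<Union>Q \<inter> B)) = m (A \<inter> B) + m (\<Union>Q \<inter> B)"
        using m unfolding density_on_def by blast
      moreover have "(A \<inter> B) \<union> (\<Union>Q \<inter> B) = \<Union>(insert A Q) \<inter> B" by blast
      ultimately show ?case using insert by simp
    qed (use density_empty[OF m] in simp)
  qed
  from eq[OF order_refl] show ?thesis using B P(2) by (auto simp: partition_on_def Int_absorb1)
qed

text \<open>
  The upper bound needs additivity of \<open>m\<close>: any other partition \<open>Q\<close> is compared with \<open>P\<close> on the common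
  refinement. The lower bound on \<open>f\<close> is needed there too, because an infimum of reals
  is meaningful only for sets that are bounded below.
\<close>

lemma density_integral_bounds:
  assumes m: "density_on \<Omega> m" and P: "finite P" "partition_on \<Omega> P"
    and bounds: "\<And>A x. A \<in> P \<Longrightarrow> x \<in> A \<Longrightarrow> u A \<le> f x \<and> f x \<le> v A"
  shows "(\<Sum>A\<in>P. u A * m A) \<le> density_integral \<Omega> m f"
    and "density_integral \<Omega> m f \<le> (\<Sum>A\<in>P. v A * m A)"
proof -
  have nonneg: "0 \<le> m B" if "B \<subseteq> \<Omega>" for B using m that unfolding density_on_def by blast
  have bdd: "bdd_below (f ` B)" if B: "B \<subseteq> \<Omega>" for B
  proof (rule bdd_belowI2[of _ "Min (u ` P)"])
    fix x assume "x \<in> B"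
    then obtain A where A: "A \<in> P" "x \<in> A" using subsetD[OF B] partition_onD1[OF P(2)] by blast
    then have "Min (u ` P) \<le> u A" using P(1) by simp
    then show "Min (u ` P) \<le> f x" using bounds[OF A] by linarith
  qed
  have upper: "(\<Sum>B\<in>Q. (INF x\<in>B. f x) * m B) \<le> (\<Sum>A\<in>P. v A * m A)"
    if Q: "finite Q" "partition_on \<Omega> Q" for Q
  proof -
    have Q\<Omega>: "B \<subseteq> \<Omega>" if "B \<in> Q" for B using that Q(2) by (auto simp: partition_on_def)
    have P\<Omega>: "A \<subseteq> \<Omega>" if "A \<in> P" for A using that P(2) by (auto simp: partition_on_def)
    have "(\<Sum>B\<in>Q. (INF x\<in>B. f x) * m B) = (\<Sum>B\<in>Q. \<Sum>A\<in>P. (INF x\<in>B. f x) * m (A \<inter> B))"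
      by (rule sum.cong[OF refl]) (simp add: density_split[OF m P Q\<Omega>] sum_distrib_left)
    also have "\<dots> \<le> (\<Sum>B\<in>Q. \<Sum>A\<in>P. v A * m (A \<inter> B))"
    proof (intro sum_mono)
      fix A B assume AB: "B \<in> Q" "A \<in> P"
      show "(INF x\<in>B. f x) * m (A \<inter> B) \<le> v A * m (A \<inter> B)"
      proof (cases "A \<inter> B = {}")
        case True
        then show ?thesis by (simp add: density_empty[OF m])
      next
        case False
        then obtain x where x: "x \<in> A" "x \<in> B" by blast
        have "(INF x\<in>B. f x) \<le> f x" using x(2) bdd[OF Q\<Omega>[OF AB(1)]] by (rule cINF_lower[rotated])
        also have "\<dots> \<le> v A" using bounds AB x by blast
        finally show ?thesis using nonneg[of "A \<inter> B"] P\<Omega>[OF AB(2)] by (intro mult_right_mono) auto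
      qed
    qed
    also have "\<dots> = (\<Sum>A\<in>P. \<Sum>B\<in>Q. v A * m (B \<inter> A))"
      by (subst sum.swap) (simp add: Int_commute)
    also have "\<dots> = (\<Sum>A\<in>P. v A * m A)"
      by (rule sum.cong[OF refl]) (simp add: density_split[OF m Q P\<Omega>] sum_distrib_left)
    finally show ?thesis .
  qed
  show "density_integral \<Omega> m f \<le> (\<Sum>A\<in>P. v A * m A)"
    unfolding density_integral_def by (rule cSUP_least) (use P upper in auto)
  have "(\<Sum>A\<in>P. u A * m A) \<le> (\<Sum>A\<in>P. (INF x\<in>A. f x) * m A)"
  proof (rule sum_mono)
    fix A assume A: "A \<in> P"
    have "A \<noteq> {}" "A \<subseteq> \<Omega>" using A P(2) by (auto simp: partition_on_def)
    moreover from this have "u A \<le> (INF x\<in>A. f x)" using bounds[OF A] by (intro cINF_greatest) auto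
    ultimately show "u A * m A \<le> (INF x\<in>A. f x) * m A" using nonneg by (intro mult_right_mono)
  qed
  also have "\<dots> \<le> density_integral \<Omega> m f"
    unfolding density_integral_def
    by (rule cSUP_upper) (use P upper in \<open>auto intro!: bdd_aboveI2\<close>)
  finally show "(\<Sum>A\<in>P. u A * m A) \<le> density_integral \<Omega> m f" .
qed

lemma tuples_Suc: "tuples (Suc k) P = (\<lambda>(cs, c). cs @ [c]) ` (tuples k P \<times> P)"
proof
  show "tuples (Suc k) P \<subseteq> (\<lambda>(cs, c). cs @ [c]) ` (tuples k P \<times> P)"
  proof
    fix xs assume xs: "xs \<in> tuples (Suc k) P"
    then obtain cs c where "xs = cs @ [c]" by (cases xs rule: rev_cases) (auto simp: tuples_def)
    then show "xs \<in> (\<lambda>(cs, c). cs @ [c]) ` (tuples k P \<times> P)" using xs by (auto simp: tuples_def)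
  qed
qed (auto simp: tuples_def)

lemma sum_tuples_Suc:
  "(\<Sum>cs\<in>tuples (Suc k) P. g cs) = (\<Sum>c\<in>P. \<Sum>cs\<in>tuples k P. g (cs @ [c]))"
proof -
  have "inj_on (\<lambda>(cs, c). cs @ [c]) (tuples k P \<times> P)" by (auto simp: inj_on_def)
  then have "(\<Sum>cs\<in>tuples (Suc k) P. g cs) = (\<Sum>(cs, c)\<in>tuples k P \<times> P. g (cs @ [c]))"
    unfolding tuples_Suc by (simp add: sum.reindex case_prod_unfold)
  also have "\<dots> = (\<Sum>cs\<in>tuples k P. \<Sum>c\<in>P. g (cs @ [c]))" by (rule sum.cartesian_product[symmetric])
  also have "\<dots> = (\<Sum>c\<in>P. \<Sum>cs\<in>tuples k P. g (cs @ [c]))" by (rule sum.swap)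
  finally show ?thesis .
qed

text \<open>
  A tuple \<open>cs\<close> of cells describes a box, and \<open>prod_list (map m cs)\<close> is its product density. Upper and
  lower bounds are proved together, because the inner integral has to be bounded on both sides.
\<close>

lemma iterated_integral_bounds:
  assumes m: "density_on \<Omega> m" and P: "finite P" "partition_on \<Omega> P"
    and bounds: "\<And>cs xs. cs \<in> tuples k P \<Longrightarrow> list_all2 (\<in>) xs cs \<Longrightarrow> u cs \<le> f xs \<and> f xs \<le> v cs"
  shows "(\<Sum>cs\<in>tuples k P. u cs * prod_list (map m cs)) \<le> iterated_integral \<Omega> m k f \<and>
    iterated_integral \<Omega> m k f \<le> (\<Sum>cs\<in>tuples k P. v cs * prod_list (map m cs))"
  using bounds
proof (induction k arbitrary: f u v)
  case 0
  have "tuples 0 P = {[]}" by (auto simp: tuples_def)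
  then show ?case using 0 by simp
next
  case (Suc k)
  define U where "U c = (\<Sum>cs\<in>tuples k P. u (cs @ [c]) * prod_list (map m cs))" for c
  define V where "V c = (\<Sum>cs\<in>tuples k P. v (cs @ [c]) * prod_list (map m cs))" for c
  have inner: "U c \<le> iterated_integral \<Omega> m k (\<lambda>xs. f (xs @ [x])) \<and>
      iterated_integral \<Omega> m k (\<lambda>xs. f (xs @ [x])) \<le> V c"
    if c: "c \<in> P" "x \<in> c" for c x
    unfolding U_def V_def
  proof (rule Suc.IH)
    fix cs xs assume "cs \<in> tuples k P" "list_all2 (\<in>) xs cs"
    then show "u (cs @ [c]) \<le> f (xs @ [x]) \<and> f (xs @ [x]) \<le> v (cs @ [c])"
      using c by (intro Suc.prems) (auto simp: tuples_Suc list_all2_appendI)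
  qed
  have eq: "(\<Sum>cs\<in>tuples (Suc k) P. w cs * prod_list (map m cs)) =
      (\<Sum>c\<in>P. (\<Sum>cs\<in>tuples k P. w (cs @ [c]) * prod_list (map m cs)) * m c)" for w
    unfolding sum_tuples_Suc by (simp add: sum_distrib_right mult.assoc)
  show ?case
    unfolding eq iterated_integral.simps U_def[symmetric] V_def[symmetric]
    using inner by (intro conjI density_integral_bounds[OF m P, where u = U and v = V]; blast)
qed

lemma product_density_upper:
  assumes m: "density_on \<Omega> m" and P: "finite P" "partition_on \<Omega> P"
  shows "product_density \<Omega> m k B \<le>
    (\<Sum>cs\<in>{cs \<in> tuples k P. \<exists>xs\<in>B. list_all2 (\<in>) xs cs}. prod_list (map m cs))"
proof -
  have fin: "finite (tuples k P)" using finite_tuples P(1) by blast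
  have "product_density \<Omega> m k B \<le>
    (\<Sum>cs\<in>tuples k P. (if \<exists>xs\<in>B. list_all2 (\<in>) xs cs then 1 else 0) * prod_list (map m cs))"
    unfolding product_density_def
    by (rule iterated_integral_bounds[OF m P, of k "\<lambda>_. 0", THEN conjunct2]) (auto simp: indicator_def)
  also have "\<dots> = (\<Sum>cs\<in>tuples k P. if \<exists>xs\<in>B. list_all2 (\<in>) xs cs then prod_list (map m cs) else 0)"
    by (rule sum.cong) auto
  also have "\<dots> = (\<Sum>cs\<in>{cs \<in> tuples k P. \<exists>xs\<in>B. list_all2 (\<in>) xs cs}. prod_list (map m cs))"
    using fin by (simp add: sum.inter_filter)
  finally show ?thesis .
qed

lemma product_density_lower:
  assumes m: "density_on \<Omega> m" and P: "finite P" "partition_on \<Omega> P"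
    and L: "L \<in> P" "tuples k L \<subseteq> B"
  shows "m L ^ k \<le> product_density \<Omega> m k B"
proof -
  have fin: "finite (tuples k P)" using finite_tuples P(1) by blast
  let ?L = "replicate k L"
  have mem: "?L \<in> tuples k P" using L(1) by (auto simp: tuples_def)
  have "m L ^ k = prod_list (map m ?L)" by (simp add: prod_list_replicate)
  also have "\<dots> = (\<Sum>cs\<in>tuples k P. if cs = ?L then prod_list (map m cs) else 0)"
    using fin mem by simp
  also have "\<dots> = (\<Sum>cs\<in>tuples k P. (if cs = ?L then 1 else 0) * prod_list (map m cs))"
    by (rule sum.cong) auto
  also have "\<dots> \<le> product_density \<Omega> m k B"
    unfolding product_density_def
  proof (rule iterated_integral_bounds[OF m P, where v = "\<lambda>_. 1", THEN conjunct1])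
    fix cs xs assume "cs \<in> tuples k P" "list_all2 (\<in>) xs cs"
    then have "cs = ?L \<Longrightarrow> xs \<in> B"
      using L(2) by (auto simp: tuples_def list_all2_conv_all_nth in_set_conv_nth subset_iff)
    then show "(if cs = ?L then 1 else 0) \<le> (indicator B xs :: real) \<and> (indicator B xs :: real) \<le> 1"
      by (auto simp: indicator_def)
  qed
  finally show ?thesis .
qed

context group begin

lemma lcosets_partition:
  assumes "subgroup H G"
  shows "partition_on (carrier G) (lcosets H)"
  unfolding partition_on_def
proof (intro conjI)
  show "\<Union>(lcosets H) = carrier G" by (rule lcosets_part_G[OF assms])
  show "disjoint (lcosets H)" using lcos_disjoint[OF assms] by (auto simp: disjoint_def)
  show "{} \<notin> lcosets H" using lcos_self[OF _ assms] by (force simp: lcosets_eq_image)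
qed

lemma measures_index_tendsto:
  assumes "measures_index_uniformly G \<mu>" "subgroup H G" "C \<in> lcosets H"
  shows "(\<lambda>n. \<mu> n C) \<longlonglongrightarrow> inverse_index G H"
proof -
  obtain g where g: "g \<in> carrier G" "C = g <# H" using assms(3) by (auto simp: lcosets_eq_image)
  have "(g, H) \<in> carrier G \<times> {H. subgroup H G}" using g assms by simp
  from tendsto_uniform_limitI[OF assms(1)[unfolded measures_index_uniformly_def] this]
  show ?thesis using g by simp
qed

lemma virtual_law_positive:
  assumes dens: "\<And>n. density_on (carrier G) (\<mu> n)" and unif: "measures_index_uniformly G \<mu>"
    and law: "virtual_law G k \<phi>"
  shows "degree_of_satisfiability G \<mu> k \<phi> > 0"
proof -
  obtain L where L: "subgroup L G" "finite_index G L" "\<forall>xs\<in>tuples k L. holds G \<phi> xs"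
    using law by (auto simp: virtual_law_def)
  have fin: "finite (lcosets L)" using L(2) by (simp add: finite_index_def)
  have memb: "L \<in> lcosets L"
    using lcos_mult_one[OF subgroup.subset[OF L(1)]] by (auto simp: lcosets_eq_image intro!: image_eqI[of _ _ \<one>])
  have pos: "inverse_index G L > 0"
    using L(2) fin memb by (auto simp: inverse_index_def card_gt_0_iff)
  let ?d = "\<lambda>n. product_density (carrier G) (\<mu> n) k {xs \<in> tuples k (carrier G). holds G \<phi> xs}"
  have lower: "\<mu> n L ^ k \<le> ?d n" for n
    by (rule product_density_lower[OF dens fin lcosets_partition[OF L(1)] memb])
      (use L(3) subgroup.subset[OF L(1)] in \<open>auto simp: tuples_def\<close>)
  have "(\<lambda>n. \<mu> n L ^ k) \<longlonglongrightarrow> inverse_index G L ^ k"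
    by (intro tendsto_power measures_index_tendsto[OF unif L(1) memb])
  then have "(\<lambda>n. ereal (\<mu> n L ^ k)) \<longlonglongrightarrow> ereal (inverse_index G L ^ k)"
    by simp
  then have lim: "limsup (\<lambda>n. ereal (\<mu> n L ^ k)) = ereal (inverse_index G L ^ k)"
    by (intro lim_imp_Limsup) auto
  have "0 < ereal (inverse_index G L ^ k)" using pos by simp
  also have "\<dots> = limsup (\<lambda>n. ereal (\<mu> n L ^ k))" by (rule lim[symmetric])
  also have "\<dots> \<le> limsup (\<lambda>n. ereal (?d n))"
    by (rule Limsup_mono) (use lower in auto)
  finally show ?thesis unfolding degree_of_satisfiability_def .
qed

lemma gterm_val_FactGroup:
  assumes M: "M \<lhd> G" and xs: "xs \<in> tuples k (carrier G)" and vars: "gterm_vars t \<subseteq> {..<k}"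
  shows "gterm_val (G Mod M) (map (\<lambda>x. M #> x) xs) t = M #> gterm_val G xs t"
proof -
  interpret M: normal M G by fact
  interpret Q: group "G Mod M" by (rule M.factorgroup_is_group)
  interpret h: group_hom G "G Mod M" "\<lambda>x. M #> x"
    by unfold_locales (rule M.r_coset_hom_Mod)
  show ?thesis using vars
  proof (induction t)
    case (Var i)
    then show ?case using xs by (simp add: tuples_def)
  next
    case One
    then show ?case using h.hom_one by simp
  next
    case (Inv t)
    then show ?case using gterm_val_closed[OF is_group xs] h.hom_inv by simp
  next
    case (Mul s t)
    then show ?case using gterm_val_closed[OF is_group xs] h.hom_mult by simp
  qed
qed

text \<open>
  A solution in \<open>G\<close> gives a solution in \<open>G/M\<close>, so the solutions are covered by the boxes of cosets of
  \<open>M\<close> that are solutions in \<open>G/M\<close>, and the density of each box tends to \<open>[G:M]\<^sup>-\<^sup>k\<close>.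
\<close>

lemma degree_le_finite_quotient:
  assumes dens: "\<And>n. density_on (carrier G) (\<mu> n)" and unif: "measures_index_uniformly G \<mu>"
    and vars: "equation_vars \<phi> \<subseteq> {..<k}" and M: "M \<lhd> G" "finite_index G M"
  shows "degree_of_satisfiability G \<mu> k \<phi> \<le>
    ereal (card {ys \<in> tuples k (carrier (G Mod M)). holds (G Mod M) \<phi> ys} / card (carrier (G Mod M)) ^ k)"
proof -
  note M_sub = normal_imp_subgroup[OF M(1)]
  let ?P = "lcosets M"
  let ?B = "{xs \<in> tuples k (carrier G). holds G \<phi> xs}"
  let ?S = "{cs \<in> tuples k ?P. \<exists>xs\<in>?B. list_all2 (\<in>) xs cs}"
  have P_eq: "carrier (G Mod M) = ?P"
    unfolding carrier_FactGroup lcosets_eq_image using M(1) by (auto simp: normal.coset_eq)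
  have fin: "finite ?P" using M(2) by (simp add: finite_index_def)
  have finS: "finite (tuples k ?P)" using finite_tuples fin by blast
  have "?S \<subseteq> {ys \<in> tuples k (carrier (G Mod M)). holds (G Mod M) \<phi> ys}"
  proof
    fix cs assume "cs \<in> ?S"
    then obtain xs where cs: "cs \<in> tuples k ?P" and xs: "xs \<in> tuples k (carrier G)" "holds G \<phi> xs"
      "list_all2 (\<in>) xs cs" by blast
    have "cs = map (\<lambda>x. M #> x) xs"
    proof (rule nth_equalityI)
      show "length cs = length (map (\<lambda>x. M #> x) xs)" using xs(3) by (simp add: list_all2_lengthD)
      fix i assume i: "i < length cs"
      have "cs ! i \<in> ?P" "xs ! i \<in> cs ! i" "xs ! i \<in> carrier G"
        using i cs xs by (auto simp: tuples_def list_all2_conv_all_nth)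
      then obtain g where g: "g \<in> carrier G" "cs ! i = g <# M" "xs ! i \<in> g <# M"
        by (auto simp: lcosets_eq_image)
      then have "cs ! i = xs ! i <# M" using l_repr_independence[OF g(3) g(1) M_sub] by simp
      then show "cs ! i = map (\<lambda>x. M #> x) xs ! i"
        using normal.coset_eq[OF M(1)] \<open>xs ! i \<in> carrier G\<close> i xs(3) by (simp add: list_all2_lengthD)
    qed
    moreover have "holds (G Mod M) \<phi> (map (\<lambda>x. M #> x) xs)"
      using xs(2) vars gterm_val_FactGroup[OF M(1) xs(1)] by (cases \<phi>) auto
    ultimately show "cs \<in> {ys \<in> tuples k (carrier (G Mod M)). holds (G Mod M) \<phi> ys}"
      using cs P_eq by simp
  qed
  then have card: "card ?S \<le> card {ys \<in> tuples k (carrier (G Mod M)). holds (G Mod M) \<phi> ys}"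
    using finS P_eq by (intro card_mono) auto
  have lim: "(\<lambda>n. \<Sum>cs\<in>?S. prod_list (map (\<mu> n) cs)) \<longlonglongrightarrow> (\<Sum>cs\<in>?S. inverse_index G M ^ k)"
  proof (rule tendsto_sum)
    fix cs assume "cs \<in> ?S"
    then have cs: "length cs = k" "set cs \<subseteq> ?P" by (auto simp: tuples_def)
    have "(\<lambda>n. prod_list (map (\<mu> n) cs)) \<longlonglongrightarrow> inverse_index G M ^ length cs"
      using cs(2)
    proof (induction cs)
      case (Cons C cs)
      then show ?case using measures_index_tendsto[OF unif M_sub] by (auto intro!: tendsto_mult)
    qed simp
    then show "(\<lambda>n. prod_list (map (\<mu> n) cs)) \<longlonglongrightarrow> inverse_index G M ^ k" using cs by simp
  qed
  have "degree_of_satisfiability G \<mu> k \<phi> \<le> limsup (\<lambda>n. ereal (\<Sum>cs\<in>?S. prod_list (map (\<mu> n) cs)))"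
    unfolding degree_of_satisfiability_def
    by (intro Limsup_mono always_eventually allI)
      (simp only: ereal_less_eq, rule product_density_upper[OF dens fin lcosets_partition[OF M_sub]])
  also have "\<dots> = ereal (\<Sum>cs\<in>?S. inverse_index G M ^ k)"
    using lim by (intro lim_imp_Limsup) (auto simp del: sum_constant)
  also have "\<dots> = ereal (card ?S / card (carrier (G Mod M)) ^ k)"
    using M(2) P_eq by (simp add: inverse_index_def power_divide)
  also have "\<dots> \<le> ereal (card {ys \<in> tuples k (carrier (G Mod M)). holds (G Mod M) \<phi> ys} /
      card (carrier (G Mod M)) ^ k)"
    using card by (simp add: divide_right_mono)
  finally show ?thesis .
qed

end

section \<open>Equations on cosets\<close>

context group begin

text \<open>
  Nilpotency and the absence of torsion pass to subgroups, so one may take the normal core in \<open>G\<close> of a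
  torsion-free subgroup of finite index in a nilpotent subgroup of finite index.
\<close>

lemma torsion_free_nilpotent_normal_subgroup:
  assumes fg: "finitely_generated_group G" and vn: "virtually_nilpotent_group G"
  obtains N c where "N \<lhd> G" "finite_index G N" "finitely_generated_group (G\<lparr>carrier := N\<rparr>)"
    "group.upper_central (G\<lparr>carrier := N\<rparr>) c = N"
    "\<And>x m. x \<in> N \<Longrightarrow> m > 0 \<Longrightarrow> x [^] (m::nat) = \<one> \<Longrightarrow> x = \<one>"
proof -
  obtain H where H: "subgroup H G" "finite_index G H" "nilpotent_group (G\<lparr>carrier := H\<rparr>)"
    using vn by (auto simp: virtually_nilpotent_group_def)
  interpret H: group "G\<lparr>carrier := H\<rparr>" using H(1) subgroup_imp_group by blast
  have fgH: "finitely_generated_group (G\<lparr>carrier := H\<rparr>)"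
    by (rule finitely_generated_group_finite_index[OF fg H(1,2)])
  obtain c where c: "H.upper_central c = H" using H.nilpotent_upper_central[OF H(3)] by auto
  obtain V where V: "subgroup V (G\<lparr>carrier := H\<rparr>)" "finite_index (G\<lparr>carrier := H\<rparr>) V"
    "\<And>x m. x \<in> V \<Longrightarrow> m > 0 \<Longrightarrow> x [^]\<^bsub>G\<lparr>carrier := H\<rparr>\<^esub> (m::nat) = \<one>\<^bsub>G\<lparr>carrier := H\<rparr>\<^esub> \<Longrightarrow> x = \<one>\<^bsub>G\<lparr>carrier := H\<rparr>\<^esub>"
    using H.nilpotent_virtually_torsion_free[OF fgH H(3)] by metis
  have VG: "subgroup V G" using incl_subgroup[OF H(1) V(1)] .
  obtain N where N: "N \<lhd> G" "N \<subseteq> V" "finite_index G N"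
    by (rule finite_index_normal_core[OF VG finite_index_trans[OF H(1) V(1) H(2) V(2)]])
  note N_sub = normal_imp_subgroup[OF N(1)]
  have NH: "N \<subseteq> H" using N(2) subgroup.subset[OF V(1)] by simp
  have "subgroup N (G\<lparr>carrier := H\<rparr>)" using subgroup_incl[OF N_sub H(1) NH] .
  from H.upper_central_full_subgroup[OF this, of c] c NH
  have "group.upper_central (G\<lparr>carrier := N\<rparr>) c = N" by simp
  moreover have "x = \<one>" if "x \<in> N" "m > 0" "x [^] (m::nat) = \<one>" for x m
    using V(3)[of x m] that N(2) by (auto simp flip: nat_pow_consistent)
  ultimately show ?thesis
    using that N finitely_generated_group_finite_index[OF fg N_sub N(3)] by blast
qed

lemma power_subgroup_of_normal_normal:
  assumes N: "N \<lhd> G"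
  shows "group.power_subgroup (G\<lparr>carrier := N\<rparr>) m \<lhd> G"
proof -
  note N_sub = normal_imp_subgroup[OF N]
  interpret N: group "G\<lparr>carrier := N\<rparr>" using N_sub subgroup_imp_group by blast
  let ?S = "(\<lambda>x. x [^] m) ` N"
  have NG: "x \<in> carrier G" if "x \<in> N" for x using that subgroup.subset[OF N_sub] by blast
  have pow: "x [^]\<^bsub>G\<lparr>carrier := N\<rparr>\<^esub> m = x [^] m" for x by (simp flip: nat_pow_consistent)
  have "?S \<subseteq> N"
    using N.nat_pow_closed[of _ m] by (auto simp: pow)
  then have "N.power_subgroup m = generate G ?S"
    unfolding N.power_subgroup_def using generate_consistent[OF _ N_sub] by (simp add: pow)
  moreover have "generate G ?S \<lhd> G"
    by (rule normal_generateI) (auto simp: pow_conj NG normal_conj_closed[OF N])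
  ultimately show ?thesis by simp
qed

lemma FactGroup_subgroup:
  "(G\<lparr>carrier := N\<rparr>) Mod M = (G Mod M)\<lparr>carrier := (\<lambda>x. M #> x) ` N\<rparr>"
  by (auto simp: FactGroup_def RCOSETS_def fun_eq_iff)

text \<open>
  A choice of one non-solution for each of the finitely many products of cosets of \<open>N\<close> gives finitely
  many elements \<open>e rs \<noteq> \<one>\<close>, the quotients of the two sides of the equation. All of them have to stay
  outside of \<open>M\<close>. Those outside of \<open>N\<close> do so anyway; the others are avoided by the subgroup generated
  by \<open>p\<^sup>n\<close>-th powers for a large \<open>n\<close>.
\<close>

lemma quotient_with_few_solutions:
  assumes N: "N \<lhd> G" "finite_index G N" and fg: "finitely_generated_group (G\<lparr>carrier := N\<rparr>)"
    and nil: "group.upper_central (G\<lparr>carrier := N\<rparr>) c = N"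
    and tf: "\<And>x m. x \<in> N \<Longrightarrow> m > 0 \<Longrightarrow> x [^] (m::nat) = \<one> \<Longrightarrow> x = \<one>"
    and vars: "equation_vars \<phi> \<subseteq> {..<k}"
    and nonsol: "\<And>gs. gs \<in> tuples k (carrier G) \<Longrightarrow>
      \<exists>xs\<in>tuples k N. \<not> holds G \<phi> (map2 (\<otimes>) gs xs)"
    and T: "2 ^ c \<le> T"
  obtains M where "M \<lhd> G" "finite_index G M"
    "T * card {ys \<in> tuples k (carrier (G Mod M)). holds (G Mod M) \<phi> ys}
      \<le> 2 ^ c * card (carrier (G Mod M)) ^ k"
proof -
  obtain l r where \<phi>: "\<phi> = Eq l r" by (cases \<phi>)
  note N_sub = normal_imp_subgroup[OF N(1)]
  interpret N: group "G\<lparr>carrier := N\<rparr>" using N_sub subgroup_imp_group by blast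
  have NG: "x \<in> carrier G" if "x \<in> N" for x using that subgroup.subset[OF N_sub] by blast
  have pow: "x [^]\<^bsub>G\<lparr>carrier := N\<rparr>\<^esub> (m::nat) = x [^] m" for x m by (simp flip: nat_pow_consistent)
  obtain p where p: "prime p" "T < p" using bigger_prime by blast
  obtain R where R: "finite R" "R \<subseteq> carrier G" "\<And>x. x \<in> carrier G \<Longrightarrow> \<exists>r\<in>R. inv r \<otimes> x \<in> N"
    using finite_index_representatives[OF N_sub N(2)] by blast
  have "\<forall>rs\<in>tuples k R. \<exists>xs\<in>tuples k N. \<not> holds G \<phi> (map2 (\<otimes>) rs xs)"
    using nonsol R(2) by (auto simp: tuples_def)
  then obtain X where X: "\<And>rs. rs \<in> tuples k R \<Longrightarrow> X rs \<in> tuples k N \<and> \<not> holds G \<phi> (map2 (\<otimes>) rs (X rs))"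
    by metis
  define e where "e rs = gterm_val G (map2 (\<otimes>) rs (X rs)) l \<otimes> inv (gterm_val G (map2 (\<otimes>) rs (X rs)) r)" for rs
  have prod_in: "map2 (\<otimes>) rs (X rs) \<in> tuples k (carrier G)" if "rs \<in> tuples k R" for rs
    using that X[OF that] R(2) NG by (auto simp: tuples_iff_nth)
  have vals: "gterm_val G (map2 (\<otimes>) rs (X rs)) l \<in> carrier G"
    "gterm_val G (map2 (\<otimes>) rs (X rs)) r \<in> carrier G" if "rs \<in> tuples k R" for rs
    using gterm_val_closed[OF is_group prod_in[OF that]] vars by (auto simp: \<phi>)
  have e: "e rs \<in> carrier G" "e rs \<noteq> \<one>" if rs: "rs \<in> tuples k R" for rs
  proof -
    show "e rs \<in> carrier G" using vals[OF rs] by (simp add: e_def)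
    show "e rs \<noteq> \<one>"
    proof
      assume "e rs = \<one>"
      then have "gterm_val G (map2 (\<otimes>) rs (X rs)) l = gterm_val G (map2 (\<otimes>) rs (X rs)) r"
        using vals[OF rs] unfolding e_def by (metis inv_solve_right' l_one one_closed)
      then show False using X[OF rs] by (simp add: \<phi>)
    qed
  qed
  have "\<exists>s. x \<notin> N.power_subgroup (p ^ s)" if x: "x \<noteq> \<one>" for x
  proof (cases "x \<in> N")
    case True
    have "\<exists>s. x \<notin> N.power_subgroup (p ^ s)"
      by (rule N.torsion_free_residually_p[OF fg _ _ p(1), of c x]) (use nil tf True x pow in auto)
    then show ?thesis .
  next
    case False
    then show ?thesis
      using subgroup.subset[OF normal_imp_subgroup[OF N.power_subgroup_normal]] by auto
  qed
  then obtain s where s: "\<And>x. x \<noteq> \<one> \<Longrightarrow> x \<notin> N.power_subgroup (p ^ s x)" by metis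
  define n where "n = (\<Sum>rs\<in>tuples k R. s (e rs))"
  define M where "M = N.power_subgroup (p ^ n)"
  have M: "M \<lhd> G" unfolding M_def by (rule power_subgroup_of_normal_normal[OF N(1)])
  have M_N: "M \<lhd> G\<lparr>carrier := N\<rparr>" unfolding M_def by (rule N.power_subgroup_normal)
  have finM: "finite_index G M"
  proof (rule finite_index_trans[OF N_sub normal_imp_subgroup[OF M_N] N(2)])
    show "finite_index (G\<lparr>carrier := N\<rparr>) M"
      unfolding M_def by (rule N.power_subgroup_finite_index[OF fg, of c]) (use nil p prime_gt_0_nat in auto)
  qed
  have eM: "e rs \<notin> M" if rs: "rs \<in> tuples k R" for rs
  proof -
    have "s (e rs) \<le> n"
      unfolding n_def using finite_tuples[OF R(1)] rs by (intro member_le_sum) auto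
    then have "M \<subseteq> N.power_subgroup (p ^ s (e rs))"
      unfolding M_def by (intro N.power_subgroup_mono le_imp_power_dvd)
    then show ?thesis using s[OF e(2)[OF rs]] by blast
  qed
  interpret M: normal M G by (rule M)
  interpret Q: group "G Mod M" by (rule M.factorgroup_is_group)
  interpret h: group_hom G "G Mod M" "\<lambda>x. M #> x"
    by unfold_locales (rule M.r_coset_hom_Mod)
  let ?A = "(\<lambda>x. M #> x) ` N"
  have "?A \<lhd> G Mod M"
    by (rule normal.surj_hom_normal_subgroup[OF N(1) h.group_hom_axioms]) (simp add: carrier_FactGroup)
  moreover have "group.upper_central ((G Mod M)\<lparr>carrier := ?A\<rparr>) c = ?A"
    using N.upper_central_full_FactGroup[OF M_N, of c] nil unfolding FactGroup_subgroup by simp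
  ultimately interpret Q: nilpotent_normal "G Mod M" ?A c
    by (intro nilpotent_normal.intro nilpotent_normal_axioms.intro Q.is_group)
  have finQ: "finite (carrier (G Mod M))" using finM finite_index_iff_FactGroup[OF M] by simp
  have exp: "Y [^]\<^bsub>G Mod M\<^esub> (p ^ n) = \<one>\<^bsub>G Mod M\<^esub>" if "Y \<in> ?A" for Y
  proof -
    obtain y where y: "y \<in> N" "Y = M #> y" using \<open>Y \<in> ?A\<close> by blast
    have "y [^] (p ^ n) \<in> M"
      unfolding M_def using N.power_in_power_subgroup[of y "p ^ n"] y(1) by (simp add: pow)
    then show ?thesis
      using y NG h.hom_nat_pow[of y "p ^ n"] FactGroup_eq_one_iff[OF M, of "y [^] (p ^ n)"] by simp
  qed
  have nonsolQ: "\<exists>Xs\<in>tuples k ?A. \<not> holds (G Mod M) \<phi> (map2 (\<otimes>\<^bsub>G Mod M\<^esub>) Gs Xs)"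
    if Gs: "Gs \<in> tuples k (carrier (G Mod M))" for Gs
  proof -
    have "\<exists>g. g \<in> carrier G \<and> Gs ! i = M #> g" if "i < k" for i
      using Gs that by (auto simp: tuples_iff_nth carrier_FactGroup)
    then obtain g where g: "\<And>i. i < k \<Longrightarrow> g i \<in> carrier G \<and> Gs ! i = M #> g i" by metis
    then have "\<forall>i<k. \<exists>\<rho>\<in>R. inv \<rho> \<otimes> g i \<in> N" using R(3) by blast
    then obtain \<rho> where \<rho>: "\<And>i. i < k \<Longrightarrow> \<rho> i \<in> R \<and> inv (\<rho> i) \<otimes> g i \<in> N" by metis
    define rs where "rs = map \<rho> [0..<k]"
    have rs: "rs \<in> tuples k R" using \<rho> by (auto simp: rs_def tuples_iff_nth)
    \<comment> \<open>\<open>Xs\<close> is chosen such that \<open>g\<^sub>i\<close> times the \<open>i\<close>-th entry is the entry of the chosen non-solution.\<close>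
    define Xs where "Xs = map (\<lambda>i. M #> (inv (g i) \<otimes> \<rho> i \<otimes> X rs ! i)) [0..<k]"
    have rX: "X rs ! i \<in> N" "\<rho> i \<in> carrier G" "g i \<in> carrier G" if "i < k" for i
      using X[OF rs] \<rho>[OF that] g[OF that] R(2) that by (auto simp: tuples_iff_nth)
    have "inv (g i) \<otimes> \<rho> i \<otimes> X rs ! i \<in> N" if i: "i < k" for i
    proof -
      have "inv (inv (\<rho> i) \<otimes> g i) \<in> N" using \<rho>[OF i] subgroup.m_inv_closed[OF N_sub] by blast
      then have "inv (g i) \<otimes> \<rho> i \<in> N" using rX[OF i] by (simp add: inv_mult_group)
      then show ?thesis using rX[OF i] subgroup.m_closed[OF N_sub] by blast
    qed
    then have Xs: "Xs \<in> tuples k ?A" by (auto simp: Xs_def tuples_iff_nth)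
    have "map2 (\<otimes>\<^bsub>G Mod M\<^esub>) Gs Xs = map (\<lambda>x. M #> x) (map2 (\<otimes>) rs (X rs))"
    proof (rule nth_equalityI)
      show "length (map2 (\<otimes>\<^bsub>G Mod M\<^esub>) Gs Xs) = length (map (\<lambda>x. M #> x) (map2 (\<otimes>) rs (X rs)))"
        using Gs Xs rs X[OF rs] by (simp add: tuples_def)
      fix i assume "i < length (map2 (\<otimes>\<^bsub>G Mod M\<^esub>) Gs Xs)"
      then have i: "i < k" using Gs Xs by (simp add: tuples_def)
      have "map2 (\<otimes>\<^bsub>G Mod M\<^esub>) Gs Xs ! i = (M #> g i) \<otimes>\<^bsub>G Mod M\<^esub> (M #> (inv (g i) \<otimes> \<rho> i \<otimes> X rs ! i))"
        using i Gs Xs g[OF i] by (simp add: tuples_def Xs_def)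
      also have "\<dots> = M #> (g i \<otimes> (inv (g i) \<otimes> \<rho> i \<otimes> X rs ! i))"
        using rX[OF i] NG by (simp only: h.hom_mult m_closed inv_closed)
      also have "g i \<otimes> (inv (g i) \<otimes> \<rho> i \<otimes> X rs ! i) = \<rho> i \<otimes> X rs ! i"
        using rX[OF i] NG by (simp add: group_word_simps)
      also have "M #> (\<rho> i \<otimes> X rs ! i) = map (\<lambda>x. M #> x) (map2 (\<otimes>) rs (X rs)) ! i"
        using i rs X[OF rs] by (simp add: tuples_def rs_def)
      finally show "map2 (\<otimes>\<^bsub>G Mod M\<^esub>) Gs Xs ! i = map (\<lambda>x. M #> x) (map2 (\<otimes>) rs (X rs)) ! i" .
    qed
    moreover have "\<not> holds (G Mod M) \<phi> (map (\<lambda>x. M #> x) (map2 (\<otimes>) rs (X rs)))"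
    proof
      let ?a = "gterm_val G (map2 (\<otimes>) rs (X rs)) l" and ?b = "gterm_val G (map2 (\<otimes>) rs (X rs)) r"
      assume "holds (G Mod M) \<phi> (map (\<lambda>x. M #> x) (map2 (\<otimes>) rs (X rs)))"
      then have ab: "M #> ?a = M #> ?b"
        using gterm_val_FactGroup[OF M prod_in[OF rs]] vars by (simp add: \<phi>)
      have "?a \<in> M #> ?b" using rcos_self[OF vals(1)[OF rs] M.is_subgroup] ab by simp
      then have "?a \<otimes> inv ?b \<in> M"
        using M.rcos_module_imp[OF is_group vals(2)[OF rs]] by blast
      then show False using eM[OF rs] by (simp add: e_def)
    qed
    ultimately show ?thesis using Xs by (metis (lifting))
  qed
  show ?thesis
    by (rule that[OF M finM], rule Q.few_solutions[OF finQ vars p(1) T p(2) exp nonsolQ])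
qed

lemma gterm_val_subgroup:
  assumes N: "subgroup N G" and xs: "xs \<in> tuples k N" and vars: "gterm_vars t \<subseteq> {..<k}"
  shows "gterm_val (G\<lparr>carrier := N\<rparr>) xs t = gterm_val G xs t"
proof -
  have grp: "group (G\<lparr>carrier := N\<rparr>)" using subgroup_imp_group[OF N] .
  show ?thesis using vars
  proof (induction t)
    case (Inv t)
    then have "gterm_val (G\<lparr>carrier := N\<rparr>) xs t \<in> N"
      using gterm_val_closed[OF grp, of xs k t] xs by simp
    then show ?case using Inv m_inv_consistent[OF N] by simp
  qed auto
qed

lemma positive_degree_imp_law_on_cosets:
  assumes dens: "\<And>n. density_on (carrier G) (\<mu> n)" and unif: "measures_index_uniformly G \<mu>"
    and fg: "finitely_generated_group G" and vn: "virtually_nilpotent_group G"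
    and vars: "equation_vars \<phi> \<subseteq> {..<k}" and pos: "degree_of_satisfiability G \<mu> k \<phi> > 0"
  obtains N gs where "subgroup N G" "finite_index G N" "gs \<in> tuples k (carrier G)"
    "\<And>xs. xs \<in> tuples k N \<Longrightarrow> holds G \<phi> (map2 (\<otimes>) gs xs)"
proof -
  obtain N c where N: "N \<lhd> G" "finite_index G N" "finitely_generated_group (G\<lparr>carrier := N\<rparr>)"
    "group.upper_central (G\<lparr>carrier := N\<rparr>) c = N"
    "\<And>x m. x \<in> N \<Longrightarrow> m > 0 \<Longrightarrow> x [^] (m::nat) = \<one> \<Longrightarrow> x = \<one>"
    using torsion_free_nilpotent_normal_subgroup[OF fg vn] by blast
  note witness = that
  show ?thesis
  proof (rule ccontr)
    assume no_thesis: "\<not> thesis"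
    have nonsol: "\<exists>xs\<in>tuples k N. \<not> holds G \<phi> (map2 (\<otimes>) gs xs)" if gs: "gs \<in> tuples k (carrier G)" for gs
    proof (rule ccontr)
      assume "\<not> (\<exists>xs\<in>tuples k N. \<not> holds G \<phi> (map2 (\<otimes>) gs xs))"
      then have "\<And>xs. xs \<in> tuples k N \<Longrightarrow> holds G \<phi> (map2 (\<otimes>) gs xs)" by blast
      from witness[OF normal_imp_subgroup[OF N(1)] N(2) gs this] show False using no_thesis by blast
    qed
    obtain r where r: "0 < r" "ereal r < degree_of_satisfiability G \<mu> k \<phi>"
      using ereal_dense2[OF pos] by auto
    \<comment> \<open>The first summand makes \<open>2\<^sup>c / T \<le> r\<close>, the second one makes \<open>T\<close> exceed the number of zeros.\<close>
    define T where "T = nat \<lceil>2 ^ c / r\<rceil> + 2 ^ c"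
    have T: "2 ^ c \<le> T" "0 < T" "2 ^ c / r \<le> real T"
    proof -
      show "2 ^ c \<le> T" by (simp add: T_def)
      show "0 < T" by (simp add: T_def)
      have "2 ^ c / r \<le> real (nat \<lceil>2 ^ c / r\<rceil>)" by (rule real_nat_ceiling_ge)
      moreover have "real T = real (nat \<lceil>2 ^ c / r\<rceil>) + 2 ^ c" by (simp add: T_def)
      ultimately show "2 ^ c / r \<le> real T" using zero_le_power[of "2::real" c] by linarith
    qed
    obtain M where M: "M \<lhd> G" "finite_index G M"
      "T * card {ys \<in> tuples k (carrier (G Mod M)). holds (G Mod M) \<phi> ys}
        \<le> 2 ^ c * card (carrier (G Mod M)) ^ k"
      by (rule quotient_with_few_solutions[OF N vars nonsol T(1)])
    define sol where "sol = card {ys \<in> tuples k (carrier (G Mod M)). holds (G Mod M) \<phi> ys}"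
    define C where "C = card (carrier (G Mod M)) ^ k"
    have "finite (carrier (G Mod M))" using M(2) finite_index_iff_FactGroup[OF M(1)] by simp
    moreover have "carrier (G Mod M) \<noteq> {}" by (auto simp: carrier_FactGroup)
    ultimately have C: "0 < C" by (simp add: C_def card_gt_0_iff)
    have "real (T * sol) \<le> real (2 ^ c * C)" using M(3) unfolding sol_def C_def of_nat_le_iff .
    then have "real T * real sol \<le> 2 ^ c * real C" by simp
    also have "\<dots> \<le> (r * real T) * real C"
      using T(3) r(1) by (intro mult_right_mono) (simp_all add: field_simps)
    finally have "real sol / real C \<le> r" using T(2) C by (simp add: field_simps)
    moreover have "degree_of_satisfiability G \<mu> k \<phi> \<le> ereal (real sol / real C)"
      using degree_le_finite_quotient[OF dens unif vars M(1,2)] by (simp add: sol_def C_def)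
    ultimately have "degree_of_satisfiability G \<mu> k \<phi> \<le> ereal r"
      by (meson ereal_less_eq(3) order_trans)
    then show False using r(2) by simp
  qed
qed

end

theorem proposition2p19:
  fixes G :: "'a monoid" and \<mu> :: "nat \<Rightarrow> 'a set \<Rightarrow> real"
    and k :: nat and \<phi> :: equation
  assumes "equation_vars \<phi> \<subseteq> {..<k}"
    and "transfers TYPE('a) k \<phi>"
    and "group G"
    and "finitely_generated_group G"
    and "virtually_nilpotent_group G"
    and "\<And>n. density_on (carrier G) (\<mu> n)"
    and "measures_index_uniformly G \<mu>"
  shows "degree_of_satisfiability G \<mu> k \<phi> > 0 \<longleftrightarrow> virtual_law G k \<phi>"
proof
  interpret group G by fact
  assume pos: "degree_of_satisfiability G \<mu> k \<phi> > 0"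
  obtain N gs where N: "subgroup N G" "finite_index G N" and gs: "gs \<in> tuples k (carrier G)"
    and hold: "\<And>xs. xs \<in> tuples k N \<Longrightarrow> holds G \<phi> (map2 (\<otimes>\<^bsub>G\<^esub>) gs xs)"
    using positive_degree_imp_law_on_cosets[OF assms(6,7,4,5,1) pos] by metis
  have "holds G \<phi> xs" if xs: "list_all2 (\<lambda>x g. x \<in> g <#\<^bsub>G\<^esub> N) xs gs" for xs
  proof -
    have len: "length xs = k" "length gs = k" using xs gs by (auto simp: tuples_def list_all2_lengthD)
    have "\<forall>i<k. \<exists>y\<in>N. xs ! i = gs ! i \<otimes>\<^bsub>G\<^esub> y"
      using xs len by (auto simp: list_all2_conv_all_nth l_coset_def)
    then obtain y where y: "\<And>i. i < k \<Longrightarrow> y i \<in> N \<and> xs ! i = gs ! i \<otimes>\<^bsub>G\<^esub> y i" by metis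
    have "xs = map2 (\<otimes>\<^bsub>G\<^esub>) gs (map y [0..<k])"
      using len y by (intro nth_equalityI) auto
    moreover have "map y [0..<k] \<in> tuples k N" using y by (auto simp: tuples_iff_nth)
    ultimately show ?thesis using hold by metis
  qed
  then have "virtual_law (G\<lparr>carrier := N\<rparr>) k \<phi>"
    using assms(2,3) N(1) gs unfolding transfers_def by blast
  then obtain L where L: "subgroup L (G\<lparr>carrier := N\<rparr>)" "finite_index (G\<lparr>carrier := N\<rparr>) L"
    "\<forall>xs\<in>tuples k L. holds (G\<lparr>carrier := N\<rparr>) \<phi> xs"
    by (auto simp: virtual_law_def)
  have "holds G \<phi> xs" if xs: "xs \<in> tuples k L" for xs
  proof -
    have "xs \<in> tuples k N" using xs subgroup.subset[OF L(1)] by (auto simp: tuples_def)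
    then show ?thesis
      using L(3) xs assms(1) gterm_val_subgroup[OF N(1)] by (cases \<phi>) fastforce
  qed
  then show "virtual_law G k \<phi>"
    unfolding virtual_law_def
    using incl_subgroup[OF N(1) L(1)] finite_index_trans[OF N(1) L(1) N(2) L(2)] by blast
next
  assume "virtual_law G k \<phi>"
  then show "degree_of_satisfiability G \<mu> k \<phi> > 0"
    using group.virtual_law_positive[OF assms(3,6,7)] by blast
qed

end
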